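(* Let $p\in\mathbb{C}[z_1,\ldots,z_d]$ admit a representation $p(z)=\det(I_{|n|}-KZ_n)$ for some $n\in\mathbb{N}_0^d$ and some contractive matrix $K\in\mathbb{C}^{|n|\times|n|}$ (i.e. $\|K\|\le1$ in operator norm). Then $$\frac{z^n\bar p(1/z)}{p(z)}=\det\left(-K^*+\sqrt{I-K^*K}\,Z_n(I-KZ_n)^{-1}\sqrt{I-KK^*}\right).$$ In particular, $p$ is an eventual Agler denominator of order $n$. If moreover $\deg p=n$, then $p$ is an Agler denominator.
   Context: For $n=(n_1,\ldots,n_d)\in\mathbb{N}_0^d$, $|n|=n_1+\cdots+n_d$, $Z_n=\bigoplus_{i=1}^d z_iI_{n_i}$, and $z^n=z_1^{n_1}\cdots z_d^{n_d}$. $\bar p(z):=\overline{p(\bar z)}$ (the polynomial with conjugated coefficients), and $1/z=(1/z_1,\ldots,1/z_d)$. The multi-degree $\deg p=(m_1,\ldots,m_d)$ has $m_i$ equal to the degree of $p$ as a polynomial in $z_i$. A polynomial is semi-stable if it has no zeros in the open polydisk $\mathbb{D}^d=\{z\in\mathbb{C}^d:|z_i|<1,\ i=1,\dots,d\}$. The (scalar) Schur--Agler class $\mathcal{SA}_d$ consists of analytic functions $f(z)=\sum_k f_kz^k$ on $\mathbb{D}^d$ such that $\sup_T\|f(T)\|\le1$, where the supremum is over all $d$-tuples $T=(T_1,\ldots,T_d)$ of commuting strict contractions on a common Hilbert space and $f(T)=\sum_k f_kT^k$. A semi-stable polynomial $p$ is an eventual Agler denominator of order $n\in\mathbb{N}_0^d$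 if $z^n\bar p(1/z)/p(z)$ is (a rational inner function) in $\mathcal{SA}_d$; it is an Agler denominator if $z^{\deg p}\bar p(1/z)/p(z)$ is in $\mathcal{SA}_d$. Square roots are the positive semidefinite square roots. *)

theory Defs
  imports
    "HOL-Analysis.Analysis"
    "HOL-Library.Poly_Mapping"
    "Jordan_Normal_Form.Gauss_Jordan_Elimination"
    "Jordan_Normal_Form.Schur_Decomposition"
begin

no_notation Matrix.vec_index (infixl "$" 100)

section \<open>Polynomials in d complex variables\<close>

text \<open>
  The variables are indexed by a type \<open>'d\<close> of class finite. A polynomial is its finitely
  supported family of coefficients, indexed by the multi-indices in \<open>nat ^ 'd\<close>.
\<close>

type_synonym 'd mpolynomial = "(nat ^ 'd) \<Rightarrow>\<^sub>0 complex"

definition monomial :: "complex ^ 'd::finite \<Rightarrow> nat ^ 'd \<Rightarrow> complex"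
  where "monomial z k = (\<Prod>i\<in>UNIV. z $ i ^ k $ i)"

definition peval :: "'d::finite mpolynomial \<Rightarrow> complex ^ 'd \<Rightarrow> complex"
  where "peval p z = (\<Sum>k\<in>Poly_Mapping.keys p. Poly_Mapping.lookup p k * monomial z k)"

definition conj_poly :: "'d::finite mpolynomial \<Rightarrow> 'd mpolynomial"
  where "conj_poly p = Poly_Mapping.map cnj p"

text \<open>The degree in each variable separately; by convention it is 0 for the zero polynomial.\<close>

definition multideg :: "'d::finite mpolynomial \<Rightarrow> nat ^ 'd"
  where "multideg p = (\<chi> i. Max (insert 0 ((\<lambda>k. k $ i) ` Poly_Mapping.keys p)))"

text \<open>
  The value at \<open>z\<close> of the Laurent polynomial \<open>z^n * conj_poly p (1/z)\<close>, multiplied out so that it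
  also makes sense at points with vanishing coordinates when \<open>multideg p \<le> n\<close>
  (see \<open>reflection_eq\<close> below). If the exponent of some \<open>z $ i\<close> is negative, the value at points
  with \<open>z $ i = 0\<close> is meaningless.
\<close>

definition reflection :: "nat ^ 'd \<Rightarrow> 'd::finite mpolynomial \<Rightarrow> complex ^ 'd \<Rightarrow> complex"
  where "reflection n p z =
    (\<Sum>k\<in>Poly_Mapping.keys (conj_poly p). Poly_Mapping.lookup (conj_poly p) k *
        (\<Prod>i\<in>UNIV. z $ i powi (int (n $ i) - int (k $ i))))"

lemma peval_conj_poly: "peval (conj_poly p) z = cnj (peval p (\<chi> i. cnj (z $ i)))"
proof -
  have keys: "Poly_Mapping.keys (conj_poly p) = Poly_Mapping.keys p"
    by (auto simp: conj_poly_def Poly_Mapping.keys.rep_eq Poly_Mapping.map.rep_eq when_def)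
  have lookup: "Poly_Mapping.lookup (conj_poly p) k = cnj (Poly_Mapping.lookup p k)" for k
    by (simp add: conj_poly_def Poly_Mapping.map.rep_eq when_def)
  show ?thesis
    by (simp add: peval_def keys lookup monomial_def)
qed

lemma reflection_eq:
  assumes "\<And>i. z $ i \<noteq> 0"
  shows "reflection n p z = monomial z n * peval (conj_poly p) (\<chi> i. 1 / z $ i)"
proof -
  have "(\<Prod>i\<in>UNIV. z $ i powi (int (n $ i) - int (k $ i))) =
      monomial z n * monomial (\<chi> i. 1 / z $ i) k" for k
    unfolding monomial_def prod.distrib [symmetric]
    by (rule prod.cong) (simp_all add: assms power_int_diff power_one_over)
  then show ?thesis
    by (simp add: reflection_def peval_def sum_distrib_left mult.left_commute)
qed

definition polydisk :: "(complex ^ 'd::finite) set"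
  where "polydisk = {z. \<forall>i. cmod (z $ i) < 1}"

definition semi_stable :: "'d::finite mpolynomial \<Rightarrow> bool"
  where "semi_stable p \<longleftrightarrow> (\<forall>z\<in>polydisk. peval p z \<noteq> 0)"


section \<open>Matrices\<close>

definition msize :: "nat ^ 'd::finite \<Rightarrow> nat"
  where "msize n = (\<Sum>i\<in>UNIV. n $ i)"

text \<open>The order on \<open>'d\<close> fixes the order of the diagonal blocks.\<close>

definition Zmat ::
    "nat ^ 'd::{finite,linorder} \<Rightarrow> complex ^ 'd::{finite,linorder} \<Rightarrow> complex mat"
  where "Zmat n z =
    diag_block_mat (map (\<lambda>i. z $ i \<cdot>\<^sub>m 1\<^sub>m (n $ i)) (sorted_list_of_set UNIV))"

definition cvec_norm :: "complex Matrix.vec \<Rightarrow> real"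
  where "cvec_norm v = sqrt (Re (v \<bullet>c v))"

definition mat_op_norm :: "complex mat \<Rightarrow> real"
  where "mat_op_norm A =
    (SUP v\<in>{v \<in> carrier_vec (dim_col A). cvec_norm v \<le> 1}. cvec_norm (A *\<^sub>v v))"

definition psd_mat :: "complex mat \<Rightarrow> bool"
  where "psd_mat A \<longleftrightarrow> square_mat A \<and> mat_adjoint A = A \<and>
    (\<forall>v\<in>carrier_vec (dim_row A). 0 \<le> Re ((A *\<^sub>v v) \<bullet>c v))"

text \<open>The positive semidefinite square root, meaningful for positive semidefinite matrices.\<close>

definition mat_sqrt :: "complex mat \<Rightarrow> complex mat"
  where "mat_sqrt A = (THE B. psd_mat B \<and> B * B = A)"


section \<open>The Schur--Agler class\<close>

class complex_hilbert = real_inner + complete_space +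
  fixes scaleC :: "complex \<Rightarrow> 'a \<Rightarrow> 'a" (infixr "*\<^sub>C" 75)
    and cinner :: "'a \<Rightarrow> 'a \<Rightarrow> complex"
  assumes scaleC_add_right: "a *\<^sub>C (x + y) = a *\<^sub>C x + a *\<^sub>C y"
    and scaleC_add_left: "(a + b) *\<^sub>C x = a *\<^sub>C x + b *\<^sub>C x"
    and scaleC_scaleC: "a *\<^sub>C b *\<^sub>C x = (a * b) *\<^sub>C x"
    and scaleC_of_real: "complex_of_real r *\<^sub>C x = r *\<^sub>R x"
    and cinner_commute: "cinner x y = cnj (cinner y x)"
    and cinner_add_left: "cinner (x + y) z = cinner x z + cinner y z"
    and cinner_scaleC_left: "cinner (a *\<^sub>C x) y = a * cinner x y"
    and Re_cinner: "Re (cinner x y) = inner x y"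

lemma norm_scaleC: "norm (a *\<^sub>C x) = cmod a * norm (x :: 'a::complex_hilbert)"
proof -
  have *: "norm y ^ 2 = Re (cinner y y)" for y :: 'a
    by (simp add: Re_cinner power2_norm_eq_inner)
  have "cinner (a *\<^sub>C x) (a *\<^sub>C x) = a * cnj a * cinner x x"
    by (metis cinner_commute cinner_scaleC_left complex_cnj_mult mult.assoc)
  then have "norm (a *\<^sub>C x) ^ 2 = (cmod a * norm x) ^ 2"
    by (simp add: * power_mult_distrib complex_mult_cnj cmod_power2)
  then show ?thesis
    by (simp add: power2_eq_iff_nonneg)
qed

lemma bounded_linear_scaleC:
  "bounded_linear (\<lambda>x :: 'a::complex_hilbert. a *\<^sub>C x)"
proof (rule bounded_linear_intro [where K = "cmod a"])
  show "a *\<^sub>C (r *\<^sub>R x) = r *\<^sub>R (a *\<^sub>C x)" for r and x :: 'a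
    by (metis mult.commute scaleC_of_real scaleC_scaleC)
qed (simp_all add: scaleC_add_right norm_scaleC mult.commute)

text \<open>
  Operators are elements of the library type of bounded real-linear maps; complex linearity is
  imposed separately.
\<close>

definition complex_linear :: "('h::complex_hilbert \<Rightarrow>\<^sub>L 'h) \<Rightarrow> bool"
  where "complex_linear A \<longleftrightarrow> (\<forall>a x. blinfun_apply A (a *\<^sub>C x) = a *\<^sub>C blinfun_apply A x)"

lift_definition scaleC_op :: "complex \<Rightarrow> ('h::complex_hilbert \<Rightarrow>\<^sub>L 'h) \<Rightarrow> ('h \<Rightarrow>\<^sub>L 'h)"
  is "\<lambda>a A x. a *\<^sub>C A x"
  by (rule bounded_linear_compose [OF bounded_linear_scaleC])

definition strict_contraction_tuples :: "('d::finite \<Rightarrow> ('h::complex_hilbert \<Rightarrow>\<^sub>L 'h)) set"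
  where "strict_contraction_tuples =
    {T. (\<forall>i. complex_linear (T i) \<and> norm (T i) < 1) \<and> (\<forall>i j. T i o\<^sub>L T j = T j o\<^sub>L T i)}"

definition op_power :: "('h::complex_hilbert \<Rightarrow>\<^sub>L 'h) \<Rightarrow> nat \<Rightarrow> ('h \<Rightarrow>\<^sub>L 'h)"
  where "op_power A m = (((o\<^sub>L) A) ^^ m) id_blinfun"

definition op_monomial ::
    "('d::{finite,linorder} \<Rightarrow> ('h::complex_hilbert \<Rightarrow>\<^sub>L 'h)) \<Rightarrow>
     nat ^ 'd::{finite,linorder} \<Rightarrow> ('h \<Rightarrow>\<^sub>L 'h)"
  where "op_monomial T k =
    foldr (\<lambda>i A. op_power (T i) (k $ i) o\<^sub>L A) (sorted_list_of_set UNIV) id_blinfun"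

text \<open>
  If the power series with coefficients \<open>c\<close> converges on the polydisk and \<open>T\<close> consists of strict
  contractions, then the series below converges absolutely in operator norm: it is dominated by
  the series with terms \<open>cmod (c k) * r ^ msize k\<close>, where \<open>r < 1\<close> bounds all \<open>norm (T i)\<close>.
\<close>

definition op_eval ::
    "(nat ^ 'd::{finite,linorder} \<Rightarrow> complex) \<Rightarrow>
     ('d::{finite,linorder} \<Rightarrow> ('h::complex_hilbert \<Rightarrow>\<^sub>L 'h)) \<Rightarrow> ('h \<Rightarrow>\<^sub>L 'h)"
  where "op_eval c T = (\<Sum>\<^sub>\<infinity>k. scaleC_op (c k) (op_monomial T k))"

text \<open>
  HOL cannot quantify over all Hilbert spaces inside a definition, so the Hilbert space is a type
  parameter. Only the values of \<open>f\<close> on the polydisk matter.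
\<close>

definition schur_agler ::
    "'h::complex_hilbert itself \<Rightarrow> (complex ^ 'd::{finite,linorder} \<Rightarrow> complex) set"
  where "schur_agler _ = {f. \<exists>c.
    (\<forall>z\<in>polydisk. ((\<lambda>k. c k * monomial z k) has_sum f z) UNIV) \<and>
    (SUP T\<in>strict_contraction_tuples.
        ennreal (norm (op_eval c (T :: 'd \<Rightarrow> ('h \<Rightarrow>\<^sub>L 'h))))) \<le> 1}"

text \<open>
  The rational function \<open>z^n * conj_poly p (1/z) / p z\<close> belongs to the Schur--Agler class if it
  coincides there, off the coordinate hyperplanes where \<open>1/z\<close> is undefined, with a member of the
  class.
\<close>

definition eventual_agler_denominator ::
    "'h::complex_hilbert itself \<Rightarrow> nat ^ 'd::{finite,linorder} \<Rightarrow>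
     'd::{finite,linorder} mpolynomial \<Rightarrow> bool"
  where "eventual_agler_denominator H n p \<longleftrightarrow> semi_stable p \<and>
    (\<exists>f\<in>schur_agler H. \<forall>z\<in>polydisk. (\<forall>i. z $ i \<noteq> 0) \<longrightarrow>
        f z = monomial z n * peval (conj_poly p) (\<chi> i. 1 / z $ i) / peval p z)"

definition agler_denominator ::
    "'h::complex_hilbert itself \<Rightarrow> 'd::{finite,linorder} mpolynomial \<Rightarrow> bool"
  where "agler_denominator H p \<longleftrightarrow> eventual_agler_denominator H (multideg p) p"

end

theory Submission
  imports Defs "HOL-Real_Asymp.Real_Asymp"
begin

text \<open>
  Let \<open>D\<close> and \<open>E\<close> be the defect operators of the contraction \<open>K\<close>. Since \<open>K\<close> intertwines them, the
  transfer function \<open>G(z) = - K* + D Z (1 - K Z)^{-1} E\<close> satisfies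
  \<open>det G(z) = det (Z - K*) / det (1 - K Z)\<close>, and the numerator is \<open>z^n * conj_poly p (1/z)\<close>.
  As the Julia operator of \<open>K\<close> is unitary, \<open>G(T)\<close> is a contraction for every tuple \<open>T\<close> of commuting
  strict contractions. Its entries commute, so \<open>det G(T)\<close> is the restriction of a product of
  contractions, one for each factor of the tensor power, to the antisymmetric tensors.
  The operator \<open>G(T)\<close> is written as \<open>V g(T)\<close> with a matrix \<open>g\<close> of polynomials, where \<open>V\<close> is the
  sum of the power series of \<open>1/p\<close> at \<open>T\<close>; the roots of \<open>x \<mapsto> p (x z)\<close> and Cauchy estimates on the
  torus show that this series converges.
\<close>

section \<open>Evaluation of polynomials and averages over the torus\<close>

text \<open>Write K' for the adjoint of K and A = 1 - K Z. The determinant formula comes from one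
  cancellation: K D = E K gives D K' = K' E, hence D G = (D^2 Z - K' A) A^-1 E = (Z - K') A^-1 E,
  and det D = det E because K' K and K K' have the same characteristic polynomial. Only
  contractivity of K is assumed, so \<open>p\<close> may vanish on the torus. This has two effects.
  Matrix identities that are later read with polynomial entries use the adjugate of A and never
  divide by det A. And 1/p need not be bounded on the torus; but each homogeneous part of its power
  series is bounded there by a polynomial in the degree, which suffices since strict contractions
  contribute a geometric factor. The tensor power is used for its sharp constant: expanding det G(T)
  entrywise would lose a factor depending on the size, whereas the antisymmetric tensor and its
  image both live on the injective index maps, each with components of equal norm, so that the
  number of these maps cancels.\<close>

definition coeff_sum :: "('k \<Rightarrow> complex \<Rightarrow> 'b::ab_group_add) \<Rightarrow> ('k \<Rightarrow>\<^sub>0 complex) \<Rightarrow> 'b"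
  where "coeff_sum f p = (\<Sum>k\<in>Poly_Mapping.keys p. f k (Poly_Mapping.lookup p k))"

lemma coeff_sum_superset:
  assumes "\<And>k. f k 0 = 0" "finite S" "Poly_Mapping.keys p \<subseteq> S"
  shows "coeff_sum f p = (\<Sum>k\<in>S. f k (Poly_Mapping.lookup p k))"
  unfolding coeff_sum_def
  by (rule sum.mono_neutral_left) (use assms in \<open>auto simp: in_keys_iff\<close>)

lemma coeff_sum_single:
  assumes "\<And>k. f k 0 = 0"
  shows "coeff_sum f (Poly_Mapping.single k a) = f k a"
  by (subst coeff_sum_superset[where S = "{k}"]) (use assms in auto)

lemma coeff_sum_add:
  assumes add: "\<And>k a b. f k (a + b) = f k a + f k b"
  shows "coeff_sum f (p + q) = coeff_sum f p + coeff_sum f q"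
proof -
  have z: "f k 0 = 0" for k
    using add[of k 0 0] by simp
  let ?S = "Poly_Mapping.keys p \<union> Poly_Mapping.keys q"
  have "Poly_Mapping.keys (p + q) \<subseteq> ?S"
    by (rule keys_add)
  then show ?thesis
    by (simp add: coeff_sum_superset[of f ?S, OF z] lookup_add add sum.distrib)
qed

lemma mpoly_induct [case_names zero single add]:
  fixes p :: "'k \<Rightarrow>\<^sub>0 'a::comm_monoid_add"
  assumes "P 0" "\<And>k a. P (Poly_Mapping.single k a)" "\<And>p q. P p \<Longrightarrow> P q \<Longrightarrow> P (p + q)"
  shows "P p"
proof (induction p rule: update_induct)
  case const
  show ?case by (rule assms(1))
next
  case (update f a b)
  have "Poly_Mapping.update a b f = f + Poly_Mapping.single a b"
    using update(1)
    by (intro poly_mapping_eqI) (auto simp: lookup_update lookup_add lookup_single when_def in_keys_iff)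
  then show ?case
    using assms(2,3) update by simp
qed

text \<open>Stated for an arbitrary biadditive \<open>mul\<close> because it serves twice: with
  multiplication of numbers for \<open>peval\<close> and with composition of operators for
  \<open>poly_op\<close>. Biadditivity reduces it to single terms.\<close>

lemma coeff_sum_mult:
  fixes f :: "'k::comm_monoid_add \<Rightarrow> complex \<Rightarrow> 'b::ab_group_add"
  assumes add: "\<And>k a b. f k (a + b) = f k a + f k b"
    and mul: "\<And>j k a b. f (j + k) (a * b) = mul (f j a) (f k b)"
    and mull: "\<And>x y z. mul (x + y) z = mul x z + mul y z"
    and mulr: "\<And>x y z. mul x (y + z) = mul x y + mul x z"
  shows "coeff_sum f (p * q) = mul (coeff_sum f p) (coeff_sum f q)"
proof -
  have z: "f k 0 = 0" for k
    using add[of k 0 0] by simp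
  have m0: "mul 0 y = 0" "mul y 0 = 0" for y
    using mull[of 0 0 y] mulr[of y 0 0] by simp_all
  have "coeff_sum f (Poly_Mapping.single k a * q) = mul (f k a) (coeff_sum f q)" for k a
  proof (induction q rule: mpoly_induct)
    case zero
    show ?case by (simp add: coeff_sum_def m0)
  next
    case (single k a)
    show ?case by (simp add: mult_single coeff_sum_single z mul)
  next
    case (add p q)
    then show ?case by (simp add: distrib_left coeff_sum_add assms)
  qed
  then show ?thesis
  proof (induction p rule: mpoly_induct)
    case zero
    show ?case by (simp add: coeff_sum_def m0)
  next
    case (single k a)
    then show ?case by (simp add: coeff_sum_single z)
  next
    case (add p q)
    then show ?case by (simp add: distrib_right coeff_sum_add assms)
  qed
qed

lemma monomial_0 [simp]: "monomial z 0 = 1"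
  by (simp add: monomial_def)

lemma monomial_add: "monomial z (j + k) = monomial z j * monomial z k"
  by (simp add: monomial_def power_add prod.distrib)

lemma monomial_axis [simp]: "monomial z (axis i 1) = z $ i"
proof -
  have "monomial z (axis i 1) = (\<Prod>j\<in>UNIV. if j = i then z $ j else 1)"
    unfolding monomial_def by (rule prod.cong) (auto simp: axis_def)
  then show ?thesis by simp
qed

lemma peval_eq_coeff_sum: "peval p z = coeff_sum (\<lambda>k a. a * monomial z k) p"
  by (simp add: peval_def coeff_sum_def)

lemma peval_single [simp]: "peval (Poly_Mapping.single k a) z = a * monomial z k"
  by (simp add: peval_eq_coeff_sum coeff_sum_single)

lemma peval_add: "peval (p + q) z = peval p z + peval q z"
  by (simp add: peval_eq_coeff_sum coeff_sum_add distrib_right)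

lemma peval_mult: "peval (p * q) z = peval p z * peval q z"
  unfolding peval_eq_coeff_sum
  by (rule coeff_sum_mult) (simp_all add: monomial_add algebra_simps)

interpretation peval_hom: comm_ring_hom "\<lambda>p. peval p z" for z
  by unfold_locales (simp_all add: peval_add peval_mult, simp_all add: peval_def)

section \<open>Fourier inversion and Cauchy estimates on the torus\<close>

lemma cis_eq_1_iff: "cis x = 1 \<longleftrightarrow> (\<exists>n::int. x = 2 * pi * of_int n)"
  by (auto simp: cis_conv_exp exp_eq_1 ac_simps)

definition torus_point :: "nat \<Rightarrow> ('d \<Rightarrow> nat) \<Rightarrow> complex ^ 'd::finite"
  where "torus_point L t = (\<chi> i. cis (2 * pi * real (t i) / real L))"

text \<open>The summand is w^t with w = cis (2 pi (j - k) / L). As |j - k| < L, w is 1 only for j =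
  k; otherwise the geometric sum vanishes because w^L = 1.\<close>

lemma sum_roots_of_unity:
  assumes "j < L" "k < L"
  shows "(\<Sum>t<L. cis (2 * pi * real t / real L) ^ j * cnj (cis (2 * pi * real t / real L) ^ k)) =
    (if j = k then of_nat L else 0)"
proof (cases "j = k")
  case True
  then show ?thesis
    by (simp add: Complex.DeMoivre cis_mult cis_cnj)
next
  case False
  define w where "w = cis (2 * pi * (real j - real k) / real L)"
  have L: "L > 0" using assms by simp
  have wt: "cis (2 * pi * real t / real L) ^ j * cnj (cis (2 * pi * real t / real L) ^ k) = w ^ t" for t
    unfolding w_def by (simp add: Complex.DeMoivre cis_cnj cis_mult) (simp add: algebra_simps diff_divide_distrib)
  have "w \<noteq> 1"
  proof
    assume "w = 1"
    then obtain n :: int where "2 * pi * (real j - real k) / real L = 2 * pi * of_int n"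
      by (auto simp: w_def cis_eq_1_iff)
    then have "(2 * pi) * ((real j - real k) / real L) = (2 * pi) * of_int n"
      by simp
    then have "(real j - real k) / real L = of_int n"
      by (simp only: mult_cancel_left) simp
    then have "real j - real k = of_int n * real L"
      using L by (simp add: divide_eq_eq)
    then have *: "int j - int k = n * int L"
      unfolding of_int_eq_iff [where 'a = real, symmetric] by simp
    have "\<bar>n\<bar> * int L = \<bar>int j - int k\<bar>"
      by (simp add: * abs_mult)
    also have "\<dots> < 1 * int L"
      using assms by linarith
    finally have "n = 0"
      using L by (simp only: mult_less_cancel_right) auto
    with * False show False by simp
  qed
  moreover have "w ^ L = 1"
    using L by (auto simp: w_def Complex.DeMoivre cis_eq_1_iff intro!: exI[of _ "int j - int k"])
  ultimately show ?thesis
    using False by (simp add: wt geometric_sum del: complex_cnj_power)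
qed

lemma norm_torus_point [simp]: "cmod (torus_point L t $ i) = 1"
  by (simp add: torus_point_def)

text \<open>Discrete Fourier inversion on the grid of \<open>L\<close>-th roots of unity. With
  \<open>L\<close> above all exponents there is no aliasing, so a finite sum does the work of the
  Cauchy integral.\<close>

lemma coeff_eq_torus_average:
  fixes p :: "'d::finite mpolynomial"
  assumes keys: "\<And>j i. j \<in> Poly_Mapping.keys p \<Longrightarrow> j $ i < L" and k: "\<And>i. k $ i < L"
  shows "(\<Sum>t\<in>Pi\<^sub>E UNIV (\<lambda>_. {..<L}). peval p (torus_point L t) * cnj (monomial (torus_point L t) k)) =
    of_nat L ^ CARD('d) * Poly_Mapping.lookup p k"
proof -
  let ?c = "\<lambda>t. cis (2 * pi * real t / real L)"
  have *: "(\<Sum>t\<in>Pi\<^sub>E UNIV (\<lambda>_. {..<L}). monomial (torus_point L t) j * cnj (monomial (torus_point L t) k)) =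
      (if j = k then of_nat L ^ CARD('d) else 0)" if "\<And>i. j $ i < L" for j
  proof -
    have "(\<Sum>t\<in>Pi\<^sub>E UNIV (\<lambda>_. {..<L}). monomial (torus_point L t) j * cnj (monomial (torus_point L t) k)) =
        (\<Sum>t\<in>Pi\<^sub>E UNIV (\<lambda>_. {..<L}). \<Prod>i\<in>UNIV. ?c (t i) ^ j $ i * cnj (?c (t i) ^ k $ i))"
      by (simp add: monomial_def torus_point_def prod.distrib)
    also have "\<dots> = (\<Prod>i\<in>UNIV. \<Sum>t<L. ?c t ^ j $ i * cnj (?c t ^ k $ i))"
      by (rule prod_sum_PiE [symmetric]) auto
    also have "\<dots> = (\<Prod>i\<in>UNIV. if j $ i = k $ i then of_nat L else 0)"
      by (intro prod.cong refl sum_roots_of_unity that k)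
    also have "\<dots> = (if j = k then of_nat L ^ CARD('d) else 0)"
      by (auto simp: Finite_Cartesian_Product.vec_eq_iff)
    finally show ?thesis .
  qed
  have "(\<Sum>t\<in>Pi\<^sub>E UNIV (\<lambda>_. {..<L}). peval p (torus_point L t) * cnj (monomial (torus_point L t) k)) =
      (\<Sum>j\<in>Poly_Mapping.keys p. Poly_Mapping.lookup p j * (\<Sum>t\<in>Pi\<^sub>E UNIV (\<lambda>_. {..<L}).
        monomial (torus_point L t) j * cnj (monomial (torus_point L t) k)))"
    unfolding peval_def sum_distrib_left sum_distrib_right mult.assoc by (rule sum.swap)
  also have "\<dots> = (\<Sum>j\<in>Poly_Mapping.keys p. if j = k then of_nat L ^ CARD('d) * Poly_Mapping.lookup p j else 0)"
    by (rule sum.cong) (auto simp: * keys)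
  also have "\<dots> = of_nat L ^ CARD('d) * Poly_Mapping.lookup p k"
    by (auto simp: in_keys_iff)
  finally show ?thesis .
qed

lemma cmod_monomial_torus: "(\<And>i. cmod (z $ i) = 1) \<Longrightarrow> cmod (monomial z k) = 1"
  by (simp add: monomial_def norm_power flip: prod_norm)

lemma exists_degree_bound:
  fixes p :: "'d::finite mpolynomial" and k :: "nat ^ 'd"
  obtains L where "L > 0" "\<And>j i. j \<in> Poly_Mapping.keys p \<Longrightarrow> j $ i < L" "\<And>i. k $ i < L"
proof -
  define S where "S = (\<lambda>(j, i). j $ i) ` (insert k (Poly_Mapping.keys p) \<times> UNIV)"
  have "finite S" unfolding S_def by simp
  then have "x < Suc (Max S)" if "x \<in> S" for x
    using that by (simp add: less_Suc_eq_le)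
  then show thesis
    by (intro that[of "Suc (Max S)"]) (auto simp: S_def)
qed

text \<open>Cauchy's estimate: the coefficient is an average of values of \<open>p\<close> times
  unimodular numbers.\<close>

lemma cmod_coeff_le:
  fixes p :: "'d::finite mpolynomial"
  assumes B: "\<And>z. (\<And>i. cmod (z $ i) = 1) \<Longrightarrow> cmod (peval p z) \<le> B"
  shows "cmod (Poly_Mapping.lookup p k) \<le> B"
proof -
  obtain L where L: "L > 0" "\<And>j i. j \<in> Poly_Mapping.keys p \<Longrightarrow> j $ i < L" "\<And>i. k $ i < L"
    using exists_degree_bound[of p k] by blast
  have "real L ^ CARD('d) * cmod (Poly_Mapping.lookup p k) =
      cmod (\<Sum>t\<in>Pi\<^sub>E UNIV (\<lambda>_. {..<L}). peval p (torus_point L t) * cnj (monomial (torus_point L t) k))"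
    by (subst coeff_eq_torus_average) (simp_all add: L norm_mult norm_power)
  also have "\<dots> \<le> (\<Sum>t\<in>Pi\<^sub>E (UNIV :: 'd set) (\<lambda>_. {..<L}). B)"
    by (rule sum_norm_le) (simp add: norm_mult cmod_monomial_torus B)
  also have "\<dots> = real L ^ CARD('d) * B"
    by (simp add: card_PiE)
  finally show ?thesis
    using L(1) by simp
qed

text \<open>The Cauchy estimate with bound 0. Testing on the torus keeps all coordinates nonzero, so
  reciprocals of the variables may occur in the test.\<close>

lemma mpoly_eqI_torus:
  fixes p q :: "'d::finite mpolynomial"
  assumes "\<And>z. (\<And>i. cmod (z $ i) = 1) \<Longrightarrow> peval p z = peval q z"
  shows "p = q"
proof (rule poly_mapping_eqI)
  fix k
  have "cmod (Poly_Mapping.lookup (p - q) k) \<le> 0"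
    by (rule cmod_coeff_le) (simp add: peval_hom.hom_minus assms)
  then show "Poly_Mapping.lookup p k = Poly_Mapping.lookup q k"
    by (simp add: lookup_minus)
qed

section \<open>Power series of the reciprocal of a polynomial\<close>

text \<open>Coefficients of the product of the polynomial \<open>q\<close> with the formal power
  series \<open>c\<close>. The guard \<open>j \<le> k\<close> is essential, as subtraction of
  natural vectors truncates at 0.\<close>

definition conv_coeff :: "'d::finite mpolynomial \<Rightarrow> (nat ^ 'd \<Rightarrow> complex) \<Rightarrow> nat ^ 'd \<Rightarrow> complex"
  where "conv_coeff q c k =
    (\<Sum>j\<in>Poly_Mapping.keys q. if j \<le> k then Poly_Mapping.lookup q j * c (k - j) else 0)"

lemma nat_vec_le_iff: "j \<le> k \<longleftrightarrow> (\<exists>l. k = j + l)" for j k :: "nat ^ 'd::finite"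
proof
  assume "j \<le> k"
  then have "k = j + (k - j)"
    by (simp add: Finite_Cartesian_Product.vec_eq_iff Finite_Cartesian_Product.less_eq_vec_def)
  then show "\<exists>l. k = j + l" ..
qed (auto simp: Finite_Cartesian_Product.less_eq_vec_def)

lemma nat_vec_add_diff [simp]: "j + (k - j) = k" if "j \<le> k" for j k :: "nat ^ 'd::finite"
  using that by (simp add: Finite_Cartesian_Product.vec_eq_iff Finite_Cartesian_Product.less_eq_vec_def)

lemma nat_vec_diff_add [simp]: "(j + k) - j = k" for j k :: "nat ^ 'd::finite"
  by (simp add: Finite_Cartesian_Product.vec_eq_iff)

lemma msize_0 [simp]: "msize 0 = 0"
  by (simp add: msize_def)

lemma msize_add: "msize (j + k) = msize j + msize k"
  by (simp add: msize_def sum.distrib)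

lemma msize_diff: "j \<le> k \<Longrightarrow> msize (k - j) = msize k - msize j"
  by (metis add_diff_cancel_left' msize_add nat_vec_add_diff)

lemma msize_eq_0_iff [simp]: "msize k = 0 \<longleftrightarrow> k = 0"
  by (auto simp: msize_def Finite_Cartesian_Product.vec_eq_iff)

lemma component_le_msize: "k $ i \<le> msize k"
  unfolding msize_def by (rule member_le_sum) auto

lemma finite_nat_vec_bounded: "finite {k :: nat ^ 'd::finite. \<forall>i. k $ i \<le> L}"
proof (rule finite_subset)
  show "{k :: nat ^ 'd. \<forall>i. k $ i \<le> L} \<subseteq> vec_lambda ` (Pi\<^sub>E UNIV (\<lambda>_. {..L}))"
  proof
    fix k :: "nat ^ 'd"
    assume "k \<in> {k. \<forall>i. k $ i \<le> L}"
    then have "(\<lambda>i. k $ i) \<in> Pi\<^sub>E UNIV (\<lambda>_. {..L})"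
      by auto
    then show "k \<in> vec_lambda ` (Pi\<^sub>E UNIV (\<lambda>_. {..L}))"
      by (rule rev_image_eqI) simp
  qed
qed (intro finite_imageI finite_PiE, auto)

lemma finite_msize_eq [simp]: "finite {k :: nat ^ 'd::finite. msize k = m}"
  by (rule finite_subset[OF _ finite_nat_vec_bounded[of m]]) (auto simp: component_le_msize)

lemma finite_nat_vec_le [simp]: "finite {j. j \<le> k}" for k :: "nat ^ 'd::finite"
  by (rule finite_subset[OF _ finite_nat_vec_bounded[of "msize k"]])
    (auto simp: Finite_Cartesian_Product.less_eq_vec_def intro: order.trans component_le_msize)

lemma has_sum_finite_sum:
  fixes f :: "'i \<Rightarrow> 'a \<Rightarrow> 'b::topological_comm_monoid_add"
  assumes "finite I" "\<And>i. i \<in> I \<Longrightarrow> (f i has_sum S i) A"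
  shows "((\<lambda>x. \<Sum>i\<in>I. f i x) has_sum (\<Sum>i\<in>I. S i)) A"
  using assms by (induction I rule: finite_induct) (auto intro: has_sum_add)

text \<open>Multiplication by one monomial is a shift of the index set, extended by zero terms; only
  finitely many monomials of \<open>q\<close> are then added, so no double series is rearranged. The
  parameters cover numbers (\<open>M j\<close> multiplies by a monomial) and operators
  (\<open>M j\<close> composes with one).\<close>

lemma conv_coeff_has_sum:
  fixes sc :: "complex \<Rightarrow> 'b::real_normed_vector \<Rightarrow> 'b" and m :: "nat ^ 'd::finite \<Rightarrow> 'b"
  assumes add: "\<And>a b x. sc (a + b) x = sc a x + sc b x"
    and mult: "\<And>a b x. sc a (sc b x) = sc (a * b) x"
    and bl: "\<And>a. bounded_linear (sc a)" "\<And>j. bounded_linear (M j)"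
    and Msc: "\<And>j k a. M j (sc a (m k)) = sc a (M j (m k))"
    and Mm: "\<And>j k. M j (m k) = m (j + k)"
    and S: "((\<lambda>k. sc (c k) (m k)) has_sum S) UNIV"
  shows "((\<lambda>k. sc (conv_coeff q c k) (m k)) has_sum
    (\<Sum>j\<in>Poly_Mapping.keys q. sc (Poly_Mapping.lookup q j) (M j S))) UNIV"
proof -
  have sc0: "sc 0 x = 0" for x
    using add[of 0 0 x] by simp
  have sc_sum: "sc (\<Sum>i\<in>I. h i) x = (\<Sum>i\<in>I. sc (h i) x)" for h :: "nat ^ 'd \<Rightarrow> complex" and I x
    by (induction I rule: infinite_finite_induct) (auto simp: sc0 add)
  let ?q = "Poly_Mapping.lookup q"
  have "((\<lambda>k. if j \<le> k then sc (?q j * c (k - j)) (m k) else 0) has_sum sc (?q j) (M j S)) UNIV" for j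
  proof -
    have "((\<lambda>k. sc (?q j) (M j (sc (c k) (m k)))) has_sum sc (?q j) (M j S)) UNIV"
      by (intro has_sum_bounded_linear[OF bl(1)] has_sum_bounded_linear[OF bl(2)] S)
    also have "(\<lambda>k. sc (?q j) (M j (sc (c k) (m k)))) = (\<lambda>k. sc (?q j * c (k - j)) (m k)) \<circ> (+) j"
      by (auto simp: Msc Mm mult)
    also have "(\<dots> has_sum sc (?q j) (M j S)) UNIV \<longleftrightarrow>
        ((\<lambda>k. sc (?q j * c (k - j)) (m k)) has_sum sc (?q j) (M j S)) (range ((+) j))"
      by (rule has_sum_reindex [symmetric]) simp
    also have "\<dots> \<longleftrightarrow> ?thesis"
      by (rule has_sum_cong_neutral) (auto simp: nat_vec_le_iff)
    finally show ?thesis .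
  qed
  then have "((\<lambda>k. \<Sum>j\<in>Poly_Mapping.keys q. if j \<le> k then sc (?q j * c (k - j)) (m k) else 0)
      has_sum (\<Sum>j\<in>Poly_Mapping.keys q. sc (?q j) (M j S))) UNIV"
    by (intro has_sum_finite_sum) auto
  also have "(\<lambda>k. \<Sum>j\<in>Poly_Mapping.keys q. if j \<le> k then sc (?q j * c (k - j)) (m k) else 0) =
      (\<lambda>k. sc (conv_coeff q c k) (m k))"
    by (auto simp: conv_coeff_def sc_sum sc0 intro!: ext sum.cong)
  finally show ?thesis .
qed

text \<open>The formal reciprocal of \<open>p\<close> when its constant coefficient is 1: the
  equation \<open>conv_coeff p c k = 0\<close> for nonzero \<open>k\<close>, solved for the term
  \<open>c k\<close> at \<open>j = 0\<close>.\<close>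

function inverse_coeff :: "'d::finite mpolynomial \<Rightarrow> nat ^ 'd \<Rightarrow> complex" where
  "inverse_coeff p k = (if k = 0 then 1 else
    - (\<Sum>j\<in>Poly_Mapping.keys p. if j \<noteq> 0 \<and> j \<le> k then Poly_Mapping.lookup p j * inverse_coeff p (k - j) else 0))"
  by auto
termination
proof (relation "Wellfounded.measure (\<lambda>(p, k). msize k)", goal_cases)
  case (2 p k j)
  then have "msize (k - j) = msize k - msize j" "msize j \<noteq> 0" "msize k \<noteq> 0"
    by (auto simp: msize_diff)
  then have "msize (k - j) < msize k"
    by linarith
  then show ?case
    by simp
qed simp

declare inverse_coeff.simps [simp del]

lemma inverse_coeff_0 [simp]: "inverse_coeff p 0 = 1"
  by (simp add: inverse_coeff.simps)

lemma conv_coeff_inverse_coeff: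
  assumes p0: "Poly_Mapping.lookup p 0 = 1"
  shows "conv_coeff p (inverse_coeff p) k = (if k = 0 then 1 else 0)"
proof -
  have k0: "0 \<in> Poly_Mapping.keys p"
    by (simp add: in_keys_iff p0)
  let ?g = "\<lambda>j. if j \<le> k then Poly_Mapping.lookup p j * inverse_coeff p (k - j) else 0"
  have le0: "0 \<le> k" "j \<le> 0 \<longleftrightarrow> j = 0" for j :: "nat ^ 'd"
    by (auto simp: Finite_Cartesian_Product.less_eq_vec_def Finite_Cartesian_Product.vec_eq_iff)
  have k_minus_0: "k - 0 = k"
    using nat_vec_diff_add[of 0 k] by simp
  have "conv_coeff p (inverse_coeff p) k = ?g 0 + (\<Sum>j\<in>Poly_Mapping.keys p - {0}. ?g j)"
    unfolding conv_coeff_def by (rule sum.remove) (simp_all add: k0)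
  also have "?g 0 = inverse_coeff p k"
    by (simp add: le0 p0 k_minus_0)
  finally have *: "conv_coeff p (inverse_coeff p) k =
    inverse_coeff p k + (\<Sum>j\<in>Poly_Mapping.keys p - {0}. ?g j)" .
  show ?thesis
  proof (cases "k = 0")
    case True
    then show ?thesis
      unfolding * by (auto simp: le0 intro!: sum.neutral)
  next
    case False
    have "inverse_coeff p k = - (\<Sum>j\<in>Poly_Mapping.keys p. if j \<noteq> 0 \<and> j \<le> k
        then Poly_Mapping.lookup p j * inverse_coeff p (k - j) else 0)"
      using False by (subst inverse_coeff.simps) simp
    also have "(\<Sum>j\<in>Poly_Mapping.keys p. if j \<noteq> 0 \<and> j \<le> k
        then Poly_Mapping.lookup p j * inverse_coeff p (k - j) else 0) = (\<Sum>j\<in>Poly_Mapping.keys p - {0}. ?g j)"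
      by (rule sum.mono_neutral_cong_right) auto
    finally show ?thesis
      unfolding * using False by simp
  qed
qed

text \<open>The coefficient of x^m in the series with coefficients \<open>c\<close> evaluated at x
  z. Restriction to complex lines reduces the reciprocal to power series in one variable.\<close>

definition hom_part :: "complex ^ 'd::finite \<Rightarrow> (nat ^ 'd \<Rightarrow> complex) \<Rightarrow> nat \<Rightarrow> complex"
  where "hom_part z c m = (\<Sum>k | msize k = m. c k * monomial z k)"

lemma hom_part_conv_coeff:
  fixes z :: "complex ^ 'd::finite"
  shows "hom_part z (conv_coeff p c) m = (\<Sum>i\<le>m. hom_part z (Poly_Mapping.lookup p) i * hom_part z c (m - i))"
proof -
  let ?p = "Poly_Mapping.lookup p"
  have conv: "conv_coeff p c k = (\<Sum>j | j \<le> k. ?p j * c (k - j))" for k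
  proof -
    have "(\<Sum>j | j \<le> k. ?p j * c (k - j)) = (\<Sum>j\<in>Poly_Mapping.keys p \<inter> {j. j \<le> k}. ?p j * c (k - j))"
      by (rule sum.mono_neutral_right) (auto simp: in_keys_iff)
    then show ?thesis
      unfolding conv_coeff_def by (simp add: sum.inter_restrict)
  qed
  have "hom_part z (conv_coeff p c) m =
      (\<Sum>k | msize k = m. \<Sum>j | j \<le> k. (?p j * monomial z j) * (c (k - j) * monomial z (k - j)))"
    unfolding hom_part_def conv sum_distrib_right
  proof (intro sum.cong refl)
    fix k j :: "nat ^ 'd"
    assume "j \<in> {j. j \<le> k}"
    then have "monomial z k = monomial z j * monomial z (k - j)"
      by (simp flip: monomial_add)
    then show "?p j * c (k - j) * monomial z k = (?p j * monomial z j) * (c (k - j) * monomial z (k - j))"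
      by simp
  qed
  also have "\<dots> = (\<Sum>(k, j)\<in>Sigma {k. msize k = m} (\<lambda>k. {j. j \<le> k}).
      (?p j * monomial z j) * (c (k - j) * monomial z (k - j)))"
    by (rule sum.Sigma) auto
  also have "\<dots> = (\<Sum>(i, j, l)\<in>Sigma {..m} (\<lambda>i. {j. msize j = i} \<times> {l. msize l = m - i}).
      (?p j * monomial z j) * (c l * monomial z l))"
    by (rule sum.reindex_bij_witness[where i = "\<lambda>(i, j, l). (j + l, j)" and j = "\<lambda>(k, j). (msize j, j, k - j)"])
      (auto simp: msize_add msize_diff nat_vec_le_iff)
  also have "\<dots> = (\<Sum>i\<le>m. \<Sum>(j, l)\<in>{j. msize j = i} \<times> {l. msize l = m - i}.
      (?p j * monomial z j) * (c l * monomial z l))"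
    by (rule sum.Sigma [symmetric]) auto
  also have "\<dots> = (\<Sum>i\<le>m. hom_part z ?p i * hom_part z c (m - i))"
    by (simp add: hom_part_def sum_product sum.cartesian_product)
  finally show ?thesis .
qed

lemma geometric_fps_inverse:
  "fps_of_poly [:1, - x:] * Abs_fps (\<lambda>m. x ^ m) = 1" for x :: complex
proof (rule fps_ext)
  fix n
  show "fps_nth (fps_of_poly [:1, - x:] * Abs_fps (\<lambda>m. x ^ m)) n = fps_nth 1 n"
    by (cases n) (simp_all add: fps_of_poly_pCons distrib_right mult.assoc)
qed

text \<open>Each further geometric series turns a coefficient into a sum of m + 1 terms, each within
  the previous bound; this is the origin of the growth rate (m + 1)^N.\<close>

lemma cmod_prod_geometric_fps_le:
  assumes "\<And>x. x \<in> set xs \<Longrightarrow> cmod x \<le> 1"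
  shows "cmod (fps_nth (\<Prod>x\<leftarrow>xs. Abs_fps (\<lambda>m. x ^ m)) m) \<le> real (m + 1) ^ length xs"
  using assms
proof (induction xs arbitrary: m)
  case Nil
  then show ?case by simp
next
  case (Cons x xs)
  let ?g = "\<Prod>x\<leftarrow>xs. Abs_fps (\<lambda>m. x ^ m)"
  have "cmod (fps_nth (Abs_fps (\<lambda>m. x ^ m) * ?g) m) \<le> (\<Sum>i=0..m. real (m + 1) ^ length xs)"
    unfolding fps_mult_nth
  proof (rule sum_norm_le)
    fix i assume i: "i \<in> {0..m}"
    have "cmod (x ^ i) \<le> 1"
      using Cons.prems[of x] by (simp add: norm_power power_le_one)
    moreover have "cmod (fps_nth ?g (m - i)) \<le> real (m - i + 1) ^ length xs"
      using Cons.prems by (intro Cons.IH) auto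
    moreover have "real (m - i + 1) ^ length xs \<le> real (m + 1) ^ length xs"
      by (intro power_mono) auto
    ultimately have "cmod (x ^ i) * cmod (fps_nth ?g (m - i)) \<le> 1 * real (m + 1) ^ length xs"
      by (intro mult_mono) auto
    then show "cmod (fps_nth (Abs_fps (\<lambda>m. x ^ m)) i * fps_nth ?g (m - i)) \<le> real (m + 1) ^ length xs"
      by (simp add: norm_mult)
  qed
  then show ?case
    by simp
qed

text \<open>Along the line through \<open>z\<close> the polynomial \<open>p\<close> becomes the
  product of the factors 1 - x a. Both sides are coefficients of an inverse of this one power
  series, and an inverse is unique.\<close>

lemma hom_part_inverse_coeff_eq:
  fixes p :: "'d::finite mpolynomial"
  assumes p: "\<And>x. peval p (\<chi> i. x * z $ i) = (\<Prod>a\<leftarrow>xs. 1 - x * a)"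
    and p0: "Poly_Mapping.lookup p 0 = 1"
  shows "hom_part z (inverse_coeff p) m = fps_nth (\<Prod>x\<leftarrow>xs. Abs_fps (\<lambda>m. x ^ m)) m"
proof -
  define P where "P = (\<Sum>k\<in>Poly_Mapping.keys p.
    Polynomial.monom (Poly_Mapping.lookup p k * monomial z k) (msize k))"
  have mon: "monomial (\<chi> i. x * z $ i) k = x ^ msize k * monomial z k" for x k
    by (simp add: monomial_def msize_def power_mult_distrib prod.distrib power_sum)
  have "poly P x = poly (\<Prod>a\<leftarrow>xs. [:1, - a:]) x" for x
  proof -
    have "poly P x = peval p (\<chi> i. x * z $ i)"
      by (simp add: P_def peval_def poly_sum poly_monom mon mult_ac)
    also have "\<dots> = poly (\<Prod>a\<leftarrow>xs. [:1, - a:]) x"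
      by (simp add: p poly_prod_list o_def)
    finally show ?thesis .
  qed
  then have P: "P = (\<Prod>a\<leftarrow>xs. [:1, - a:])"
    by (simp add: poly_eq_poly_eq_iff [symmetric] fun_eq_iff)
  have coeff_P: "poly.coeff P m = hom_part z (Poly_Mapping.lookup p) m" for m
  proof -
    have "poly.coeff P m = (\<Sum>k\<in>Poly_Mapping.keys p.
        if msize k = m then Poly_Mapping.lookup p k * monomial z k else 0)"
      by (simp add: P_def coeff_sum)
    also have "\<dots> = (\<Sum>k\<in>Poly_Mapping.keys p \<inter> {k. msize k = m}. Poly_Mapping.lookup p k * monomial z k)"
      by (simp add: sum.inter_restrict)
    also have "\<dots> = hom_part z (Poly_Mapping.lookup p) m"
      unfolding hom_part_def by (rule sum.mono_neutral_left) (auto simp: in_keys_iff)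
    finally show ?thesis .
  qed
  define H where "H = Abs_fps (hom_part z (inverse_coeff p))"
  define G where "G = (\<Prod>x\<leftarrow>xs. Abs_fps (\<lambda>m. x ^ m))"
  have "fps_of_poly P * H = 1"
  proof (rule fps_ext)
    fix m
    have "fps_nth (fps_of_poly P * H) m = hom_part z (conv_coeff p (inverse_coeff p)) m"
      by (simp add: H_def fps_mult_nth coeff_P hom_part_conv_coeff atLeast0AtMost)
    also have "\<dots> = (\<Sum>k :: nat ^ 'd | msize k = m. if k = 0 then 1 else 0)"
      unfolding hom_part_def by (intro sum.cong) (auto simp: conv_coeff_inverse_coeff p0)
    also have "\<dots> = fps_nth 1 m"
      by auto
    finally show "fps_nth (fps_of_poly P * H) m = fps_nth 1 m" .
  qed
  moreover have "fps_of_poly P * G = 1"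
  proof -
    have "fps_of_poly (\<Prod>a\<leftarrow>xs. [:1, - a:]) * (\<Prod>x\<leftarrow>xs. Abs_fps (\<lambda>m. x ^ m)) = 1"
    proof (induction xs)
      case (Cons a xs)
      have "fps_of_poly (\<Prod>a\<leftarrow>a # xs. [:1, - a:]) * (\<Prod>x\<leftarrow>a # xs. Abs_fps (\<lambda>m. x ^ m)) =
          (fps_of_poly [:1, - a:] * Abs_fps (\<lambda>m. a ^ m)) *
          (fps_of_poly (\<Prod>a\<leftarrow>xs. [:1, - a:]) * (\<Prod>x\<leftarrow>xs. Abs_fps (\<lambda>m. x ^ m)))"
        by (simp only: list.map prod_list.Cons fps_of_poly_mult ac_simps)
      then show ?case
        by (simp only: Cons.IH geometric_fps_inverse mult_1_left)
    qed simp
    then show ?thesis by (simp add: P G_def)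
  qed
  ultimately have "H = G"
    by (metis mult.left_commute mult.right_neutral mult.commute)
  then show ?thesis
    by (metis G_def H_def fps_nth_Abs_fps)
qed

text \<open>The homogeneous part of degree |k| is itself a polynomial, so the Cauchy estimate
  applies to it and reads off the coefficient at \<open>k\<close>; convergence of the full series on
  the torus is never at issue. \<open>N\<close> counts the linear factors on each line.\<close>

lemma cmod_inverse_coeff_le:
  fixes p :: "'d::finite mpolynomial"
  assumes p: "\<And>z. (\<And>i. cmod (z $ i) = 1) \<Longrightarrow> \<exists>xs. length xs = N \<and> (\<forall>a\<in>set xs. cmod a \<le> 1) \<and>
      (\<forall>x. peval p (\<chi> i. x * z $ i) = (\<Prod>a\<leftarrow>xs. 1 - x * a))"
    and p0: "Poly_Mapping.lookup p 0 = 1"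
  shows "cmod (inverse_coeff p k) \<le> real (msize k + 1) ^ N"
proof -
  define h where "h = (\<Sum>j | msize j = msize k. Poly_Mapping.single j (inverse_coeff p j))"
  have "peval h z = hom_part z (inverse_coeff p) (msize k)" for z
    by (simp add: h_def hom_part_def peval_hom.hom_sum)
  then have "cmod (peval h z) \<le> real (msize k + 1) ^ N" if "\<And>i. cmod (z $ i) = 1" for z
    using p[OF that] cmod_prod_geometric_fps_le[of _ "msize k"] hom_part_inverse_coeff_eq[OF _ p0, of z]
    by force
  then have "cmod (Poly_Mapping.lookup h k) \<le> real (msize k + 1) ^ N"
    by (rule cmod_coeff_le)
  also have "Poly_Mapping.lookup h k = inverse_coeff p k"
    by (simp add: h_def lookup_sum lookup_single when_def)
  finally show ?thesis .
qed

text \<open>A finite set of multi-indices lies in a box, over which the sum factors into finite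
  geometric sums, one per variable.\<close>

lemma summable_power_msize:
  assumes "0 \<le> s" "s < (1::real)"
  shows "(\<lambda>k :: nat ^ 'd::finite. s ^ msize k) summable_on UNIV"
proof (rule nonneg_bdd_above_summable_on)
  show "bdd_above (sum (\<lambda>k :: nat ^ 'd. s ^ msize k) ` {F. F \<subseteq> UNIV \<and> finite F})"
  proof (rule bdd_aboveI2)
    fix F :: "(nat ^ 'd) set"
    assume "F \<in> {F. F \<subseteq> UNIV \<and> finite F}"
    then have F: "finite F" by simp
    define L where "L = Max (insert 0 (msize ` F))"
    have L: "k $ i \<le> L" if "k \<in> F" for k i
      using component_le_msize[of k i] Max_ge[of "insert 0 (msize ` F)" "msize k"] F that
      unfolding L_def by (meson finite_imageI finite_insert imageI insertI2 le_trans)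
    have "(\<Sum>k\<in>F. s ^ msize k) = (\<Sum>t\<in>vec_nth ` F. \<Prod>i\<in>UNIV. s ^ t i)"
      by (subst sum.reindex) (auto simp: inj_on_def vec_nth_inject msize_def power_sum)
    also have "\<dots> \<le> (\<Sum>t\<in>Pi\<^sub>E (UNIV :: 'd set) (\<lambda>_. {..L}). \<Prod>i\<in>UNIV. s ^ t i)"
      by (rule sum_mono2) (auto intro!: finite_PiE prod_nonneg L simp: assms)
    also have "\<dots> = (\<Prod>i\<in>(UNIV :: 'd set). \<Sum>t\<le>L. s ^ t)"
      by (rule prod_sum_PiE [symmetric]) auto
    also have "\<dots> \<le> (\<Prod>i\<in>(UNIV :: 'd set). 1 / (1 - s))"
    proof (rule prod_mono, intro conjI)
      have "(1 - s) * (\<Sum>t\<le>L. s ^ t) \<le> 1"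
        using assms by (simp only: sum_gp_basic) simp
      then show "(\<Sum>t\<le>L. s ^ t) \<le> 1 / (1 - s)"
        using assms by (simp add: pos_le_divide_eq mult.commute)
    qed (simp add: assms sum_nonneg)
    finally show "(\<Sum>k\<in>F. s ^ msize k) \<le> (\<Prod>i\<in>(UNIV :: 'd set). 1 / (1 - s))" .
  qed
qed (simp add: assms)

lemma summable_polynomial_power_msize:
  assumes "0 \<le> r" "r < (1::real)"
  shows "(\<lambda>k :: nat ^ 'd::finite. real (msize k + 1) ^ N * r ^ msize k) summable_on UNIV"
proof -
  \<comment> \<open>\<open>s\<close> lies strictly between r and 1, and \<open>x\<close> is chosen
    with x s = (r + s) / 2. So r^m \<le> x^m s^m, where x^m absorbs the polynomial factor and s^m
    stays summable; the midpoint instead of r keeps \<open>x\<close> positive when r = 0.\<close>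
  define s where "s = (r + 1) / 2"
  define x where "x = (r + s) / (2 * s)"
  have s: "0 < s" "s < 1" "r < s" and x: "0 < x" "x < 1" and rx: "r \<le> x * s"
  proof -
    have "0 < s" using assms by (auto simp: s_def)
    moreover have "r < s" "s < 1" using assms by (auto simp: s_def)
    moreover from this \<open>0 < s\<close> have "x < 1" "0 < x" "x * s = (r + s) / 2"
      using assms by (auto simp: x_def field_simps)
    ultimately show "0 < s" "s < 1" "r < s" "0 < x" "x < 1" "r \<le> x * s"
      by auto
  qed
  have "(\<lambda>m. (real m + 1) ^ N * x ^ m) \<longlonglongrightarrow> 0"
    using x by real_asymp
  then have "Bseq (\<lambda>m. (real m + 1) ^ N * x ^ m)"
    by (intro convergent_imp_Bseq) (auto simp: convergent_def)
  then obtain C where C: "\<And>m. \<bar>(real m + 1) ^ N * x ^ m\<bar> \<le> C"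
    by (auto simp: Bseq_def)
  show ?thesis
  proof (rule summable_on_comparison_test)
    show "(\<lambda>k :: nat ^ 'd. C * s ^ msize k) summable_on UNIV"
      by (intro summable_on_cmult_right summable_power_msize) (use s in auto)
    fix k :: "nat ^ 'd"
    have "real (msize k + 1) ^ N * r ^ msize k \<le> real (msize k + 1) ^ N * (x * s) ^ msize k"
      by (intro mult_left_mono power_mono rx assms) auto
    also have "\<dots> = ((real (msize k) + 1) ^ N * x ^ msize k) * s ^ msize k"
      by (simp add: power_mult_distrib add.commute)
    also have "\<dots> \<le> C * s ^ msize k"
      using C[of "msize k"] s by (intro mult_right_mono) auto
    finally show "real (msize k + 1) ^ N * r ^ msize k \<le> C * s ^ msize k" .
  qed (use assms in auto)
qed

section \<open>Spectral theorem for Hermitian matrices\<close>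

lemma mat_adjoint_dim [simp]:
  "dim_row (mat_adjoint A) = dim_col A" "dim_col (mat_adjoint A) = dim_row A"
  by (simp_all add: mat_adjoint_def)

lemma mat_adjoint_index [simp]:
  fixes A :: "complex mat"
  shows "i < dim_col A \<Longrightarrow> j < dim_row A \<Longrightarrow> mat_adjoint A $$ (i, j) = cnj (A $$ (j, i))"
  by (simp add: mat_adjoint_def mat_of_rows_index)

lemma mat_adjoint_carrier [simp]: "A \<in> carrier_mat n m \<Longrightarrow> mat_adjoint A \<in> carrier_mat m n"
  by (metis carrier_matD carrier_matI mat_adjoint_dim)

lemma mat_adjoint_adjoint [simp]: "mat_adjoint (mat_adjoint A) = (A :: complex mat)"
  by (rule eq_matI) auto

lemma mult_carrier_square [simp]:
  "A \<in> carrier_mat n n \<Longrightarrow> B \<in> carrier_mat n n \<Longrightarrow> A * B \<in> carrier_mat n n"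
  by (rule mult_carrier_mat)

lemma assoc_mult_square:
  "A \<in> carrier_mat n n \<Longrightarrow> B \<in> carrier_mat n n \<Longrightarrow> C \<in> carrier_mat n n \<Longrightarrow> A * B * C = A * (B * C)"
  by (rule assoc_mult_mat)

lemma mat_adjoint_one [simp]: "mat_adjoint (1\<^sub>m n :: complex mat) = 1\<^sub>m n"
  by (rule eq_matI) auto

lemma mat_adjoint_minus:
  fixes A B :: "complex mat"
  shows "A \<in> carrier_mat n m \<Longrightarrow> B \<in> carrier_mat n m \<Longrightarrow> mat_adjoint (A - B) = mat_adjoint A - mat_adjoint B"
  by (rule eq_matI) auto

lemma mat_adjoint_mult:
  fixes A B :: "complex mat"
  assumes "A \<in> carrier_mat n m" "B \<in> carrier_mat m l"
  shows "mat_adjoint (A * B) = mat_adjoint B * mat_adjoint A"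
  by (rule eq_matI) (use assms in \<open>auto simp: scalar_prod_def mult.commute intro!: sum.cong\<close>)

lemma inner_adjoint:
  fixes A :: "complex mat"
  assumes "A \<in> carrier_mat n m" "v \<in> carrier_vec m" "w \<in> carrier_vec n"
  shows "(A *\<^sub>v v) \<bullet>c w = v \<bullet>c (mat_adjoint A *\<^sub>v w)"
proof -
  have "(A *\<^sub>v v) \<bullet>c w = (\<Sum>i<n. \<Sum>j<m. A $$ (i, j) * vec_index v j * cnj (vec_index w i))"
    using assms by (auto simp: scalar_prod_def sum_distrib_right atLeast0LessThan intro!: sum.cong)
  also have "\<dots> = (\<Sum>j<m. \<Sum>i<n. A $$ (i, j) * vec_index v j * cnj (vec_index w i))"
    by (rule sum.swap)
  also have "\<dots> = v \<bullet>c (mat_adjoint A *\<^sub>v w)"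
    using assms by (auto simp: scalar_prod_def sum_distrib_left atLeast0LessThan intro!: sum.cong)
  finally show ?thesis .
qed

lemma vec_inner_commute:
  fixes v w :: "complex Matrix.vec"
  assumes "v \<in> carrier_vec n" "w \<in> carrier_vec n"
  shows "v \<bullet>c w = cnj (w \<bullet>c v)"
  using assms by (auto simp: scalar_prod_def mult.commute intro!: sum.cong)

lemma cvec_norm_square: "v \<bullet>c v = of_real (cvec_norm v ^ 2)"
proof -
  have "v \<bullet>c v \<ge> 0"
    by (rule conjugate_square_ge_0_vec)
  then show ?thesis
    by (auto simp: cvec_norm_def less_eq_complex_def complex_eq_iff)
qed

lemma cvec_norm_nonneg [simp]: "0 \<le> cvec_norm v"
  using conjugate_square_ge_0_vec[of v] by (auto simp: cvec_norm_def less_eq_complex_def)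

lemma cvec_norm_sum: "cvec_norm v ^ 2 = (\<Sum>i<dim_vec v. cmod (vec_index v i) ^ 2)"
proof -
  have "complex_of_real (cvec_norm v ^ 2) = (\<Sum>i<dim_vec v. of_real (cmod (vec_index v i) ^ 2))"
    unfolding cvec_norm_square [symmetric]
    by (simp add: scalar_prod_def atLeast0LessThan complex_norm_square del: of_real_power)
  then show ?thesis
    unfolding of_real_sum [symmetric] of_real_eq_iff .
qed

lemma cvec_norm_eq_0_iff: "v \<in> carrier_vec n \<Longrightarrow> cvec_norm v = 0 \<longleftrightarrow> v = 0\<^sub>v n"
  using conjugate_square_eq_0_vec[of v n] by (simp add: cvec_norm_square)

lemma cvec_norm_smult: "cvec_norm (c \<cdot>\<^sub>v v) = cmod c * cvec_norm v"
proof -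
  have "cvec_norm (c \<cdot>\<^sub>v v) ^ 2 = (cmod c * cvec_norm v) ^ 2"
    by (simp add: cvec_norm_sum power_mult_distrib norm_mult sum_distrib_left)
  then show ?thesis
    by (simp add: power2_eq_iff_nonneg)
qed

text \<open>Gram-Schmidt leaves the first vector of a completed basis untouched; dividing all
  vectors by their norms gives the columns.\<close>

lemma exists_unitary_first_column:
  fixes v :: "complex Matrix.vec"
  assumes v: "v \<in> carrier_vec n" "v \<noteq> 0\<^sub>v n"
  obtains W c where "W \<in> carrier_mat n n" "mat_adjoint W * W = 1\<^sub>m n" "col W 0 = c \<cdot>\<^sub>v v"
proof -
  interpret cof_vec_space n "TYPE(complex)" .
  have n: "n \<noteq> 0"
    using v by (metis carrier_vecD eq_vecI not_less0 index_zero_vec(2))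
  define b where "b = basis_completion v"
  define ws where "ws = gram_schmidt n b"
  note b = basis_completion[OF v, folded b_def]
  obtain vs where bv: "b = v # vs"
    using b(6,7) n by (cases b) auto
  have hd: "hd ws = v"
    using gram_schmidt_hd[OF v(1), of vs] unfolding ws_def bv .
  note ws = gram_schmidt_result[OF b(2,4,5) refl, folded ws_def]
  have len: "length ws = n"
    using ws(4) b(6) by simp
  have ws_c: "ws ! i \<in> carrier_vec n" if "i < n" for i
    using ws(3) len that nth_mem by blast
  have ws_dim: "dim_vec (ws ! i) = n" if "i < n" for i
    using ws_c[OF that] by simp
  have hd0: "ws ! 0 = v"
    using hd len n by (cases ws) auto
  have nz: "cvec_norm (ws ! i) \<noteq> 0" if "i < n" for i
    using corthogonalD[OF ws(2), of i i] that len by (auto simp: cvec_norm_square)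
  define u where "u i = complex_of_real (1 / cvec_norm (ws ! i)) \<cdot>\<^sub>v (ws ! i)" for i
  define W where "W = mat_of_cols n (map u [0..<n])"
  have W: "W \<in> carrier_mat n n"
    unfolding W_def by (metis diff_zero length_map length_upt mat_of_cols_carrier(1))
  have u_dim: "dim_vec (u i) = n" if "i < n" for i
    using that by (simp add: u_def ws_dim)
  have Wij: "W $$ (i, j) = vec_index (u j) i" if "i < n" "j < n" for i j
    using that by (simp add: W_def mat_of_cols_index)
  have uu: "u j \<bullet>c u i = (if i = j then 1 else 0)" if "i < n" "j < n" for i j
  proof -
    have "u j \<bullet>c u i = of_real (1 / cvec_norm (ws ! j)) * (of_real (1 / cvec_norm (ws ! i)) * ((ws ! j) \<bullet>c (ws ! i)))"
      unfolding u_def using that ws_c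
      by (auto simp: scalar_prod_def sum_distrib_left ws_dim intro!: sum.cong)
    then show ?thesis
      using corthogonalD[OF ws(2), of j i] that len nz[OF that(1)]
      by (auto simp: cvec_norm_square power2_eq_square)
  qed
  have "mat_adjoint W * W = 1\<^sub>m n"
  proof (rule eq_matI)
    fix i j assume "i < dim_row (1\<^sub>m n :: complex mat)" "j < dim_col (1\<^sub>m n :: complex mat)"
    then have ij: "i < n" "j < n" by auto
    then have "(mat_adjoint W * W) $$ (i, j) = u j \<bullet>c u i"
      using W by (auto simp: scalar_prod_def Wij u_dim intro!: sum.cong)
    then show "(mat_adjoint W * W) $$ (i, j) = 1\<^sub>m n $$ (i, j)"
      using ij by (simp add: uu)
  qed (use W in auto)
  moreover have "col W 0 = of_real (1 / cvec_norm v) \<cdot>\<^sub>v v"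
    by (rule eq_vecI) (use W n v in \<open>auto simp: Wij u_def hd0\<close>)
  ultimately show thesis
    using that W by blast
qed

lemma unitary_right_inverse:
  fixes P :: "complex mat"
  assumes "P \<in> carrier_mat n n" "mat_adjoint P * P = 1\<^sub>m n"
  shows "P * mat_adjoint P = 1\<^sub>m n"
  using mat_mult_left_right_inverse[OF mat_adjoint_carrier[OF assms(1)] assms(1)] assms by auto

lemma mat_adjoint_four_block:
  fixes A B C D :: "complex mat"
  assumes "A \<in> carrier_mat n1 m1" "B \<in> carrier_mat n1 m2" "C \<in> carrier_mat n2 m1" "D \<in> carrier_mat n2 m2"
  shows "mat_adjoint (four_block_mat A B C D) =
    four_block_mat (mat_adjoint A) (mat_adjoint C) (mat_adjoint B) (mat_adjoint D)"
proof (rule eq_matI)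
  fix i j
  assume "i < dim_row (four_block_mat (mat_adjoint A) (mat_adjoint C) (mat_adjoint B) (mat_adjoint D))"
    "j < dim_col (four_block_mat (mat_adjoint A) (mat_adjoint C) (mat_adjoint B) (mat_adjoint D))"
  then have "i < m1 + m2" "j < n1 + n2"
    using assms by auto
  then show "mat_adjoint (four_block_mat A B C D) $$ (i, j) =
    four_block_mat (mat_adjoint A) (mat_adjoint C) (mat_adjoint B) (mat_adjoint D) $$ (i, j)"
    using assms by simp
qed (use assms in auto)

text \<open>Induction by deflation: with a unit eigenvector for \<open>e\<close> as first column of
  a unitary matrix, conjugation splits off the 1 by 1 block \<open>e\<close>, the first row
  vanishing by symmetry, and leaves a Hermitian block with the remaining factors. The order of
  \<open>es\<close> is prescribed, so that two matrices with the same characteristic polynomial get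
  the same diagonal.\<close>

lemma hermitian_diagonalize:
  fixes A :: "complex mat"
  assumes "A \<in> carrier_mat n n" "mat_adjoint A = A" "char_poly A = (\<Prod>e\<leftarrow>es. [:- e, 1:])"
  shows "\<exists>P\<in>carrier_mat n n. mat_adjoint P * P = 1\<^sub>m n \<and> mat_adjoint P * A * P = mat_diag n (\<lambda>i. es ! i)"
  using assms
proof (induction es arbitrary: n A)
  case Nil
  then have "n = 0"
    using degree_monic_char_poly[OF Nil(1)] by simp
  with Nil show ?case
    by (intro bexI[of _ "1\<^sub>m n"]) (auto simp: mat_diag_def intro!: eq_matI)
next
  case (Cons e es n A)
  note A = Cons.prems(1)
  have "eigenvalue A e"
    unfolding eigenvalue_root_char_poly[OF A] Cons.prems(3) by simp
  then obtain v where v: "v \<in> carrier_vec n" "v \<noteq> 0\<^sub>v n" "A *\<^sub>v v = e \<cdot>\<^sub>v v"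
    using A by (auto simp: eigenvalue_def eigenvector_def)
  then have "n \<noteq> 0"
    by (metis carrier_vecD eq_vecI not_less0 index_zero_vec(2))
  then obtain m where n: "n = Suc m"
    by (cases n) auto
  obtain W c where W: "W \<in> carrier_mat n n" "mat_adjoint W * W = 1\<^sub>m n" "col W 0 = c \<cdot>\<^sub>v v"
    using exists_unitary_first_column[OF v(1,2)] .
  note WW = unitary_right_inverse[OF W(1,2)]
  define A' where "A' = mat_adjoint W * A * W"
  have A': "A' \<in> carrier_mat n n"
    using A W by (simp add: A'_def)
  have A'_adj: "mat_adjoint A' = A'"
    unfolding A'_def using A W
    by (simp add: mat_adjoint_mult[of _ n n _ n] Cons.prems(2) assoc_mult_square[of _ n])
  have Wc: "col W 0 \<in> carrier_vec n"
    using v(1) unfolding W(3) by simp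
  have "A *\<^sub>v col W 0 = e \<cdot>\<^sub>v col W 0"
    using v unfolding W(3) mult_mat_vec[OF A v(1)] by (simp add: smult_smult_assoc mult.commute)
  have n0: "0 < n"
    by (simp add: n)
  have Wa: "mat_adjoint W \<in> carrier_mat n n"
    using W(1) by simp
  have col0: "col A' 0 = e \<cdot>\<^sub>v col (1\<^sub>m n) 0"
  proof -
    have "col A' 0 = col (mat_adjoint W * (A * W)) 0"
      by (simp only: A'_def assoc_mult_square[OF Wa A W(1)])
    also have "\<dots> = mat_adjoint W *\<^sub>v col (A * W) 0"
      by (rule col_mult2[OF Wa mult_carrier_square[OF A W(1)] n0])
    also have "col (A * W) 0 = e \<cdot>\<^sub>v col W 0"
      unfolding col_mult2[OF A W(1) n0] by fact
    also have "mat_adjoint W *\<^sub>v (e \<cdot>\<^sub>v col W 0) = e \<cdot>\<^sub>v (mat_adjoint W *\<^sub>v col W 0)"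
      by (rule mult_mat_vec[OF Wa Wc])
    also have "mat_adjoint W *\<^sub>v col W 0 = col (mat_adjoint W * W) 0"
      by (rule col_mult2[OF Wa W(1) n0, symmetric])
    finally show ?thesis
      unfolding W(2) .
  qed
  have A'0: "A' $$ (i, 0) = (if i = 0 then e else 0)" if "i < n" for i
  proof -
    have "A' $$ (i, 0) = vec_index (col A' 0) i"
      using that A' n by simp
    then show ?thesis
      unfolding col0 using that n by simp
  qed
  have A'0': "A' $$ (0, j) = 0" if "j < n" "j \<noteq> 0" for j
  proof -
    have "A' $$ (0, j) = cnj (A' $$ (j, 0))"
      using mat_adjoint_index[of 0 A' j] that A' n unfolding A'_adj by simp
    then show ?thesis
      using A'0[of j] that by simp
  qed
  define A3 where "A3 = Matrix.mat m m (\<lambda>(i, j). A' $$ (Suc i, Suc j))"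
  have A3: "A3 \<in> carrier_mat m m"
    by (simp add: A3_def)
  have A3_adj: "mat_adjoint A3 = A3"
  proof (rule eq_matI)
    fix i j assume "i < dim_row A3" "j < dim_col A3"
    then have ij: "i < m" "j < m" by (auto simp: A3_def)
    then show "mat_adjoint A3 $$ (i, j) = A3 $$ (i, j)"
      using mat_adjoint_index[of "Suc i" A' "Suc j"] A' n unfolding A'_adj by (simp add: A3_def)
  qed (simp_all add: A3_def)
  let ?E = "Matrix.mat 1 1 (\<lambda>_. e)"
  have block: "A' = four_block_mat ?E (0\<^sub>m 1 m) (0\<^sub>m m 1) A3"
    by (rule eq_matI) (use A' n in \<open>auto simp: A3_def A'0 A'0'\<close>)
  have "similar_mat A' A"
    by (rule similar_matI[of _ _ "mat_adjoint W" W n]) (use A A' W WW in \<open>auto simp: A'_def\<close>)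
  from char_poly_similar[OF this] have "char_poly A' = [:- e, 1:] * (\<Prod>e\<leftarrow>es. [:- e, 1:])"
    by (simp only: Cons.prems(3) list.map prod_list.Cons)
  moreover have "char_poly A' = char_poly ?E * char_poly A3"
    unfolding block by (rule char_poly_four_block_zeros_col) (auto simp: A3)
  moreover have "char_poly ?E = [:- e, 1:]"
    by (simp add: char_poly_defs Determinant.det_def sign_def)
  ultimately have "char_poly A3 = (\<Prod>e\<leftarrow>es. [:- e, 1:])"
    by (metis mult_cancel_left pCons_eq_0_iff zero_neq_one)
  from Cons.IH[OF A3 A3_adj this] obtain P3 where P3: "P3 \<in> carrier_mat m m"
    "mat_adjoint P3 * P3 = 1\<^sub>m m" "mat_adjoint P3 * A3 * P3 = mat_diag m (\<lambda>i. es ! i)"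
    by blast
  define F where "F = four_block_mat (1\<^sub>m 1) (0\<^sub>m 1 m) (0\<^sub>m m 1) P3"
  have F: "F \<in> carrier_mat n n"
    using four_block_carrier_mat[OF one_carrier_mat[of 1] P3(1)] unfolding F_def n plus_1_eq_Suc .
  have z: "mat_adjoint (0\<^sub>m k l :: complex mat) = 0\<^sub>m l k" for k l
    by (rule eq_matI) auto
  have F_adj: "mat_adjoint F = four_block_mat (1\<^sub>m 1) (0\<^sub>m 1 m) (0\<^sub>m m 1) (mat_adjoint P3)"
    unfolding F_def using P3 by (subst mat_adjoint_four_block[of _ 1 1 _ m _ m]) (auto simp: z)
  have one: "four_block_mat (1\<^sub>m 1) (0\<^sub>m 1 m) (0\<^sub>m m 1) (1\<^sub>m m) = (1\<^sub>m n :: complex mat)"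
    by (rule eq_matI) (auto simp: n)
  have FF: "mat_adjoint F * F = 1\<^sub>m n"
    unfolding F_adj unfolding F_def using P3
    by (subst mult_four_block_mat[of _ 1 1 _ m _ m _ _ 1 _ m]) (auto simp: one n)
  have "mat_adjoint F * A' * F = four_block_mat ?E (0\<^sub>m 1 m) (0\<^sub>m m 1) (mat_adjoint P3 * A3 * P3)"
    unfolding F_adj block unfolding F_def using P3 A3
    by (simp add: mult_four_block_mat[of _ 1 1 _ m _ m _ _ 1 _ m])
  also have "\<dots> = mat_diag n (\<lambda>i. (e # es) ! i)"
    unfolding P3(3) by (rule eq_matI) (auto simp: mat_diag_def n nth_Cons split: nat.split)
  finally have FAF: "mat_adjoint F * A' * F = mat_diag n (\<lambda>i. (e # es) ! i)" .
  have P_adj: "mat_adjoint (W * F) = mat_adjoint F * mat_adjoint W"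
    by (rule mat_adjoint_mult) (use W F in auto)
  have carr: "mat_adjoint F \<in> carrier_mat n n" "mat_adjoint W \<in> carrier_mat n n"
    using F W by auto
  show ?case
  proof (intro bexI[of _ "W * F"] conjI)
    have "mat_adjoint (W * F) * (W * F) = mat_adjoint F * ((mat_adjoint W * W) * F)"
      unfolding P_adj using W(1) F carr by (simp add: assoc_mult_square[of _ n])
    then show "mat_adjoint (W * F) * (W * F) = 1\<^sub>m n"
      using F FF by (simp add: W(2))
    have "mat_adjoint (W * F) * A * (W * F) = mat_adjoint F * A' * F"
      unfolding P_adj A'_def using W(1) F A carr by (simp add: assoc_mult_square[of _ n])
    then show "mat_adjoint (W * F) * A * (W * F) = mat_diag n (\<lambda>i. (e # es) ! i)"
      using FAF by simp
  qed (use W F in auto)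
qed

section \<open>Positive semidefinite square roots\<close>

lemma conj_unitary_cancel:
  fixes P :: "complex mat"
  assumes P: "P \<in> carrier_mat n n" "mat_adjoint P * P = 1\<^sub>m n" and X: "X \<in> carrier_mat n n"
  shows "mat_adjoint P * (P * X) = X" "P * (mat_adjoint P * X) = X"
proof -
  have "mat_adjoint P * (P * X) = (mat_adjoint P * P) * X" "P * (mat_adjoint P * X) = (P * mat_adjoint P) * X"
    using P(1) X by (simp_all add: assoc_mult_square[of _ n])
  then show "mat_adjoint P * (P * X) = X" "P * (mat_adjoint P * X) = X"
    using X by (simp_all add: P(2) unitary_right_inverse[OF P])
qed

text \<open>The eigenvalues are also supplied as quadratic forms at unit vectors, from which their
  reality and their sign are read off later.\<close>

lemma hermitian_spectral:
  fixes A :: "complex mat"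
  assumes A: "A \<in> carrier_mat n n" "mat_adjoint A = A" "char_poly A = (\<Prod>e\<leftarrow>es. [:- e, 1:])"
  obtains P where "P \<in> carrier_mat n n" "mat_adjoint P * P = 1\<^sub>m n"
    "A = P * mat_diag n (\<lambda>i. es ! i) * mat_adjoint P"
    "\<And>i. i < n \<Longrightarrow> es ! i = (A *\<^sub>v col P i) \<bullet>c col P i" "\<And>i. i < n \<Longrightarrow> cvec_norm (col P i) = 1"
proof -
  obtain P where P: "P \<in> carrier_mat n n" "mat_adjoint P * P = 1\<^sub>m n"
    "mat_adjoint P * A * P = mat_diag n (\<lambda>i. es ! i)"
    using hermitian_diagonalize[OF A] by blast
  have Pa: "mat_adjoint P \<in> carrier_mat n n"
    using P(1) by simp
  show thesis
  proof (rule that[OF P(1,2)])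
    have "P * mat_diag n (\<lambda>i. es ! i) * mat_adjoint P = P * (mat_adjoint P * (A * (P * mat_adjoint P)))"
      unfolding P(3)[symmetric] using P(1) A(1) Pa by (simp add: assoc_mult_square[of _ n])
    then show "A = P * mat_diag n (\<lambda>i. es ! i) * mat_adjoint P"
      using A(1) by (simp add: unitary_right_inverse[OF P(1,2)] conj_unitary_cancel[OF P(1,2)])
  next
    fix i assume i: "i < n"
    have entry: "(mat_adjoint P * (B * P)) $$ (i, i) = (B *\<^sub>v col P i) \<bullet>c col P i" if B: "B \<in> carrier_mat n n" for B
      using i P(1) B by (auto simp: scalar_prod_def mult.commute intro!: sum.cong)
    have "es ! i = (mat_adjoint P * (A * P)) $$ (i, i)"
      using i unfolding assoc_mult_square[OF Pa A(1) P(1), symmetric] P(3) by (simp add: mat_diag_def)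
    then show "es ! i = (A *\<^sub>v col P i) \<bullet>c col P i"
      using entry[OF A(1)] by simp
    have colP: "col P i \<in> carrier_vec n"
      using P(1) i by auto
    have "(col P i) \<bullet>c col P i = 1"
      using entry[of "1\<^sub>m n"] P i colP by simp
    then have "cvec_norm (col P i) ^ 2 = 1"
      unfolding cvec_norm_square of_real_eq_1_iff .
    then show "cvec_norm (col P i) = 1"
      using cvec_norm_nonneg[of "col P i"] by (simp add: power2_eq_1_iff)
  qed
qed

lemma det_mat_diag: "Determinant.det (mat_diag n d) = (\<Prod>i<n. d i)"
  by (subst Determinant.det_upper_triangular[of _ n])
    (auto simp: mat_diag_def prod_list_diag_prod atLeast0LessThan)

lemma mat_diag_mult_vec_index:
  fixes d :: "nat \<Rightarrow> complex"
  assumes "v \<in> carrier_vec n" "i < n"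
  shows "vec_index (mat_diag n d *\<^sub>v v) i = d i * vec_index v i"
proof -
  have "vec_index (mat_diag n d *\<^sub>v v) i = (\<Sum>j\<in>{0..<n}. (if i = j then d j else 0) * vec_index v j)"
    using assms by (simp add: mat_diag_def scalar_prod_def)
  also have "\<dots> = (\<Sum>j\<in>{0..<n}. if i = j then d j * vec_index v j else 0)"
    by (rule sum.cong) auto
  finally show ?thesis
    using assms(2) by simp
qed

lemma mat_adjoint_mat_diag: "mat_adjoint (mat_diag n d) = mat_diag n (\<lambda>i. cnj (d i))"
  by (rule eq_matI) (auto simp: mat_diag_def)

lemma psd_mat_unitary_conj:
  assumes P: "P \<in> carrier_mat n n" and d: "\<And>i. i < n \<Longrightarrow> 0 \<le> d i"
  shows "psd_mat (P * mat_diag n (\<lambda>i. complex_of_real (d i)) * mat_adjoint P)" (is "psd_mat ?A")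
proof -
  let ?D = "mat_diag n (\<lambda>i. complex_of_real (d i))"
  have Pa: "mat_adjoint P \<in> carrier_mat n n" and D: "?D \<in> carrier_mat n n"
    using P by auto
  have A: "?A \<in> carrier_mat n n"
    using P Pa D by simp
  have "mat_adjoint ?A = ?A"
    using P Pa D by (simp add: mat_adjoint_mult[of _ n n _ n] mat_adjoint_mat_diag assoc_mult_square[of _ n])
  moreover have "0 \<le> Re ((?A *\<^sub>v v) \<bullet>c v)" if v: "v \<in> carrier_vec n" for v
  proof -
    define w where "w = mat_adjoint P *\<^sub>v v"
    have w: "w \<in> carrier_vec n"
      unfolding w_def using Pa v by (rule mult_mat_vec_carrier)
    have Dw: "?D *\<^sub>v w \<in> carrier_vec n"
      using D w by (rule mult_mat_vec_carrier)
    have "?A *\<^sub>v v = P *\<^sub>v (?D *\<^sub>v w)"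
      unfolding w_def
      by (simp only: assoc_mult_mat_vec[OF mult_carrier_square[OF P D] Pa v]
          assoc_mult_mat_vec[OF P D mult_mat_vec_carrier[OF Pa v]])
    then have "(?A *\<^sub>v v) \<bullet>c v = (?D *\<^sub>v w) \<bullet>c w"
      using inner_adjoint[OF P Dw v] by (simp add: w_def)
    also have "\<dots> = (\<Sum>i<n. of_real (d i * cmod (vec_index w i) ^ 2))"
    proof -
      have "vec_index (?D *\<^sub>v w) i = of_real (d i) * vec_index w i" if "i < n" for i
        by (rule mat_diag_mult_vec_index[OF w that])
      then show ?thesis
        using w by (auto simp: scalar_prod_def atLeast0LessThan complex_norm_square mult.assoc intro!: sum.cong
            simp del: of_real_power)
    qed
    finally show ?thesis
      using d by (auto intro!: sum_nonneg)
  qed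
  ultimately show ?thesis
    using A by (auto simp: psd_mat_def)
qed

lemma psd_mat_spectral:
  assumes "psd_mat B" "B \<in> carrier_mat n n"
  obtains P d where "P \<in> carrier_mat n n" "mat_adjoint P * P = 1\<^sub>m n"
    "\<And>i. i < n \<Longrightarrow> 0 \<le> d i" "B = P * mat_diag n (\<lambda>i. complex_of_real (d i)) * mat_adjoint P"
proof -
  have B: "mat_adjoint B = B" "\<And>v. v \<in> carrier_vec n \<Longrightarrow> 0 \<le> Re ((B *\<^sub>v v) \<bullet>c v)"
    using assms by (auto simp: psd_mat_def)
  obtain es where es: "char_poly B = (\<Prod>e\<leftarrow>es. [:- e, 1:])"
    using char_poly_factorized[OF assms(2)] by blast
  obtain P where P: "P \<in> carrier_mat n n" "mat_adjoint P * P = 1\<^sub>m n"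
    "B = P * mat_diag n (\<lambda>i. es ! i) * mat_adjoint P"
    "\<And>i. i < n \<Longrightarrow> es ! i = (B *\<^sub>v col P i) \<bullet>c col P i"
    using hermitian_spectral[OF assms(2) B(1) es] by metis
  have col: "col P i \<in> carrier_vec n" if "i < n" for i
    using P(1) that by auto
  have real: "es ! i = of_real (Re (es ! i))" if i: "i < n" for i
  proof -
    have Bc: "B *\<^sub>v col P i \<in> carrier_vec n"
      using assms(2) col[OF i] by (rule mult_mat_vec_carrier)
    have "(B *\<^sub>v col P i) \<bullet>c col P i = col P i \<bullet>c (B *\<^sub>v col P i)"
      using inner_adjoint[OF assms(2) col[OF i] col[OF i]] unfolding B(1) .
    also have "\<dots> = cnj ((B *\<^sub>v col P i) \<bullet>c col P i)"
      by (rule vec_inner_commute[OF col[OF i] Bc])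
    finally have "cnj (es ! i) = es ! i"
      using P(4)[OF i] by simp
    then show ?thesis
      by (metis Reals_cnj_iff of_real_Re)
  qed
  have "mat_diag n (\<lambda>i. es ! i) = mat_diag n (\<lambda>i. of_real (Re (es ! i)))"
    by (rule eq_matI) (auto simp: mat_diag_def real[symmetric])
  then show thesis
    using that[OF P(1,2), of "\<lambda>i. Re (es ! i)"] P(3,4) B(2) col by metis
qed

lemma unitary_conj_mult:
  fixes P :: "complex mat"
  assumes P: "P \<in> carrier_mat n n" "mat_adjoint P * P = 1\<^sub>m n"
  shows "(P * mat_diag n f * mat_adjoint P) * (P * mat_diag n g * mat_adjoint P) =
    P * mat_diag n (\<lambda>i. f i * g i) * mat_adjoint P"
proof -
  have Pa: "mat_adjoint P \<in> carrier_mat n n"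
    using P(1) by simp
  have "mat_diag n f * (mat_diag n g * X) = mat_diag n (\<lambda>i. f i * g i) * X" if "X \<in> carrier_mat n n" for X
    using that by (simp flip: assoc_mult_square[of _ n])
  then show ?thesis
    using P(1) Pa by (simp add: assoc_mult_square[of _ n] conj_unitary_cancel[OF P])
qed

text \<open>Between eigenbases of \<open>D\<close> and \<open>E\<close> the matrix of
  \<open>K\<close> has entries satisfying M d^2 = e^2 M; where an entry is nonzero the squares
  agree, hence so do the nonnegative numbers \<open>d\<close> and \<open>e\<close>
  themselves.\<close>

lemma psd_mat_intertwine:
  assumes D: "psd_mat D" "D \<in> carrier_mat n n" and E: "psd_mat E" "E \<in> carrier_mat n n"
    and K: "K \<in> carrier_mat n n" and eq: "K * (D * D) = (E * E) * K"
  shows "K * D = E * K"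
proof -
  obtain P d where P: "P \<in> carrier_mat n n" "mat_adjoint P * P = 1\<^sub>m n"
    "\<And>i. i < n \<Longrightarrow> 0 \<le> d i" and D_eq: "D = P * mat_diag n (\<lambda>i. complex_of_real (d i)) * mat_adjoint P"
    using psd_mat_spectral[OF D] by metis
  obtain Q e where Q: "Q \<in> carrier_mat n n" "mat_adjoint Q * Q = 1\<^sub>m n"
    "\<And>i. i < n \<Longrightarrow> 0 \<le> e i" and E_eq: "E = Q * mat_diag n (\<lambda>i. complex_of_real (e i)) * mat_adjoint Q"
    using psd_mat_spectral[OF E] by metis
  have Pa: "mat_adjoint P \<in> carrier_mat n n" and Qa: "mat_adjoint Q \<in> carrier_mat n n"
    using P Q by auto
  define M where "M = mat_adjoint Q * K * P"
  have M: "M \<in> carrier_mat n n"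
    using Qa K P(1) by (simp add: M_def)
  have K_eq: "K = Q * M * mat_adjoint P"
    unfolding M_def using Qa K P(1) Q(1) Pa
    by (simp add: assoc_mult_square[of _ n] conj_unitary_cancel[OF Q(1,2)] unitary_right_inverse[OF P(1,2)])
  have conj: "mat_adjoint Q * (K * (P * mat_diag n f * mat_adjoint P)) * P = M * mat_diag n f"
    "mat_adjoint Q * ((Q * mat_diag n f * mat_adjoint Q) * K) * P = mat_diag n f * M" for f
    unfolding M_def using Qa K P(1) Q(1) Pa
    by (simp_all add: assoc_mult_square[of _ n] conj_unitary_cancel[OF Q(1,2)] P(2) right_mult_one_mat[of _ n n])
  have "M * mat_diag n (\<lambda>i. of_real (d i) * of_real (d i)) = mat_diag n (\<lambda>i. of_real (e i) * of_real (e i)) * M"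
    using eq unfolding D_eq E_eq unitary_conj_mult[OF P(1,2)] unitary_conj_mult[OF Q(1,2)]
    by (metis conj)
  then have sq: "M $$ (i, j) * of_real (d j ^ 2) = of_real (e i ^ 2) * M $$ (i, j)" if "i < n" "j < n" for i j
    using that unfolding mat_diag_mult_left[OF M] mat_diag_mult_right[OF M]
    by (metis (no_types, lifting) index_mat(1) of_real_mult power2_eq_square prod.simps(2))
  have "M $$ (i, j) * of_real (d j) = of_real (e i) * M $$ (i, j)" if ij: "i < n" "j < n" for i j
  proof (cases "M $$ (i, j) = 0")
    case False
    then have "d j ^ 2 = e i ^ 2"
      using sq[OF ij] by (simp add: mult.commute flip: of_real_power)
    then show ?thesis
      using P(3)[OF ij(2)] Q(3)[OF ij(1)] by (simp add: power2_eq_iff_nonneg)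
  qed simp
  then have MD: "M * mat_diag n (\<lambda>i. of_real (d i)) = mat_diag n (\<lambda>i. of_real (e i)) * M"
    unfolding mat_diag_mult_left[OF M] mat_diag_mult_right[OF M] by (intro eq_matI) auto
  have "K * D = Q * (M * mat_diag n (\<lambda>i. of_real (d i))) * mat_adjoint P"
    unfolding D_eq K_eq using Qa P(1) Q(1) Pa M
    by (simp add: assoc_mult_square[of _ n] conj_unitary_cancel[OF P(1,2)])
  also have "\<dots> = E * K"
    unfolding MD E_eq K_eq using Qa P(1) Q(1) Pa M
    by (simp add: assoc_mult_square[of _ n] conj_unitary_cancel[OF Q(1,2)])
  finally show ?thesis .
qed

text \<open>Uniqueness of the square root is \<open>psd_mat_intertwine\<close> for the identity
  matrix, applied to two candidates.\<close>

lemma mat_sqrt_eqI: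
  assumes B: "psd_mat B" "B * B = A" and A: "A \<in> carrier_mat n n"
  shows "mat_sqrt A = B"
proof -
  have carr: "C \<in> carrier_mat n n" if "psd_mat C" "C * C = A" for C
  proof
    show "dim_row C = n" using that(2) A by auto
    show "dim_col C = n" using that(2) A by auto
  qed
  have "C = B" if C: "psd_mat C" "C * C = A" for C
  proof -
    have "1\<^sub>m n * (C * C) = B * B * 1\<^sub>m n"
      using A by (simp add: C(2) B(2))
    then have "1\<^sub>m n * C = B * 1\<^sub>m n"
      by (rule psd_mat_intertwine[OF C(1) carr[OF C] B(1) carr[OF B] one_carrier_mat])
    then show "C = B"
      using carr[OF C] carr[OF B] by simp
  qed
  then show ?thesis
    unfolding mat_sqrt_def using B by (intro the_equality) blast+
qed

lemma det_unitary_conj_add: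
  fixes P :: "complex mat"
  assumes P: "P \<in> carrier_mat n n" "mat_adjoint P * P = 1\<^sub>m n"
  shows "Determinant.det (P * mat_diag n d * mat_adjoint P + t \<cdot>\<^sub>m 1\<^sub>m n) = (\<Prod>i<n. d i + t)"
proof -
  have Pa: "mat_adjoint P \<in> carrier_mat n n"
    using P(1) by simp
  have diag: "mat_diag n (\<lambda>i. d i + t) = mat_diag n d + t \<cdot>\<^sub>m 1\<^sub>m n"
    by (rule eq_matI) (auto simp: mat_diag_def)
  have "P * mat_diag n (\<lambda>i. d i + t) = P * mat_diag n d + t \<cdot>\<^sub>m P"
    unfolding diag using P(1)
    by (subst mult_add_distrib_mat[of _ n n _ n]) (auto simp: mult_smult_distrib[of _ n n _ n])
  then have "P * mat_diag n (\<lambda>i. d i + t) * mat_adjoint P = P * mat_diag n d * mat_adjoint P + t \<cdot>\<^sub>m 1\<^sub>m n"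
    using P(1) Pa
    by (simp add: add_mult_distrib_mat[of _ n n _ _ n] mult_smult_assoc_mat[of _ n n _ n] unitary_right_inverse[OF P])
  then have "P * mat_diag n d * mat_adjoint P + t \<cdot>\<^sub>m 1\<^sub>m n = P * mat_diag n (\<lambda>i. d i + t) * mat_adjoint P"
    by simp
  also have "Determinant.det \<dots> = Determinant.det P * Determinant.det (mat_diag n (\<lambda>i. d i + t)) * Determinant.det (mat_adjoint P)"
    using P(1) Pa by (simp add: Determinant.det_mult[of _ n])
  also have "\<dots> = (Determinant.det (mat_adjoint P * P)) * Determinant.det (mat_diag n (\<lambda>i. d i + t))"
    using P(1) Pa by (simp add: Determinant.det_mult[of _ n])
  also have "Determinant.det (mat_diag n (\<lambda>i. d i + t)) = (\<Prod>i<n. d i + t)"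
    by (rule det_mat_diag)
  finally show ?thesis
    by (simp add: P(2))
qed

text \<open>Sylvester's identity: the block matrices ((x, A), (B, 1)) and ((1, 0), (-B, x)) have
  triangular products in both orders, with determinants det (x - A B) x^n and x^n det (x - B A).
  This settles nonzero x, and two polynomials that agree there are equal.\<close>

lemma char_poly_mult_commute:
  fixes A B :: "complex mat"
  assumes A: "A \<in> carrier_mat n n" and B: "B \<in> carrier_mat n n"
  shows "char_poly (A * B) = char_poly (B * A)"
proof (cases "n = 0")
  case True
  then have "A * B = B * A"
    using A B by (intro eq_matI) auto
  then show ?thesis by simp
next
  case n: False
  have ev: "poly (char_poly C) x = Determinant.det (x \<cdot>\<^sub>m 1\<^sub>m n - C)" if "C \<in> carrier_mat n n" for C :: "complex mat" and x
  proof -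
    have "- char_matrix C x = x \<cdot>\<^sub>m 1\<^sub>m n - C"
      using that by (intro eq_matI) (auto simp: char_matrix_def)
    then show ?thesis
      using char_poly_matrix[OF that, of x] by simp
  qed
  have neg: "C * (- D) = - (C * D)" and neg': "- C * D = - (C * D)"
    if "C \<in> carrier_mat n n" "D \<in> carrier_mat n n" for C D :: "complex mat"
    using that by (auto simp: scalar_prod_def sum_negf intro!: eq_matI)
  have main: "poly (char_poly (A * B)) x = poly (char_poly (B * A)) x" if x: "x \<noteq> 0" for x
  proof -
    let ?X = "x \<cdot>\<^sub>m 1\<^sub>m n" and ?I = "1\<^sub>m n" and ?O = "0\<^sub>m n n :: complex mat"
    let ?M = "four_block_mat ?X A B ?I"
    let ?L = "four_block_mat ?I ?O (- B) ?X"
    have M: "?M \<in> carrier_mat (n + n) (n + n)" and L: "?L \<in> carrier_mat (n + n) (n + n)"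
      using A B by auto
    have "Determinant.det ?M * Determinant.det ?L = Determinant.det (?M * ?L)"
      using M L by (simp add: Determinant.det_mult[of _ "n + n"])
    also have "?M * ?L = four_block_mat (?X - A * B) (x \<cdot>\<^sub>m A) ?O ?X"
    proof -
      have "?M * ?L = four_block_mat (?X * ?I + A * (- B)) (?X * ?O + A * ?X) (B * ?I + ?I * (- B)) (B * ?O + ?I * ?X)"
        by (rule mult_four_block_mat) (use A B in auto)
      moreover have "?X * ?I + A * (- B) = ?X - A * B" "?X * ?O + A * ?X = x \<cdot>\<^sub>m A"
        "B * ?I + ?I * (- B) = ?O" "B * ?O + ?I * ?X = ?X"
        unfolding neg[OF A B] using A B by (auto simp: mult_smult_distrib[of _ n n _ n])
      ultimately show ?thesis by simp
    qed
    also have "Determinant.det \<dots> = Determinant.det (?X - A * B) * Determinant.det ?X"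
      by (rule det_four_block_mat_lower_left_zero[of _ n _ n]) (use A B in auto)
    finally have 1: "Determinant.det ?M * Determinant.det ?L = Determinant.det (?X - A * B) * x ^ n"
      by simp
    have "Determinant.det ?L * Determinant.det ?M = Determinant.det (?L * ?M)"
      using M L by (simp add: Determinant.det_mult[of _ "n + n"])
    also have "?L * ?M = four_block_mat ?X A ?O (?X - B * A)"
    proof -
      have "?L * ?M = four_block_mat (?I * ?X + ?O * B) (?I * A + ?O * ?I) (- B * ?X + ?X * B) (- B * A + ?X * ?I)"
        by (rule mult_four_block_mat) (use A B in auto)
      moreover have "?I * ?X + ?O * B = ?X" "?I * A + ?O * ?I = A"
        "- B * ?X + ?X * B = ?O" "- B * A + ?X * ?I = ?X - B * A"
        unfolding neg'[OF B A] using A B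
        by (auto simp: mult_smult_distrib[of _ n n _ n] mult_smult_assoc_mat[of _ n n _ n] intro!: eq_matI)
      ultimately show ?thesis by simp
    qed
    also have "Determinant.det \<dots> = Determinant.det ?X * Determinant.det (?X - B * A)"
      by (rule det_four_block_mat_lower_left_zero[of _ n _ n]) (use A B in auto)
    finally have 2: "Determinant.det ?L * Determinant.det ?M = x ^ n * Determinant.det (?X - B * A)"
      by simp
    show ?thesis
      using 1 2 x A B by (simp add: ev mult.commute)
  qed
  show ?thesis
  proof (rule ccontr)
    assume "char_poly (A * B) \<noteq> char_poly (B * A)"
    then have "finite {x. poly (char_poly (A * B) - char_poly (B * A)) x = 0}"
      by (intro poly_roots_finite) simp
    moreover have "UNIV - {0} \<subseteq> {x. poly (char_poly (A * B) - char_poly (B * A)) x = 0}"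
      using main by auto
    ultimately have "finite (UNIV - {0 :: complex})"
      using finite_subset by blast
    then show False
      using infinite_UNIV_char_0[where 'a = complex] by simp
  qed
qed

section \<open>The determinant of the transfer function\<close>

definition mat_tendsto :: "nat \<Rightarrow> ('a \<Rightarrow> complex mat) \<Rightarrow> complex mat \<Rightarrow> 'a filter \<Rightarrow> bool"
  where "mat_tendsto n M L F \<longleftrightarrow> (\<forall>t. M t \<in> carrier_mat n n) \<and> L \<in> carrier_mat n n \<and>
    (\<forall>i<n. \<forall>j<n. ((\<lambda>t. M t $$ (i, j)) \<longlongrightarrow> L $$ (i, j)) F)"

lemma mat_tendsto_const: "A \<in> carrier_mat n n \<Longrightarrow> mat_tendsto n (\<lambda>_. A) A F"
  by (simp add: mat_tendsto_def)

lemma mat_tendsto_mult: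
  assumes "mat_tendsto n M A F" "mat_tendsto n N B F"
  shows "mat_tendsto n (\<lambda>t. M t * N t) (A * B) F"
proof -
  have c: "M t \<in> carrier_mat n n" "N t \<in> carrier_mat n n" "A \<in> carrier_mat n n" "B \<in> carrier_mat n n" for t
    using assms by (auto simp: mat_tendsto_def)
  have mult: "(X * Y) $$ (i, j) = (\<Sum>k<n. X $$ (i, k) * Y $$ (k, j))"
    if "X \<in> carrier_mat n n" "Y \<in> carrier_mat n n" "i < n" "j < n" for X Y :: "complex mat" and i j
    using that by (auto simp: scalar_prod_def atLeast0LessThan intro!: sum.cong)
  show ?thesis
    unfolding mat_tendsto_def
  proof (intro conjI allI impI)
    fix i j assume "i < n" "j < n"
    then show "((\<lambda>t. (M t * N t) $$ (i, j)) \<longlongrightarrow> (A * B) $$ (i, j)) F"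
      using assms unfolding mult[OF c(1,2) \<open>i < n\<close> \<open>j < n\<close>] mult[OF c(3,4) \<open>i < n\<close> \<open>j < n\<close>]
      by (intro tendsto_sum tendsto_mult) (auto simp: mat_tendsto_def)
  qed (use c in auto)
qed

lemma mat_tendsto_minus:
  assumes "mat_tendsto n M A F" "mat_tendsto n N B F"
  shows "mat_tendsto n (\<lambda>t. M t - N t) (A - B) F"
proof -
  have c: "M t \<in> carrier_mat n n" "N t \<in> carrier_mat n n" "A \<in> carrier_mat n n" "B \<in> carrier_mat n n" for t
    using assms by (auto simp: mat_tendsto_def)
  show ?thesis
    unfolding mat_tendsto_def
  proof (intro conjI allI impI)
    fix i j assume ij: "i < n" "j < n"
    have minus: "(X - Y) $$ (i, j) = X $$ (i, j) - Y $$ (i, j)" if "Y \<in> carrier_mat n n" for X Y :: "complex mat"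
      using that ij by simp
    show "((\<lambda>t. (M t - N t) $$ (i, j)) \<longlongrightarrow> (A - B) $$ (i, j)) F"
      unfolding minus[OF c(2)] minus[OF c(4)]
      using assms ij unfolding mat_tendsto_def by (intro tendsto_diff) blast+
  qed (intro minus_carrier_mat c)+
qed

lemma tendsto_det:
  assumes "mat_tendsto n M A F"
  shows "((\<lambda>t. Determinant.det (M t)) \<longlongrightarrow> Determinant.det A) F"
proof -
  have c: "M t \<in> carrier_mat n n" "A \<in> carrier_mat n n" for t
    using assms by (auto simp: mat_tendsto_def)
  show ?thesis
    unfolding det_def'[OF c(1)] det_def'[OF c(2)]
  proof (intro tendsto_sum tendsto_mult tendsto_const tendsto_prod)
    fix p i assume "p \<in> {p. p permutes {0..<n}}" "i \<in> {0..<n}"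
    then have "i < n" "p i < n"
      by (auto dest: permutes_in_image)
    then show "((\<lambda>t. M t $$ (i, p i)) \<longlongrightarrow> A $$ (i, p i)) F"
      using assms by (simp add: mat_tendsto_def)
  qed
qed

lemma one_minus_unitary_conj:
  fixes P :: "complex mat"
  assumes P: "P \<in> carrier_mat n n" "mat_adjoint P * P = 1\<^sub>m n"
  shows "1\<^sub>m n - P * mat_diag n f * mat_adjoint P = P * mat_diag n (\<lambda>i. 1 - f i) * mat_adjoint P"
proof -
  have Pa: "mat_adjoint P \<in> carrier_mat n n"
    using P(1) by simp
  have d: "mat_diag n (\<lambda>i. 1 - f i) = 1\<^sub>m n - mat_diag n f"
    by (rule eq_matI) (auto simp: mat_diag_def)
  have "P * mat_diag n (\<lambda>i. 1 - f i) = P - P * mat_diag n f"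
    unfolding d using P(1) by (subst mult_minus_distrib_mat[of _ n n _ n]) auto
  then have "P * mat_diag n (\<lambda>i. 1 - f i) * mat_adjoint P =
      P * mat_adjoint P - P * mat_diag n f * mat_adjoint P"
    using P(1) Pa by (simp add: minus_mult_distrib_mat[of _ n n _ _ n])
  then show ?thesis
    by (simp add: unitary_right_inverse[OF P])
qed

text \<open>One list \<open>es\<close> of eigenvalues serves K' K and K K', where K' is the adjoint,
  so \<open>D\<close> and \<open>E\<close> are unitarily conjugate to the same diagonal matrix; this
  makes the determinants of D + t and E + t equal. The relation \<open>K * D = E * K\<close>
  descends from the one between the squares by \<open>psd_mat_intertwine\<close>.\<close>

lemma defect_operators:
  fixes K :: "complex mat"
  assumes K: "K \<in> carrier_mat n n"
    and contr: "\<forall>v\<in>carrier_vec n. cvec_norm (K *\<^sub>v v) \<le> cvec_norm v"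
  defines "D \<equiv> mat_sqrt (1\<^sub>m n - mat_adjoint K * K)" and "E \<equiv> mat_sqrt (1\<^sub>m n - K * mat_adjoint K)"
  shows "psd_mat D" "D \<in> carrier_mat n n" "D * D = 1\<^sub>m n - mat_adjoint K * K"
    and "psd_mat E" "E \<in> carrier_mat n n" "E * E = 1\<^sub>m n - K * mat_adjoint K"
    and "K * D = E * K"
    and "\<And>t. t > 0 \<Longrightarrow> Determinant.det (D + complex_of_real t \<cdot>\<^sub>m 1\<^sub>m n) =
      Determinant.det (E + complex_of_real t \<cdot>\<^sub>m 1\<^sub>m n)"
    and "\<And>t. t > 0 \<Longrightarrow> Determinant.det (E + complex_of_real t \<cdot>\<^sub>m 1\<^sub>m n) \<noteq> 0"
proof -
  have Ka: "mat_adjoint K \<in> carrier_mat n n"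
    using K by simp
  obtain es where es: "char_poly (mat_adjoint K * K) = (\<Prod>e\<leftarrow>es. [:- e, 1:])"
    using char_poly_factorized[OF mult_carrier_square[OF Ka K]] by blast
  have es': "char_poly (K * mat_adjoint K) = (\<Prod>e\<leftarrow>es. [:- e, 1:])"
    using es char_poly_mult_commute[OF K Ka] by simp
  have herm: "mat_adjoint (mat_adjoint K * K) = mat_adjoint K * K"
    "mat_adjoint (K * mat_adjoint K) = K * mat_adjoint K"
    using mat_adjoint_mult[OF Ka K] mat_adjoint_mult[OF K Ka] by simp_all
  obtain P where P: "P \<in> carrier_mat n n" "mat_adjoint P * P = 1\<^sub>m n"
    "mat_adjoint K * K = P * mat_diag n (\<lambda>i. es ! i) * mat_adjoint P"
    "\<And>i. i < n \<Longrightarrow> es ! i = (mat_adjoint K * K *\<^sub>v col P i) \<bullet>c col P i"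
    "\<And>i. i < n \<Longrightarrow> cvec_norm (col P i) = 1"
    using hermitian_spectral[OF mult_carrier_square[OF Ka K] herm(1) es] by metis
  obtain Q where Q: "Q \<in> carrier_mat n n" "mat_adjoint Q * Q = 1\<^sub>m n"
    "K * mat_adjoint K = Q * mat_diag n (\<lambda>i. es ! i) * mat_adjoint Q"
    using hermitian_spectral[OF mult_carrier_square[OF K Ka] herm(2) es'] by metis
  \<comment> \<open>The i-th eigenvalue of 1 - K' K, with K' the adjoint; contractivity of
    \<open>K\<close> at the unit vector \<open>col P i\<close> makes it nonnegative.\<close>
  define s where "s i = 1 - cvec_norm (K *\<^sub>v col P i) ^ 2" for i
  have s: "es ! i = of_real (1 - s i)" "0 \<le> s i" if i: "i < n" for i
  proof -
    have c: "col P i \<in> carrier_vec n"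
      using P(1) i by auto
    then have Kc: "K *\<^sub>v col P i \<in> carrier_vec n"
      using K by simp
    have "es ! i = (mat_adjoint K *\<^sub>v (K *\<^sub>v col P i)) \<bullet>c col P i"
      unfolding P(4)[OF i] assoc_mult_mat_vec[OF Ka K c] ..
    also have "\<dots> = (K *\<^sub>v col P i) \<bullet>c (K *\<^sub>v col P i)"
      unfolding inner_adjoint[OF Ka Kc c] by simp
    finally show "es ! i = of_real (1 - s i)"
      unfolding cvec_norm_square by (simp add: s_def)
    show "0 \<le> s i"
      using bspec[OF contr c] P(5)[OF i] by (simp add: s_def power_le_one)
  qed
  define r where "r i = complex_of_real (sqrt (s i))" for i
  have r: "mat_diag n (\<lambda>i. 1 - es ! i) = mat_diag n (\<lambda>i. r i * r i)"
    by (rule eq_matI) (auto simp: mat_diag_def s r_def simp flip: of_real_mult)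
  have sq: "1\<^sub>m n - X = (U * mat_diag n r * mat_adjoint U) * (U * mat_diag n r * mat_adjoint U)"
    "psd_mat (U * mat_diag n r * mat_adjoint U)"
    if U: "U \<in> carrier_mat n n" "mat_adjoint U * U = 1\<^sub>m n" and X: "X = U * mat_diag n (\<lambda>i. es ! i) * mat_adjoint U"
    for U X
    unfolding X one_minus_unitary_conj[OF U] r unitary_conj_mult[OF U]
    unfolding r_def by (rule refl) (rule psd_mat_unitary_conj[OF U(1)], simp add: s)
  have cD: "1\<^sub>m n - mat_adjoint K * K \<in> carrier_mat n n" and cE: "1\<^sub>m n - K * mat_adjoint K \<in> carrier_mat n n"
    using K Ka by (auto intro: minus_carrier_mat)
  note sqP = sq[OF P(1-3)] and sqQ = sq[OF Q(1-3)]
  have D_eq: "D = P * mat_diag n r * mat_adjoint P"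
    unfolding D_def by (rule mat_sqrt_eqI[OF sqP(2) sqP(1)[symmetric] cD])
  have E_eq: "E = Q * mat_diag n r * mat_adjoint Q"
    unfolding E_def by (rule mat_sqrt_eqI[OF sqQ(2) sqQ(1)[symmetric] cE])
  show D: "psd_mat D" "D * D = 1\<^sub>m n - mat_adjoint K * K" "D \<in> carrier_mat n n"
    using sqP P(1) unfolding D_eq by auto
  show E: "psd_mat E" "E * E = 1\<^sub>m n - K * mat_adjoint K" "E \<in> carrier_mat n n"
    using sqQ Q(1) unfolding E_eq by auto
  have "K * (D * D) = K - K * (mat_adjoint K * K)"
    unfolding D(2) using K Ka by (subst mult_minus_distrib_mat[of _ n n _ n]) auto
  also have "\<dots> = (E * E) * K"
    unfolding E(2) using K Ka
    by (subst minus_mult_distrib_mat[of _ n n _ _ n]) (auto simp: assoc_mult_square[of _ n])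
  finally show "K * D = E * K"
    by (rule psd_mat_intertwine[OF D(1,3) E(1,3) K])
  fix t :: real assume t: "t > 0"
  show "Determinant.det (D + complex_of_real t \<cdot>\<^sub>m 1\<^sub>m n) = Determinant.det (E + complex_of_real t \<cdot>\<^sub>m 1\<^sub>m n)"
    unfolding D_eq E_eq det_unitary_conj_add[OF P(1,2)] det_unitary_conj_add[OF Q(1,2)] ..
  show "Determinant.det (E + complex_of_real t \<cdot>\<^sub>m 1\<^sub>m n) \<noteq> 0"
    unfolding E_eq det_unitary_conj_add[OF Q(1,2)]
  proof -
    have "r i + of_real t \<noteq> 0" if "i < n" for i
    proof -
      have "sqrt (s i) + t > 0"
        using s(2)[OF that] t by (intro add_nonneg_pos) auto
      then show ?thesis
        unfolding r_def of_real_add[symmetric] of_real_eq_0_iff by simp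
    qed
    then show "(\<Prod>i<n. r i + of_real t) \<noteq> 0"
      by simp
  qed
qed

text \<open>
  For \<open>t > 0\<close> the matrices \<open>D + t\<close> and \<open>E + t\<close> are invertible and still intertwined by \<open>K\<close>, so
  the transfer function factors; the limit \<open>t \<rightarrow> 0\<close> covers singular defect operators.
\<close>

lemma det_transfer_numerator:
  fixes K Z :: "complex mat"
  assumes K: "K \<in> carrier_mat n n" and Z: "Z \<in> carrier_mat n n"
    and contr: "\<forall>v\<in>carrier_vec n. cvec_norm (K *\<^sub>v v) \<le> cvec_norm v"
  defines "D \<equiv> mat_sqrt (1\<^sub>m n - mat_adjoint K * K)" and "E \<equiv> mat_sqrt (1\<^sub>m n - K * mat_adjoint K)"
    and "A \<equiv> 1\<^sub>m n - K * Z"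
  shows "Determinant.det A * Determinant.det (D * Z * adj_mat A * E - Determinant.det A \<cdot>\<^sub>m mat_adjoint K) =
    Determinant.det A ^ n * Determinant.det (Z - mat_adjoint K)"
proof -
  note defect = defect_operators[OF K contr, folded D_def E_def]
  define a where "a = Determinant.det A"
  \<comment> \<open>The adjugate stands in for the inverse of \<open>A\<close>, so the identity
    holds even where \<open>Determinant.det A\<close> vanishes.\<close>
  define B where "B = adj_mat A"
  have Ka: "mat_adjoint K \<in> carrier_mat n n"
    using K by simp
  have KZ: "K * Z \<in> carrier_mat n n"
    using K Z by simp
  have A: "A \<in> carrier_mat n n"
    unfolding A_def using KZ by (rule minus_carrier_mat)
  have B: "B \<in> carrier_mat n n" "A * B = a \<cdot>\<^sub>m 1\<^sub>m n"
    using adj_mat[OF A] by (auto simp: B_def a_def)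
  note D = defect(2) and E = defect(5)
  have adj: "mat_adjoint D = D" "mat_adjoint E = E"
    using defect(1,4) by (auto simp: psd_mat_def)
  have DK: "D * mat_adjoint K = mat_adjoint K * E"
    using mat_adjoint_mult[OF K D] mat_adjoint_mult[OF E K] defect(7) adj by simp
  define Dt where "Dt t = D + complex_of_real t \<cdot>\<^sub>m 1\<^sub>m n" for t
  define Et where "Et t = E + complex_of_real t \<cdot>\<^sub>m 1\<^sub>m n" for t
  have Dt: "Dt t \<in> carrier_mat n n" and Et: "Et t \<in> carrier_mat n n" for t
    using D E by (auto simp: Dt_def Et_def)
  define g where "g t = Dt t * Z * B * Et t - a \<cdot>\<^sub>m mat_adjoint K" for t
  have g_carr: "g t \<in> carrier_mat n n" for t
    unfolding g_def using Ka by (intro minus_carrier_mat) simp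
  have tend: "mat_tendsto n Dt D (at_right 0)" "mat_tendsto n Et E (at_right 0)"
  proof -
    have "mat_tendsto n (\<lambda>t. X + complex_of_real t \<cdot>\<^sub>m 1\<^sub>m n) X (at_right 0)" if X: "X \<in> carrier_mat n n" for X
    proof -
      have "((\<lambda>t. (X + complex_of_real t \<cdot>\<^sub>m 1\<^sub>m n) $$ (i, j)) \<longlongrightarrow> X $$ (i, j)) (at_right 0)"
        if "i < n" "j < n" for i j
      proof -
        have "((\<lambda>t. X $$ (i, j) + complex_of_real t * (if i = j then 1 else 0)) \<longlongrightarrow>
            X $$ (i, j) + complex_of_real 0 * (if i = j then 1 else 0)) (at_right 0)"
          by (intro tendsto_intros)
        then show ?thesis
          using that X by simp
      qed
      then show ?thesis
        using X by (simp add: mat_tendsto_def)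
    qed
    then show "mat_tendsto n Dt D (at_right 0)" "mat_tendsto n Et E (at_right 0)"
      unfolding Dt_def [abs_def] Et_def [abs_def] using D E by auto
  qed
  \<comment> \<open>Multiplying \<open>g t\<close> by \<open>Dt t\<close> on the left moves
    \<open>Dt t\<close> past the adjoint of \<open>K\<close>, where it becomes \<open>Et t\<close>,
    and a common factor \<open>B * Et t\<close> splits off on the right. The determinants of
    \<open>Dt t\<close> and \<open>Et t\<close> are equal and nonzero, so they cancel.\<close>
  have key: "Determinant.det (g t) = Determinant.det (Dt t * Dt t * Z - mat_adjoint K * A) * Determinant.det B"
    if t: "t > 0" for t
  proof -
    have DtK: "Dt t * mat_adjoint K = mat_adjoint K * Et t"
      unfolding Dt_def Et_def using D E Ka
      by (simp add: add_mult_distrib_mat[of _ n n _ _ n] mult_add_distrib_mat[of _ n n _ n] DK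
          left_mult_one_mat[of _ n n] right_mult_one_mat[of _ n n] mult_smult_distrib[of _ n n _ n] mult_smult_assoc_mat[of _ n n _ n])
    have BE: "B * Et t \<in> carrier_mat n n"
      using B Et by simp
    have aK: "a \<cdot>\<^sub>m mat_adjoint K \<in> carrier_mat n n"
      using Ka by simp
    have "a \<cdot>\<^sub>m (mat_adjoint K * Et t) = mat_adjoint K * ((A * B) * Et t)"
      unfolding B(2) using Ka Et[of t]
      by (simp add: mult_smult_distrib[of _ n n _ n] mult_smult_assoc_mat[of _ n n _ n])
    also have "\<dots> = (mat_adjoint K * A) * (B * Et t)"
      using Ka A B(1) Et[of t] by (simp add: assoc_mult_square[of _ n])
    finally have e1: "Dt t * (a \<cdot>\<^sub>m mat_adjoint K) = (mat_adjoint K * A) * (B * Et t)"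
      using Ka Dt[of t] by (simp add: mult_smult_distrib[of _ n n _ n] DtK)
    have "Dt t * g t = Dt t * (Dt t * Z * B * Et t) - Dt t * (a \<cdot>\<^sub>m mat_adjoint K)"
      unfolding g_def using Dt[of t] Z B(1) Et[of t] aK
      by (subst mult_minus_distrib_mat[of _ n n _ n]) auto
    also have "Dt t * (Dt t * Z * B * Et t) = (Dt t * Dt t * Z) * (B * Et t)"
      using Dt[of t] Z B(1) Et[of t] by (simp add: assoc_mult_square[of _ n])
    also have "(Dt t * Dt t * Z) * (B * Et t) - Dt t * (a \<cdot>\<^sub>m mat_adjoint K) =
        (Dt t * Dt t * Z - mat_adjoint K * A) * (B * Et t)"
      unfolding e1 using Dt[of t] Z Ka A BE
      by (subst minus_mult_distrib_mat[of _ n n _ _ n]) auto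
    finally have eq: "Dt t * g t = (Dt t * Dt t * Z - mat_adjoint K * A) * (B * Et t)" .
    have c: "Dt t * Dt t * Z - mat_adjoint K * A \<in> carrier_mat n n"
      using Ka A by (intro minus_carrier_mat) simp
    have "Determinant.det (Dt t) * Determinant.det (g t) =
        Determinant.det (Dt t * Dt t * Z - mat_adjoint K * A) * (Determinant.det B * Determinant.det (Et t))"
      using arg_cong[OF eq, of Determinant.det]
      unfolding Determinant.det_mult[OF Dt g_carr] Determinant.det_mult[OF c BE] Determinant.det_mult[OF B(1) Et] .
    moreover have "Determinant.det (Dt t) = Determinant.det (Et t)" "Determinant.det (Et t) \<noteq> 0"
      unfolding Dt_def Et_def by (rule defect(8)[OF t], rule defect(9)[OF t])
    ultimately show ?thesis
      by simp
  qed
  have lim1: "((\<lambda>t. Determinant.det (g t)) \<longlongrightarrow> Determinant.det (D * Z * B * E - a \<cdot>\<^sub>m mat_adjoint K)) (at_right 0)"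
    unfolding g_def using Z B(1) Ka
    by (intro tendsto_det[of n] mat_tendsto_minus mat_tendsto_mult mat_tendsto_const tend) auto
  have lim2: "((\<lambda>t. Determinant.det (Dt t * Dt t * Z - mat_adjoint K * A) * Determinant.det B) \<longlongrightarrow>
      Determinant.det (D * D * Z - mat_adjoint K * A) * Determinant.det B) (at_right 0)"
    using Z A Ka
    by (intro tendsto_mult tendsto_const tendsto_det[of n] mat_tendsto_minus mat_tendsto_mult mat_tendsto_const tend) auto
  have "\<forall>\<^sub>F t in at_right 0. Determinant.det (g t) =
      Determinant.det (Dt t * Dt t * Z - mat_adjoint K * A) * Determinant.det B"
    unfolding eventually_at_right_field using key by (intro exI[of _ 1]) auto
  from tendsto_unique[OF trivial_limit_at_right_real lim1 Lim_transform_eventually[OF lim2]]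
  have det_g: "Determinant.det (D * Z * B * E - a \<cdot>\<^sub>m mat_adjoint K) =
      Determinant.det (D * D * Z - mat_adjoint K * A) * Determinant.det B"
    using \<open>\<forall>\<^sub>F t in at_right 0. _ t\<close> by (simp add: eq_commute)
  have "D * D * Z = Z - mat_adjoint K * K * Z"
    unfolding defect(3) using Ka K Z by (subst minus_mult_distrib_mat[of _ n n _ _ n]) auto
  moreover have "mat_adjoint K * A = mat_adjoint K - mat_adjoint K * K * Z"
    unfolding A_def using Ka K Z
    by (subst mult_minus_distrib_mat[of _ n n _ n]) (auto simp: assoc_mult_square[of _ n])
  ultimately have "D * D * Z - mat_adjoint K * A = Z - mat_adjoint K"
    using Ka K Z by (intro eq_matI) auto
  \<comment> \<open>Keeping the factor \<open>a\<close> avoids the exponent n - 1 and any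
    cancellation of a possibly vanishing \<open>a\<close>; it is the extra factor in the
    conclusion.\<close>
  moreover have "a * Determinant.det B = a ^ n"
    using arg_cong[OF B(2), of Determinant.det] A B(1) by (simp add: Determinant.det_mult[of _ n] a_def)
  ultimately show ?thesis
    using det_g by (simp add: a_def B_def mult_ac)
qed

text \<open>With C the inverse of A = 1 - K Z, the adjugate is det A times C, so the matrix in
  \<open>det_transfer_numerator\<close> is det A times the transfer function and its determinant
  gains the factor (det A)^n.\<close>

lemma det_transfer_function:
  fixes K Z :: "complex mat"
  assumes K: "K \<in> carrier_mat n n" and Z: "Z \<in> carrier_mat n n"
    and contr: "\<forall>v\<in>carrier_vec n. cvec_norm (K *\<^sub>v v) \<le> cvec_norm v"
    and nz: "Determinant.det (1\<^sub>m n - K * Z) \<noteq> 0"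
  shows "Determinant.det (- mat_adjoint K + mat_sqrt (1\<^sub>m n - mat_adjoint K * K) * Z *
      the (mat_inverse (1\<^sub>m n - K * Z)) * mat_sqrt (1\<^sub>m n - K * mat_adjoint K)) =
    Determinant.det (Z - mat_adjoint K) / Determinant.det (1\<^sub>m n - K * Z)"
proof -
  define D where "D = mat_sqrt (1\<^sub>m n - mat_adjoint K * K)"
  define E where "E = mat_sqrt (1\<^sub>m n - K * mat_adjoint K)"
  define A where "A = 1\<^sub>m n - K * Z"
  define a where "a = Determinant.det A"
  note defect = defect_operators[OF K contr, folded D_def E_def]
  have Ka: "mat_adjoint K \<in> carrier_mat n n"
    using K by simp
  have a: "a \<noteq> 0"
    using nz by (simp add: a_def A_def)
  have KZ: "K * Z \<in> carrier_mat n n"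
    using K Z by simp
  have A: "A \<in> carrier_mat n n"
    unfolding A_def using KZ by (rule minus_carrier_mat)
  note B = adj_mat[OF A, folded a_def]
  obtain C where C: "mat_inverse A = Some C"
  proof (cases "mat_inverse A")
    case None
    have "A \<in> Units (ring_mat TYPE(complex) n ())"
      using det_non_zero_imp_unit[OF A] a by (simp add: a_def)
    with mat_inverse(1)[OF A None, of "()"] show ?thesis by blast
  qed
  note C' = mat_inverse(2)[OF A C]
  have "adj_mat A = (C * A) * adj_mat A"
    using C' B(1) by simp
  also have "\<dots> = C * (a \<cdot>\<^sub>m 1\<^sub>m n)"
    using assoc_mult_square[of C n A "adj_mat A"] C' A B by metis
  also have "\<dots> = a \<cdot>\<^sub>m C"
    using C' by (simp add: mult_smult_distrib[of _ n n _ n] right_mult_one_mat[of _ n n])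
  finally have adj: "adj_mat A = a \<cdot>\<^sub>m C" .
  define G where "G = - mat_adjoint K + D * Z * C * E"
  have G: "G \<in> carrier_mat n n"
    unfolding G_def using Ka Z C' defect(2,5) by auto
  have X: "D * Z * C * E \<in> carrier_mat n n"
    using Z C' defect(2,5) by simp
  have smult: "a \<cdot>\<^sub>m M - a \<cdot>\<^sub>m M' = a \<cdot>\<^sub>m (- M' + M)"
    if "M \<in> carrier_mat n n" "M' \<in> carrier_mat n n" for M M'
    using that by (intro eq_matI) (auto simp: algebra_simps)
  have "D * Z * adj_mat A * E = a \<cdot>\<^sub>m (D * Z * C * E)"
    unfolding adj using Z C' defect(2,5)
    by (simp add: mult_smult_distrib[of _ n n _ n] mult_smult_assoc_mat[of _ n n _ n])
  then have "D * Z * adj_mat A * E - a \<cdot>\<^sub>m mat_adjoint K = a \<cdot>\<^sub>m G"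
    unfolding G_def using smult[OF X Ka] by simp
  then have "a * (a ^ n * Determinant.det G) = a ^ n * Determinant.det (Z - mat_adjoint K)"
    using det_transfer_numerator[OF K Z contr, folded D_def E_def A_def, folded a_def] G
    by (simp add: Determinant.det_smult)
  then have "a * Determinant.det G = Determinant.det (Z - mat_adjoint K)"
    using a by (simp add: mult.left_commute)
  then show ?thesis
    using a C unfolding G_def D_def E_def A_def a_def by (simp add: field_simps)
qed

section \<open>The reflected polynomial as a determinant\<close>

lemma diag_block_mat_scalar_blocks:
  "diag_block_mat (map (\<lambda>i. f i \<cdot>\<^sub>m 1\<^sub>m (m i)) xs) =
    mat_diag (length (concat (map (\<lambda>i. replicate (m i) i) xs)))
      (\<lambda>j. (f (concat (map (\<lambda>i. replicate (m i) i) xs) ! j) :: complex))"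
proof (induction xs)
  case Nil
  show ?case by (rule eq_matI) (auto simp: mat_diag_def)
next
  case (Cons x xs)
  define ys where "ys = concat (map (\<lambda>i. replicate (m i) i) xs)"
  have "diag_block_mat (map (\<lambda>i. f i \<cdot>\<^sub>m 1\<^sub>m (m i)) (x # xs)) =
      four_block_mat (f x \<cdot>\<^sub>m 1\<^sub>m (m x)) (0\<^sub>m (m x) (length ys)) (0\<^sub>m (length ys) (m x))
        (mat_diag (length ys) (\<lambda>j. f (ys ! j)))"
    using Cons.IH by (simp add: ys_def Let_def mat_diag_def)
  also have "\<dots> = mat_diag (length (replicate (m x) x @ ys)) (\<lambda>j. f ((replicate (m x) x @ ys) ! j))"
    by (rule eq_matI) (auto simp: mat_diag_def nth_append)
  finally show ?case
    by (simp add: ys_def)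
qed

text \<open>\<open>b i\<close> is the variable at the diagonal position \<open>i\<close>. From here
  on the block structure is forgotten and \<open>Zmat\<close> is an ordinary diagonal
  matrix.\<close>

lemma Zmat_eq_mat_diag:
  fixes n :: "nat ^ 'd::{finite,linorder}"
  obtains b where "\<And>z. Zmat n z = mat_diag (msize n) (\<lambda>i. z $ b i)"
    "\<And>z. (\<Prod>i<msize n. z $ b i) = monomial z n"
proof -
  define xs where "xs = sorted_list_of_set (UNIV :: 'd set)"
  define ys where "ys = concat (map (\<lambda>i. replicate (n $ i) i) xs)"
  have xs: "distinct xs" "set xs = UNIV"
    by (simp_all add: xs_def)
  have "length ys = (\<Sum>i\<leftarrow>xs. n $ i)"
    by (simp add: ys_def length_concat o_def)
  also have "\<dots> = msize n"
    using xs by (simp add: msize_def sum_list_distinct_conv_sum_set)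
  finally have len: "length ys = msize n" .
  show thesis
  proof (rule that[of "\<lambda>j. ys ! j"])
    fix z :: "complex ^ 'd::{finite,linorder}"
    show "Zmat n z = mat_diag (msize n) (\<lambda>i. z $ (ys ! i))"
      unfolding Zmat_def len[symmetric] ys_def xs_def[symmetric] by (rule diag_block_mat_scalar_blocks)
    have "(\<Prod>i<msize n. z $ (ys ! i)) = prod_list (map (\<lambda>i. z $ i) ys)"
      by (simp add: prod.list_conv_set_nth len atLeast0LessThan)
    also have "\<dots> = (\<Prod>i\<leftarrow>xs. z $ i ^ n $ i)"
      unfolding ys_def by (induction xs) simp_all
    also have "\<dots> = monomial z n"
      using xs by (simp add: monomial_def prod.distinct_set_conv_list[symmetric])
    finally show "(\<Prod>i<msize n. z $ (ys ! i)) = monomial z n" .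
  qed
qed

lemma keys_conj_poly [simp]: "Poly_Mapping.keys (conj_poly p) = Poly_Mapping.keys p"
  by (auto simp: conj_poly_def Poly_Mapping.keys.rep_eq Poly_Mapping.map.rep_eq when_def)

lemma lookup_conj_poly [simp]: "Poly_Mapping.lookup (conj_poly p) k = cnj (Poly_Mapping.lookup p k)"
  by (simp add: conj_poly_def Poly_Mapping.map.rep_eq when_def)

text \<open>Meant for \<open>m\<close> above all exponents of \<open>p\<close>, where the truncated
  difference \<open>m - k\<close> is a true difference and the reflection is an honest
  polynomial.\<close>

definition reflection_poly :: "nat ^ 'd \<Rightarrow> 'd::finite mpolynomial \<Rightarrow> 'd mpolynomial"
  where "reflection_poly m p =
    (\<Sum>k\<in>Poly_Mapping.keys p. Poly_Mapping.single (m - k) (cnj (Poly_Mapping.lookup p k)))"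

lemma reflection_eq_peval:
  assumes "\<And>k. k \<in> Poly_Mapping.keys p \<Longrightarrow> k \<le> m"
  shows "reflection m p z = peval (reflection_poly m p) z"
proof -
  have "(\<Prod>i\<in>UNIV. z $ i powi (int (m $ i) - int (k $ i))) = monomial z (m - k)"
    if "k \<in> Poly_Mapping.keys p" for k
    unfolding monomial_def
  proof (rule prod.cong)
    fix i
    have "k $ i \<le> m $ i"
      using assms[OF that] by (simp add: Finite_Cartesian_Product.less_eq_vec_def)
    then have "int (m $ i) - int (k $ i) = int ((m - k) $ i)"
      by simp
    then show "z $ i powi (int (m $ i) - int (k $ i)) = z $ i ^ (m - k) $ i"
      by (simp only: power_int_of_nat)
  qed simp
  then show ?thesis
    by (simp add: reflection_def reflection_poly_def peval_hom.hom_sum)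
qed

lemma lookup_reflection_poly:
  assumes "\<And>k. k \<in> Poly_Mapping.keys p \<Longrightarrow> k \<le> m" "k \<in> Poly_Mapping.keys p"
  shows "Poly_Mapping.lookup (reflection_poly m p) (m - k) = cnj (Poly_Mapping.lookup p k)"
proof -
  have "m - j = m - k \<longleftrightarrow> j = k" if "j \<in> Poly_Mapping.keys p" for j
    using assms(1)[OF that] assms(1)[OF assms(2)]
    by (metis add_right_cancel nat_vec_add_diff)
  then have "Poly_Mapping.lookup (reflection_poly m p) (m - k) =
      (\<Sum>j\<in>Poly_Mapping.keys p. if j = k then cnj (Poly_Mapping.lookup p j) else 0)"
    unfolding reflection_poly_def lookup_sum by (intro sum.cong) (auto simp: lookup_single when_def)
  then show ?thesis
    using assms(2) by simp
qed

lemma nonzero_if_norm_1: "(\<And>i. cmod (z $ i) = 1) \<Longrightarrow> z $ i \<noteq> 0"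
  by (metis norm_zero zero_neq_one)

text \<open>
  Multiplying by a large monomial and comparing coefficients bounds the degree of \<open>p\<close> by \<open>n\<close>,
  so no exponent in \<open>reflection n p\<close> is negative.
\<close>

lemma reflection_eq_polynomial:
  fixes p q :: "'d::finite mpolynomial"
  assumes q: "\<And>z. (\<And>i. z $ i \<noteq> 0) \<Longrightarrow> monomial z n * peval (conj_poly p) (\<chi> i. 1 / z $ i) = peval q z"
  shows "reflection n p z = peval q z"
proof -
  obtain L where L: "L > 0" "\<And>j i. j \<in> Poly_Mapping.keys p \<Longrightarrow> j $ i < L" "\<And>i. n $ i < L"
    using exists_degree_bound[of p n] by blast
  define m :: "nat ^ 'd" where "m = (\<chi> i. L)"
  have m: "k \<le> m" if "k \<in> Poly_Mapping.keys p" for k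
    using L(2)[OF that] by (simp add: m_def Finite_Cartesian_Product.less_eq_vec_def less_imp_le)
  have n: "n \<le> m"
    using L(3) by (simp add: m_def Finite_Cartesian_Product.less_eq_vec_def less_imp_le)
  have "reflection_poly m p = Poly_Mapping.single (m - n) 1 * q"
  proof (rule mpoly_eqI_torus)
    fix z :: "complex ^ 'd" assume "\<And>i. cmod (z $ i) = 1"
    then have z: "z $ i \<noteq> 0" for i
      by (rule nonzero_if_norm_1)
    have "peval (reflection_poly m p) z = monomial z m * peval (conj_poly p) (\<chi> i. 1 / z $ i)"
      using reflection_eq_peval[OF m] reflection_eq[OF z] by metis
    also have "monomial z m = monomial z (m - n) * monomial z n"
      using nat_vec_add_diff[OF n] by (metis monomial_add mult.commute)
    finally show "peval (reflection_poly m p) z = peval (Poly_Mapping.single (m - n) 1 * q) z"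
      using q[OF z] by (simp add: peval_mult)
  qed
  \<comment> \<open>All exponents on the right-hand side are at least \<open>m - n\<close>, while
    each \<open>k\<close> in \<open>p\<close> contributes the exponent \<open>m - k\<close> on the
    left with nonzero coefficient.\<close>
  then have le_n: "k \<le> n" if k: "k \<in> Poly_Mapping.keys p" for k
  proof -
    have "Poly_Mapping.lookup (Poly_Mapping.single (m - n) 1 * q) (m - k) \<noteq> 0"
      using lookup_reflection_poly[OF m k] k \<open>reflection_poly m p = _\<close> by (simp add: in_keys_iff)
    then have "m - k \<in> Poly_Mapping.keys (Poly_Mapping.single (m - n) (1 :: complex) * q)"
      by (simp add: in_keys_iff)
    then obtain b where "m - k = (m - n) + b"
      using keys_mult[of "Poly_Mapping.single (m - n) (1 :: complex)" q] by auto
    then have "m $ i - k $ i = (m $ i - n $ i) + b $ i" for i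
      by (metis vector_add_component vector_minus_component)
    moreover have "k $ i \<le> m $ i" "n $ i \<le> m $ i" for i
      using m[OF k] n by (auto simp: Finite_Cartesian_Product.less_eq_vec_def)
    ultimately have "k $ i \<le> n $ i" for i
      by (metis add_leD1 diff_le_mono2 diff_diff_cancel le_add1)
    then show "k \<le> n"
      by (simp add: Finite_Cartesian_Product.less_eq_vec_def)
  qed
  have "reflection_poly n p = q"
  proof (rule mpoly_eqI_torus)
    fix z :: "complex ^ 'd" assume "\<And>i. cmod (z $ i) = 1"
    then have z: "z $ i \<noteq> 0" for i
      by (rule nonzero_if_norm_1)
    show "peval (reflection_poly n p) z = peval q z"
      using reflection_eq_peval[OF le_n] reflection_eq[OF z] q[OF z] by metis
  qed
  then show ?thesis
    using reflection_eq_peval[OF le_n] by simp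
qed

lemma det_mat_adjoint:
  assumes "A \<in> carrier_mat n n"
  shows "Determinant.det (mat_adjoint A) = cnj (Determinant.det A)"
proof -
  interpret cnj_hom: comm_ring_hom cnj
    by unfold_locales auto
  have "mat_adjoint A = map_mat cnj (transpose_mat A)"
    by (rule eq_matI) auto
  then show ?thesis
    using Determinant.det_transpose[OF assms] by simp
qed

definition const_poly :: "complex \<Rightarrow> 'd::finite mpolynomial"
  where "const_poly a = Poly_Mapping.single 0 a"

definition var_poly :: "'d \<Rightarrow> 'd::finite mpolynomial"
  where "var_poly i = Poly_Mapping.single (axis i 1) 1"

lemma peval_const_poly [simp]: "peval (const_poly a) z = a"
  by (simp add: const_poly_def)

lemma peval_var_poly [simp]: "peval (var_poly i) z = z $ i"
  by (simp add: var_poly_def del: One_nat_def)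

text \<open>For nonzero coordinates, taking the adjoint of 1 - K Z at the conjugate of 1/z shows
  that the reflection is z^n det (1 - Z^-1 K') with K' the adjoint of K, and z^n = det Z absorbs the
  inverse. The result is a polynomial in z, so \<open>reflection_eq_polynomial\<close> covers
  vanishing coordinates too.\<close>

lemma reflection_eq_det:
  fixes p :: "'d::{finite,linorder} mpolynomial" and n :: "nat ^ 'd::{finite,linorder}"
  assumes K: "K \<in> carrier_mat (msize n) (msize n)"
    and p: "\<And>z. peval p z = Determinant.det (1\<^sub>m (msize n) - K * Zmat n z)"
  shows "reflection n p z = Determinant.det (Zmat n z - mat_adjoint K)"
proof -
  define N where "N = msize n"
  obtain b where b: "\<And>z. Zmat n z = mat_diag N (\<lambda>i. z $ b i)" "\<And>z. (\<Prod>i<N. z $ b i) = monomial z n"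
    using Zmat_eq_mat_diag[of n] unfolding N_def by metis
  note K = K[folded N_def]
  have Ka: "mat_adjoint K \<in> carrier_mat N N"
    using K by simp
  define q where "q = Determinant.det (mat_diag N (\<lambda>i. var_poly (b i)) - map_mat const_poly (mat_adjoint K))"
  have q: "peval q z = Determinant.det (Zmat n z - mat_adjoint K)" for z
    unfolding q_def peval_hom.hom_det[symmetric]
    by (rule arg_cong[of _ _ Determinant.det], rule eq_matI)
      (use K in \<open>auto simp: mat_diag_def b peval_hom.hom_minus\<close>)
  have "reflection n p z = peval q z"
  proof (rule reflection_eq_polynomial)
    fix z :: "complex ^ 'd::{finite,linorder}" assume z: "\<And>i. z $ i \<noteq> 0"
    define w :: "complex ^ 'd::{finite,linorder}" where "w = (\<chi> i. 1 / z $ i)"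
    have Z: "Zmat n x \<in> carrier_mat N N" for x
      unfolding b(1) by simp
    have ZK: "Zmat n w * mat_adjoint K \<in> carrier_mat N N"
      using Z Ka by simp
    have KZ: "1\<^sub>m N - K * Zmat n x \<in> carrier_mat N N" for x
      using mult_carrier_square[OF K Z] by (rule minus_carrier_mat)
    have "peval (conj_poly p) w = cnj (Determinant.det (1\<^sub>m N - K * Zmat n (\<chi> i. cnj (w $ i))))"
      unfolding peval_conj_poly p N_def ..
    also have "\<dots> = Determinant.det (mat_adjoint (1\<^sub>m N - K * Zmat n (\<chi> i. cnj (w $ i))))"
      by (rule det_mat_adjoint[OF KZ, symmetric])
    also have "mat_adjoint (1\<^sub>m N - K * Zmat n (\<chi> i. cnj (w $ i))) =
        1\<^sub>m N - mat_adjoint (Zmat n (\<chi> i. cnj (w $ i))) * mat_adjoint K"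
      using mat_adjoint_minus[OF one_carrier_mat mult_carrier_square[OF K Z]] mat_adjoint_mult[OF K Z] by simp
    also have "mat_adjoint (Zmat n (\<chi> i. cnj (w $ i))) = Zmat n w"
      unfolding b(1) mat_adjoint_mat_diag by simp
    finally have 1: "peval (conj_poly p) w = Determinant.det (1\<^sub>m N - Zmat n w * mat_adjoint K)" .
    have 2: "monomial z n = Determinant.det (Zmat n z)"
      unfolding b(1) det_mat_diag b(2) ..
    have "Zmat n z * Zmat n w = 1\<^sub>m N"
      unfolding b(1) mat_diag_diag using z by (simp add: w_def)
    then have "Zmat n z * (Zmat n w * mat_adjoint K) = mat_adjoint K"
      using assoc_mult_square[OF Z Z Ka, of z w] left_mult_one_mat[OF Ka] by simp
    then have "Zmat n z * (1\<^sub>m N - Zmat n w * mat_adjoint K) = Zmat n z - mat_adjoint K"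
      using Z[of z] by (subst mult_minus_distrib_mat[OF Z one_carrier_mat ZK]) simp
    then show "monomial z n * peval (conj_poly p) (\<chi> i. 1 / z $ i) = peval q z"
      unfolding w_def[symmetric] 1 2 q
      using Determinant.det_mult[OF Z minus_carrier_mat[OF ZK], of z "1\<^sub>m N"] by simp
  qed
  then show ?thesis
    using q by simp
qed

text \<open>A supremum of reals carries information only for a bounded set; entries of vectors in
  the unit ball have modulus at most 1, which gives this crude bound by row sums.\<close>

lemma bounded_mat_image:
  fixes A :: "complex mat"
  shows "bdd_above ((\<lambda>v. cvec_norm (A *\<^sub>v v)) ` {v \<in> carrier_vec (dim_col A). cvec_norm v \<le> 1})"
proof (rule bdd_aboveI2)
  fix v assume v: "v \<in> {v \<in> carrier_vec (dim_col A). cvec_norm v \<le> 1}"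
  then have dim: "dim_vec v = dim_col A" by auto
  have comp: "cmod (vec_index v j) \<le> 1" if "j < dim_col A" for j
  proof -
    have "cmod (vec_index v j) ^ 2 \<le> (\<Sum>j<dim_vec v. cmod (vec_index v j) ^ 2)"
      by (rule member_le_sum) (use that dim in auto)
    also have "\<dots> \<le> 1"
      using v by (simp add: cvec_norm_sum[symmetric] power_le_one)
    finally show ?thesis
      by (simp add: power2_le_iff_abs_le abs_square_le_1)
  qed
  have "cvec_norm (A *\<^sub>v v) ^ 2 = (\<Sum>i<dim_row A. cmod (\<Sum>j<dim_col A. A $$ (i, j) * vec_index v j) ^ 2)"
    by (simp add: cvec_norm_sum scalar_prod_def dim atLeast0LessThan)
  also have "\<dots> \<le> (\<Sum>i<dim_row A. (\<Sum>j<dim_col A. cmod (A $$ (i, j))) ^ 2)"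
    by (intro sum_mono power_mono order.trans[OF norm_sum] sum_mono)
      (auto simp: norm_mult intro!: mult_left_le comp)
  finally show "cvec_norm (A *\<^sub>v v) \<le> sqrt (\<Sum>i<dim_row A. (\<Sum>j<dim_col A. cmod (A $$ (i, j))) ^ 2)"
    by (simp add: real_le_rsqrt)
qed

lemma cvec_norm_mat_le:
  fixes K :: "complex mat"
  assumes K: "K \<in> carrier_mat m n" "mat_op_norm K \<le> 1" and v: "v \<in> carrier_vec n"
  shows "cvec_norm (K *\<^sub>v v) \<le> cvec_norm v"
proof (cases "v = 0\<^sub>v n")
  case True
  have "K *\<^sub>v 0\<^sub>v n = 0\<^sub>v m"
    using K by (intro eq_vecI) auto
  then show ?thesis
    using True cvec_norm_eq_0_iff[of "0\<^sub>v m" m] by simp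
next
  case False
  then have nv: "cvec_norm v > 0"
    using cvec_norm_eq_0_iff[OF v] cvec_norm_nonneg[of v] by (simp add: less_le)
  define c where "c = complex_of_real (1 / cvec_norm v)"
  have "cvec_norm (c \<cdot>\<^sub>v v) = 1"
    using nv by (simp add: cvec_norm_smult c_def norm_divide)
  moreover have "c \<cdot>\<^sub>v v \<in> carrier_vec (dim_col K)"
    using v K by simp
  ultimately have "cvec_norm (K *\<^sub>v (c \<cdot>\<^sub>v v)) \<le> mat_op_norm K"
    unfolding mat_op_norm_def by (intro cSUP_upper bounded_mat_image) auto
  also note K(2)
  finally have "cvec_norm (K *\<^sub>v v) / cvec_norm v \<le> 1"
    using nv unfolding mult_mat_vec[OF K(1) v] cvec_norm_smult by (simp add: c_def norm_divide)
  then show ?thesis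
    using nv by (simp add: divide_le_eq)
qed

section \<open>Functional calculus for commuting strict contractions\<close>

instance complex_hilbert \<subseteq> banach ..

lemma scaleC_op_apply [simp]: "blinfun_apply (scaleC_op a A) x = a *\<^sub>C blinfun_apply A x"
  by (simp add: scaleC_op.rep_eq)

lemma scaleC_sum_right: "a *\<^sub>C (\<Sum>i\<in>I. f i) = (\<Sum>i\<in>I. a *\<^sub>C (f i :: 'h::complex_hilbert))"
  by (rule bounded_linear.linear[OF bounded_linear_scaleC, THEN linear_sum])

lemma scaleC_zero_left [simp]: "0 *\<^sub>C (x :: 'h::complex_hilbert) = 0"
  using scaleC_add_left[of 0 0 x] by simp

lemma scaleC_one [simp]: "1 *\<^sub>C (x :: 'h::complex_hilbert) = x"
  using scaleC_of_real[of 1 x] by simp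

lemma scaleC_diff_left: "(a - b) *\<^sub>C x = a *\<^sub>C x - b *\<^sub>C (x :: 'h::complex_hilbert)"
  using scaleC_add_left[of "a - b" b x] by simp

lemma scaleC_sum_left: "(\<Sum>i\<in>I. f i) *\<^sub>C x = (\<Sum>i\<in>I. f i *\<^sub>C (x :: 'h::complex_hilbert))"
  by (induction I rule: infinite_finite_induct) (simp_all add: scaleC_add_left)

lemma inner_scaleC_left: "inner (a *\<^sub>C x) y = inner x (cnj a *\<^sub>C (y :: 'h::complex_hilbert))"
proof -
  have "cinner x (cnj a *\<^sub>C y) = a * cinner x y"
    by (metis cinner_commute cinner_scaleC_left complex_cnj_cnj complex_cnj_mult)
  then show ?thesis
    by (metis Re_cinner cinner_scaleC_left)
qed

lemma scaleC_op_add_left: "scaleC_op (a + b) A = scaleC_op a A + scaleC_op b A"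
  by (rule blinfun_eqI) (simp add: scaleC_add_left blinfun.add_left)

lemma scaleC_op_scaleC_op: "scaleC_op a (scaleC_op b A) = scaleC_op (a * b) A"
  by (rule blinfun_eqI) (simp add: scaleC_scaleC)

lemma norm_scaleC_op_le: "norm (scaleC_op a A) \<le> cmod a * norm A"
proof (rule norm_blinfun_bound)
  fix x
  show "norm (blinfun_apply (scaleC_op a A) x) \<le> cmod a * norm A * norm x"
    using mult_left_mono[OF norm_blinfun[of A x], of "cmod a"] by (simp add: norm_scaleC mult.assoc)
qed simp

lemma bounded_linear_scaleC_op: "bounded_linear (scaleC_op a)"
proof (rule bounded_linear_intro)
  show "scaleC_op a (A + B) = scaleC_op a A + scaleC_op a B" for A B
    by (rule blinfun_eqI) (simp add: scaleC_add_right blinfun.add_left)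
  show "scaleC_op a (r *\<^sub>R A) = r *\<^sub>R scaleC_op a A" for r A
    by (rule blinfun_eqI)
      (simp add: blinfun.scaleR_left linear_scale[OF bounded_linear.linear[OF bounded_linear_scaleC]])
  show "norm (scaleC_op a A) \<le> norm A * cmod a" for A
    using norm_scaleC_op_le[of a A] by (simp add: mult.commute)
qed

lemma complex_linearD: "complex_linear A \<Longrightarrow> blinfun_apply A (a *\<^sub>C x) = a *\<^sub>C blinfun_apply A x"
  by (simp add: complex_linear_def)

lemma complex_linear_compose: "complex_linear A \<Longrightarrow> complex_linear B \<Longrightarrow> complex_linear (A o\<^sub>L B)"
  by (simp add: complex_linear_def)

lemma complex_linear_id: "complex_linear id_blinfun"
  by (simp add: complex_linear_def)

lemma op_power_0 [simp]: "op_power A 0 = id_blinfun"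
  by (simp add: op_power_def)

lemma op_power_Suc [simp]: "op_power A (Suc m) = A o\<^sub>L op_power A m"
  by (simp add: op_power_def)

lemma blinfun_compose_id [simp]: "A o\<^sub>L id_blinfun = A" "id_blinfun o\<^sub>L A = A"
  by (auto intro: blinfun_eqI)

lemma blinfun_compose_assoc: "(A o\<^sub>L B) o\<^sub>L C = A o\<^sub>L (B o\<^sub>L C)"
  by (auto intro: blinfun_eqI)

lemma op_power_commute:
  assumes "A o\<^sub>L B = B o\<^sub>L A"
  shows "A o\<^sub>L op_power B m = op_power B m o\<^sub>L A"
  by (induction m) (simp_all add: assms, metis assms blinfun_compose_assoc)

lemma op_power_add: "op_power A (j + k) = op_power A j o\<^sub>L op_power A k"
  by (induction j) (simp_all add: blinfun_compose_assoc)

lemma complex_linear_op_power: "complex_linear A \<Longrightarrow> complex_linear (op_power A m)"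
  by (induction m) (simp_all add: complex_linear_id complex_linear_compose)

lemma norm_op_power_le: "norm A \<le> r \<Longrightarrow> norm (op_power A m) \<le> r ^ m"
proof (induction m)
  case 0
  then show ?case by (simp add: norm_blinfun_id_le)
next
  case (Suc m)
  have "norm (A o\<^sub>L op_power A m) \<le> norm A * norm (op_power A m)"
    by (rule norm_blinfun_compose)
  also have "\<dots> \<le> r * r ^ m"
    using Suc order_trans[OF norm_ge_zero Suc.prems] by (intro mult_mono) auto
  finally show ?case by simp
qed

locale commuting_tuple =
  fixes T :: "'d::{finite,linorder} \<Rightarrow> 'h::complex_hilbert \<Rightarrow>\<^sub>L 'h"
  assumes linear: "complex_linear (T i)" and norm_less_1: "norm (T i) < 1"
    and commute: "T i o\<^sub>L T j = T j o\<^sub>L T i"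
begin

abbreviation fold_monomial :: "nat ^ 'd::{finite,linorder} \<Rightarrow> 'd list \<Rightarrow> 'h \<Rightarrow>\<^sub>L 'h"
  where "fold_monomial k xs \<equiv> foldr (\<lambda>i A. op_power (T i) (k $ i) o\<^sub>L A) xs id_blinfun"

lemma op_power_fold_monomial_commute:
  "op_power (T i) m o\<^sub>L fold_monomial k xs = fold_monomial k xs o\<^sub>L op_power (T i) m"
proof (induction xs)
  case (Cons j xs)
  have "op_power (T i) m o\<^sub>L op_power (T j) l = op_power (T j) l o\<^sub>L op_power (T i) m" for l
    by (intro op_power_commute op_power_commute[symmetric] commute)
  then have "op_power (T i) m o\<^sub>L (op_power (T j) (k $ j) o\<^sub>L fold_monomial k xs) =
      op_power (T j) (k $ j) o\<^sub>L (op_power (T i) m o\<^sub>L fold_monomial k xs)"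
    by (simp only: blinfun_compose_assoc [symmetric])
  then show ?case
    unfolding Cons by (simp only: foldr.simps o_apply blinfun_compose_assoc)
qed simp

lemma fold_monomial_add: "fold_monomial (j + k) xs = fold_monomial j xs o\<^sub>L fold_monomial k xs"
proof (induction xs)
  case (Cons i xs)
  have "fold_monomial (j + k) (i # xs) =
      op_power (T i) (j $ i) o\<^sub>L (op_power (T i) (k $ i) o\<^sub>L fold_monomial j xs) o\<^sub>L fold_monomial k xs"
    using Cons by (simp only: foldr.simps o_apply vector_add_component op_power_add blinfun_compose_assoc)
  also have "\<dots> = fold_monomial j (i # xs) o\<^sub>L fold_monomial k (i # xs)"
    unfolding op_power_fold_monomial_commute by (simp add: blinfun_compose_assoc)
  finally show ?case .
qed simp

lemma op_monomial_add: "op_monomial T (j + k) = op_monomial T j o\<^sub>L op_monomial T k"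
  unfolding op_monomial_def by (rule fold_monomial_add)

lemma op_monomial_0 [simp]: "op_monomial T 0 = id_blinfun"
proof -
  have "fold_monomial 0 xs = id_blinfun" for xs
    by (induction xs) auto
  then show ?thesis
    by (simp add: op_monomial_def)
qed

lemma op_monomial_commute: "op_monomial T j o\<^sub>L op_monomial T k = op_monomial T k o\<^sub>L op_monomial T j"
  by (metis add.commute op_monomial_add)

lemma complex_linear_op_monomial: "complex_linear (op_monomial T k)"
proof -
  have "complex_linear (fold_monomial k xs)" for xs
    by (induction xs) (auto intro: complex_linear_id complex_linear_compose complex_linear_op_power linear)
  then show ?thesis
    by (simp add: op_monomial_def)
qed

lemma op_monomial_axis: "op_monomial T (axis i 1) = T i"
proof -
  have "fold_monomial (axis i 1) xs = (if i \<in> set xs then T i else id_blinfun)" if "distinct xs" for xs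
    using that by (induction xs) (auto simp: axis_def)
  then show ?thesis
    by (simp add: op_monomial_def)
qed

lemma norm_op_monomial_le:
  assumes r: "\<And>i. norm (T i) \<le> r"
  shows "norm (op_monomial T k) \<le> r ^ msize k"
proof -
  have r0: "0 \<le> r"
    using r[of undefined] norm_ge_zero order_trans by blast
  have "norm (fold_monomial k xs) \<le> r ^ (\<Sum>i\<leftarrow>xs. k $ i)" for xs
  proof (induction xs)
    case Nil
    then show ?case by (simp add: norm_blinfun_id_le)
  next
    case (Cons i xs)
    have "norm (fold_monomial k (i # xs)) \<le> norm (op_power (T i) (k $ i)) * norm (fold_monomial k xs)"
      by (simp add: norm_blinfun_compose)
    also have "\<dots> \<le> r ^ k $ i * r ^ (\<Sum>i\<leftarrow>xs. k $ i)"
      by (intro mult_mono norm_op_power_le r Cons) (simp_all add: r0)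
    finally show ?case by (simp add: power_add)
  qed
  from this[of "sorted_list_of_set UNIV"] show ?thesis
    by (simp add: op_monomial_def msize_def sum_list_distinct_conv_sum_set)
qed

definition poly_op :: "'d mpolynomial \<Rightarrow> 'h \<Rightarrow>\<^sub>L 'h"
  where "poly_op q = coeff_sum (\<lambda>k a. scaleC_op a (op_monomial T k)) q"

lemma poly_op_add: "poly_op (p + q) = poly_op p + poly_op q"
  unfolding poly_op_def by (rule coeff_sum_add) (rule scaleC_op_add_left)

lemma scaleC_op_zero [simp]: "scaleC_op 0 A = 0"
  by (rule blinfun_eqI) simp

lemma poly_op_single: "poly_op (Poly_Mapping.single k a) = scaleC_op a (op_monomial T k)"
  unfolding poly_op_def by (rule coeff_sum_single) simp

lemma poly_op_mult: "poly_op (p * q) = poly_op p o\<^sub>L poly_op q"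
  unfolding poly_op_def
proof (rule coeff_sum_mult)
  show "scaleC_op (a * b) (op_monomial T (j + k)) =
      scaleC_op a (op_monomial T j) o\<^sub>L scaleC_op b (op_monomial T k)" for j k a b
    by (rule blinfun_eqI)
      (simp add: op_monomial_add scaleC_scaleC complex_linearD[OF complex_linear_op_monomial])
qed (simp_all add: scaleC_op_add_left blinfun.add_left blinfun.add_right blinfun_eqI)

lemma poly_op_0 [simp]: "poly_op 0 = 0"
  by (simp add: poly_op_def coeff_sum_def)

lemma poly_op_const: "poly_op (const_poly a) x = a *\<^sub>C x"
  by (simp add: const_poly_def poly_op_single)

lemma poly_op_1 [simp]: "poly_op 1 = id_blinfun"
proof -
  have "poly_op (Poly_Mapping.single 0 1) = id_blinfun"
    by (rule blinfun_eqI) (simp add: poly_op_single del: single_one)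
  then show ?thesis by (simp only: single_one)
qed

lemma poly_op_var: "poly_op (var_poly i) = T i"
  by (rule blinfun_eqI) (simp only: var_poly_def poly_op_single op_monomial_axis scaleC_op_apply scaleC_one)

lemma poly_op_minus: "poly_op (p - q) = poly_op p - poly_op q"
  using poly_op_add[of "p - q" q] by simp

lemma poly_op_sum: "poly_op (\<Sum>i\<in>I. f i) = (\<Sum>i\<in>I. poly_op (f i))"
  by (induction I rule: infinite_finite_induct) (simp_all add: poly_op_add)

text \<open>\<open>op_eval\<close> is an infinite sum with default value 0, so summability has to be
  shown. The maximum r of the finitely many norms is below 1, and r^|k| beats the polynomial growth
  of the coefficients.\<close>

lemma op_eval_has_sum:
  assumes c: "\<And>k. cmod (c k) \<le> real (msize k + 1) ^ N"
  shows "((\<lambda>k. scaleC_op (c k) (op_monomial T k)) has_sum op_eval c T) UNIV"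
proof -
  define r where "r = Max (range (\<lambda>i. norm (T i)))"
  have r: "norm (T i) \<le> r" for i
    by (simp add: r_def)
  have r1: "r < 1"
    unfolding r_def by (subst Max_less_iff) (auto simp: norm_less_1)
  have r0: "0 \<le> r"
    using r[of undefined] norm_ge_zero order_trans by blast
  have "(\<lambda>k. norm (scaleC_op (c k) (op_monomial T k))) summable_on UNIV"
  proof (rule summable_on_comparison_test)
    show "(\<lambda>k :: nat ^ 'd::{finite,linorder}. real (msize k + 1) ^ N * r ^ msize k) summable_on UNIV"
      by (rule summable_polynomial_power_msize[OF r0 r1])
    fix k :: "nat ^ 'd::{finite,linorder}"
    show "norm (scaleC_op (c k) (op_monomial T k)) \<le> real (msize k + 1) ^ N * r ^ msize k"
      by (rule order_trans[OF norm_scaleC_op_le])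
        (intro mult_mono c norm_op_monomial_le r, auto)
  qed simp
  then show ?thesis
    unfolding op_eval_def by (rule has_sum_infsum[OF abs_summable_summable])
qed

lemma op_eval_conv_coeff:
  assumes "((\<lambda>k. scaleC_op (c k) (op_monomial T k)) has_sum S) UNIV"
  shows "((\<lambda>k. scaleC_op (conv_coeff q c k) (op_monomial T k)) has_sum (poly_op q o\<^sub>L S)) UNIV"
proof -
  have "((\<lambda>k. scaleC_op (conv_coeff q c k) (op_monomial T k)) has_sum
      (\<Sum>j\<in>Poly_Mapping.keys q. scaleC_op (Poly_Mapping.lookup q j) (op_monomial T j o\<^sub>L S))) UNIV"
  proof (rule conv_coeff_has_sum[where sc = scaleC_op])
    show "op_monomial T j o\<^sub>L scaleC_op a (op_monomial T k) = scaleC_op a (op_monomial T j o\<^sub>L op_monomial T k)"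
      for j k a
      by (rule blinfun_eqI) (simp add: complex_linearD[OF complex_linear_op_monomial])
  qed (rule scaleC_op_add_left scaleC_op_scaleC_op bounded_linear_scaleC_op
      bounded_bilinear.bounded_linear_right[OF bounded_bilinear_blinfun_compose]
      op_monomial_add[symmetric] assms)+
  also have "(\<Sum>j\<in>Poly_Mapping.keys q. scaleC_op (Poly_Mapping.lookup q j) (op_monomial T j o\<^sub>L S)) = poly_op q o\<^sub>L S"
    by (rule blinfun_eqI) (simp add: poly_op_def coeff_sum_def blinfun.sum_left)
  finally show ?thesis .
qed

end

section \<open>Isometries and tensor slots\<close>

context commuting_tuple
begin

text \<open>\<open>V\<close> is (1/p)(T). The Cauchy product of \<open>p\<close> with its reciprocal
  has the single coefficient 1, and \<open>V\<close> commutes with polynomials in \<open>T\<close>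
  because its terms do.\<close>

lemma poly_op_inverse:
  assumes p0: "Poly_Mapping.lookup p 0 = 1"
    and bound: "\<And>k. cmod (inverse_coeff p k) \<le> real (msize k + 1) ^ N"
  defines "V \<equiv> op_eval (inverse_coeff p) T"
  shows "poly_op p o\<^sub>L V = id_blinfun" "V o\<^sub>L poly_op q = poly_op q o\<^sub>L V"
proof -
  let ?c = "inverse_coeff p"
  have V: "((\<lambda>k. scaleC_op (?c k) (op_monomial T k)) has_sum V) UNIV"
    unfolding V_def by (rule op_eval_has_sum[OF bound])
  have "((\<lambda>k. scaleC_op (conv_coeff p ?c k) (op_monomial T k)) has_sum id_blinfun) UNIV"
  proof (rule has_sum_finite_neutralI[of "{0}"])
    show "id_blinfun = (\<Sum>k\<in>{0}. scaleC_op (conv_coeff p ?c k) (op_monomial T k))"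
      by (rule blinfun_eqI) (simp add: conv_coeff_inverse_coeff[OF p0])
  qed (auto simp: conv_coeff_inverse_coeff[OF p0])
  with op_eval_conv_coeff[OF V, of p] show "poly_op p o\<^sub>L V = id_blinfun"
    by (rule has_sum_unique)
  \<comment> \<open>The coefficients of \<open>q\<close> are complex, so commutation with
    \<open>poly_op q\<close> needs complex linearity, which the type of \<open>V\<close> does not
    provide.\<close>
  have lin: "complex_linear V"
    unfolding complex_linear_def
  proof (intro allI)
    fix a x
    have "((\<lambda>k. scaleC_op (?c k) (op_monomial T k) (a *\<^sub>C x)) has_sum V (a *\<^sub>C x)) UNIV"
      by (rule has_sum_bounded_linear[OF bounded_bilinear.bounded_linear_left[OF bounded_bilinear_blinfun_apply] V])
    moreover have "((\<lambda>k. a *\<^sub>C scaleC_op (?c k) (op_monomial T k) x) has_sum a *\<^sub>C V x) UNIV"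
      by (rule has_sum_bounded_linear[OF bounded_linear_scaleC
          has_sum_bounded_linear[OF bounded_bilinear.bounded_linear_left[OF bounded_bilinear_blinfun_apply] V]])
    moreover have "scaleC_op (?c k) (op_monomial T k) (a *\<^sub>C x) = a *\<^sub>C scaleC_op (?c k) (op_monomial T k) x" for k
      by (simp add: complex_linearD[OF complex_linear_op_monomial] scaleC_scaleC mult.commute)
    ultimately show "V (a *\<^sub>C x) = a *\<^sub>C V x"
      using has_sum_unique by (metis (no_types, lifting) has_sum_cong)
  qed
  have mon: "V o\<^sub>L op_monomial T j = op_monomial T j o\<^sub>L V" for j
  proof -
    have "((\<lambda>k. scaleC_op (?c k) (op_monomial T k) o\<^sub>L op_monomial T j) has_sum V o\<^sub>L op_monomial T j) UNIV"
      by (rule has_sum_bounded_linear[OF bounded_bilinear.bounded_linear_left[OF bounded_bilinear_blinfun_compose] V])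
    moreover have "((\<lambda>k. op_monomial T j o\<^sub>L scaleC_op (?c k) (op_monomial T k)) has_sum op_monomial T j o\<^sub>L V) UNIV"
      by (rule has_sum_bounded_linear[OF bounded_bilinear.bounded_linear_right[OF bounded_bilinear_blinfun_compose] V])
    moreover have "scaleC_op (?c k) (op_monomial T k) o\<^sub>L op_monomial T j =
        op_monomial T j o\<^sub>L scaleC_op (?c k) (op_monomial T k)" for k
    proof (rule blinfun_eqI)
      fix x
      show "(scaleC_op (?c k) (op_monomial T k) o\<^sub>L op_monomial T j) x =
          (op_monomial T j o\<^sub>L scaleC_op (?c k) (op_monomial T k)) x"
        using arg_cong[OF op_monomial_commute[of j k], of "\<lambda>A. blinfun_apply A x"]
        by (simp add: complex_linearD[OF complex_linear_op_monomial])
    qed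
    ultimately show ?thesis
      using has_sum_unique by (metis (no_types, lifting) has_sum_cong)
  qed
  show "V o\<^sub>L poly_op q = poly_op q o\<^sub>L V"
  proof (rule blinfun_eqI)
    fix x
    have "V (op_monomial T j x) = op_monomial T j (V x)" for j
      using arg_cong[OF mon[of j], of "\<lambda>A. blinfun_apply A x"] by simp
    then show "(V o\<^sub>L poly_op q) x = (poly_op q o\<^sub>L V) x"
      by (simp add: poly_op_def coeff_sum_def blinfun.sum_left blinfun.sum_right complex_linearD[OF lin])
  qed
qed

end

text \<open>The operator A \<otimes> 1 on a finite direct sum of copies of the Hilbert space; a
  column is a function of which only the values below \<open>dim_col A\<close> matter.\<close>

definition mat_act :: "complex mat \<Rightarrow> (nat \<Rightarrow> 'h::complex_hilbert) \<Rightarrow> nat \<Rightarrow> 'h"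
  where "mat_act A u i = (\<Sum>j<dim_col A. A $$ (i, j) *\<^sub>C u j)"

lemma mat_act_mult:
  assumes "A \<in> carrier_mat n n" "B \<in> carrier_mat n n" "i < n"
  shows "mat_act (A * B) u i = mat_act A (mat_act B u) i"
proof -
  have "mat_act (A * B) u i = (\<Sum>j<n. \<Sum>k<n. (A $$ (i, k) * B $$ (k, j)) *\<^sub>C u j)"
    using assms by (auto simp: mat_act_def scalar_prod_def scaleC_sum_left atLeast0LessThan intro!: sum.cong)
  also have "\<dots> = (\<Sum>k<n. \<Sum>j<n. (A $$ (i, k) * B $$ (k, j)) *\<^sub>C u j)"
    by (rule sum.swap)
  also have "\<dots> = mat_act A (mat_act B u) i"
    using assms by (auto simp: mat_act_def scaleC_sum_right scaleC_scaleC intro!: sum.cong)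
  finally show ?thesis .
qed

lemma mat_act_minus:
  assumes "A \<in> carrier_mat n n" "B \<in> carrier_mat n n" "i < n"
  shows "mat_act (A - B) u i = mat_act A u i - mat_act B u i"
proof -
  have "mat_act (A - B) u i = (\<Sum>j<n. A $$ (i, j) *\<^sub>C u j - B $$ (i, j) *\<^sub>C u j)"
    using assms by (auto simp: mat_act_def scaleC_diff_left intro!: sum.cong)
  then show ?thesis
    using assms by (simp add: mat_act_def sum_subtractf)
qed

lemma mat_act_one: "i < n \<Longrightarrow> mat_act (1\<^sub>m n) u i = u i"
proof -
  assume i: "i < n"
  have "mat_act (1\<^sub>m n) u i = (\<Sum>j<n. if i = j then u j else 0)"
    unfolding mat_act_def using i by (intro sum.cong) auto
  then show ?thesis
    using i by simp
qed

lemma inner_mat_act: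
  assumes "A \<in> carrier_mat n n"
  shows "(\<Sum>i<n. inner (mat_act A u i) (v i)) = (\<Sum>i<n. inner (u i) (mat_act (mat_adjoint A) v i))"
proof -
  have "(\<Sum>i<n. inner (mat_act A u i) (v i)) = (\<Sum>i<n. \<Sum>j<n. inner (u j) (cnj (A $$ (i, j)) *\<^sub>C v i))"
    using assms by (simp add: mat_act_def inner_sum_left inner_scaleC_left)
  also have "\<dots> = (\<Sum>j<n. \<Sum>i<n. inner (u j) (cnj (A $$ (i, j)) *\<^sub>C v i))"
    by (rule sum.swap)
  also have "\<dots> = (\<Sum>j<n. inner (u j) (mat_act (mat_adjoint A) v j))"
    using assms by (auto simp: mat_act_def inner_sum_right intro!: sum.cong)
  finally show ?thesis .
qed

text \<open>With K' the adjoint, the Julia operator ((K, E), (D, -K')) is isometric. Expanding the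
  squares, the terms in x add up because D^2 + K' K = 1, those in u because E^2 + K K' = 1, and the
  cross terms cancel because E K = K D.\<close>

lemma julia_isometry:
  fixes u x :: "nat \<Rightarrow> 'h::complex_hilbert"
  assumes K: "K \<in> carrier_mat n n" and D: "D \<in> carrier_mat n n" and E: "E \<in> carrier_mat n n"
    and adj: "mat_adjoint D = D" "mat_adjoint E = E"
    and DD: "D * D = 1\<^sub>m n - mat_adjoint K * K" and EE: "E * E = 1\<^sub>m n - K * mat_adjoint K"
    and KD: "K * D = E * K"
  shows "(\<Sum>i<n. norm (mat_act K x i + mat_act E u i) ^ 2) +
      (\<Sum>i<n. norm (mat_act D x i - mat_act (mat_adjoint K) u i) ^ 2) =
    (\<Sum>i<n. norm (x i) ^ 2) + (\<Sum>i<n. norm (u i) ^ 2)"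
proof -
  let ?ip = "\<lambda>f g. \<Sum>i<n. inner (f i) (g i :: 'h)"
  let ?K' = "mat_adjoint K"
  have Ka: "?K' \<in> carrier_mat n n"
    using K by simp
  have sq_add: "(\<Sum>i<n. norm (f i + g i) ^ 2) = ?ip f f + 2 * ?ip f g + ?ip g g"
    and sq_diff: "(\<Sum>i<n. norm (f i - g i) ^ 2) = ?ip f f - 2 * ?ip f g + ?ip g g" for f g :: "nat \<Rightarrow> 'h"
  proof -
    have "?ip g f = ?ip f g"
      by (intro sum.cong refl inner_commute)
    then show "(\<Sum>i<n. norm (f i + g i) ^ 2) = ?ip f f + 2 * ?ip f g + ?ip g g"
      "(\<Sum>i<n. norm (f i - g i) ^ 2) = ?ip f f - 2 * ?ip f g + ?ip g g"
      by (simp_all add: power2_norm_eq_inner inner_add_left inner_add_right inner_diff_left inner_diff_right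
          sum.distrib sum_subtractf)
  qed
  have quad: "?ip (mat_act A f) (mat_act A f) = ?ip f (mat_act (mat_adjoint A * A) f)"
    if A: "A \<in> carrier_mat n n" for A and f :: "nat \<Rightarrow> 'h"
    unfolding inner_mat_act[OF A] using A by (intro sum.cong refl) (simp add: mat_act_mult[of _ n])
  have compl: "?ip f (mat_act (1\<^sub>m n - A) f) = ?ip f f - ?ip f (mat_act A f)"
    if A: "A \<in> carrier_mat n n" for A and f :: "nat \<Rightarrow> 'h"
    using A by (simp add: mat_act_minus[of _ n] mat_act_one inner_diff_right sum_subtractf)
  have 1: "?ip (mat_act D x) (mat_act D x) = ?ip x x - ?ip (mat_act K x) (mat_act K x)"
    unfolding quad[OF D] adj DD quad[OF K] by (rule compl) (use K Ka in simp)
  have 2: "?ip (mat_act E u) (mat_act E u) = ?ip u u - ?ip (mat_act ?K' u) (mat_act ?K' u)"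
    unfolding quad[OF E] adj EE quad[OF Ka] mat_adjoint_adjoint by (rule compl) (use K Ka in simp)
  have "?ip (mat_act K x) (mat_act E u) = ?ip (mat_act E (mat_act K x)) u"
    unfolding inner_mat_act[OF E] adj ..
  also have "\<dots> = ?ip (mat_act K (mat_act D x)) u"
    by (intro sum.cong refl) (use K D E KD in \<open>simp flip: mat_act_mult[of _ n]\<close>)
  also have "\<dots> = ?ip (mat_act D x) (mat_act ?K' u)"
    by (rule inner_mat_act[OF K])
  finally show ?thesis
    unfolding sq_add sq_diff 1 2 by (simp add: power2_norm_eq_inner)
qed

section \<open>The tensor power and operators in one of its slots\<close>

lemma sum_PiE_fun_upd:
  fixes f :: "(nat \<Rightarrow> nat) \<Rightarrow> real"
  assumes "m < n"
  shows "(\<Sum>s\<in>Pi\<^sub>E {..<n} (\<lambda>_. {..<n}). f s) =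
    (\<Sum>r\<in>Pi\<^sub>E ({..<n} - {m}) (\<lambda>_. {..<n}). \<Sum>i<n. f (r(m := i)))"
proof -
  have I: "{..<n} = insert m ({..<n} - {m})"
    using assms by auto
  have "(\<Sum>s\<in>Pi\<^sub>E (insert m ({..<n} - {m})) (\<lambda>_. {..<n}). f s) =
      (\<Sum>(i, r)\<in>{..<n} \<times> Pi\<^sub>E ({..<n} - {m}) (\<lambda>_. {..<n}). f (r(m := i)))"
    unfolding PiE_insert_eq
    by (subst sum.reindex[OF inj_combinator]) (auto simp: case_prod_unfold intro!: sum.cong)
  also have "\<dots> = (\<Sum>i<n. \<Sum>r\<in>Pi\<^sub>E ({..<n} - {m}) (\<lambda>_. {..<n}). f (r(m := i)))"
    by (rule sum.cartesian_product [symmetric])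
  also have "\<dots> = (\<Sum>r\<in>Pi\<^sub>E ({..<n} - {m}) (\<lambda>_. {..<n}). \<Sum>i<n. f (r(m := i)))"
    by (rule sum.swap)
  finally show ?thesis
    using I by simp
qed

text \<open>The families \<open>x\<close> model the tensor product of the space \<open>'h\<close>
  with the n-th tensor power of C^n, \<open>s\<close> being the index of a component. Fixing all
  indices except the one in slot \<open>m\<close> splits the claim into copies of the
  hypothesis.\<close>

lemma slot_contraction:
  fixes x :: "(nat \<Rightarrow> nat) \<Rightarrow> 'h::real_normed_vector"
  assumes G: "\<And>u. (\<Sum>i<n. norm (\<Sum>j<n. G i j (u j)) ^ 2) \<le> (\<Sum>i<n. norm (u i) ^ 2)" and m: "m < n"
  shows "(\<Sum>s\<in>Pi\<^sub>E {..<n} (\<lambda>_. {..<n}). norm (\<Sum>k<n. G (s m) k (x (s(m := k)))) ^ 2) \<le>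
    (\<Sum>s\<in>Pi\<^sub>E {..<n} (\<lambda>_. {..<n}). norm (x s) ^ 2)"
  unfolding sum_PiE_fun_upd[OF m] by (rule sum_mono) (use G in simp)

text \<open>Component \<open>s\<close> of the tensor obtained from the antisymmetric one by applying
  \<open>g\<close> in the slots below \<open>m\<close>: at m = 0 it is the sign of \<open>s\<close>
  (0 if \<open>s\<close> repeats an index), at m = n it is that sign times the determinant.\<close>

definition mixed_det :: "nat \<Rightarrow> 'a::comm_ring_1 mat \<Rightarrow> nat \<Rightarrow> (nat \<Rightarrow> nat) \<Rightarrow> 'a"
  where "mixed_det n g m s = Determinant.det
    (Matrix.mat n n (\<lambda>(i, j). if i < m then g $$ (s i, j) else if s i = j then 1 else 0))"

text \<open>Laplace expansion along row \<open>m\<close>. Deleting that row removes the only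
  difference between the two matrices, and a matrix whose row \<open>m\<close> is the k-th unit row
  has the cofactor at k as its determinant.\<close>

lemma mixed_det_Suc:
  assumes m: "m < n"
  shows "mixed_det n g (Suc m) s = (\<Sum>k<n. g $$ (s m, k) * mixed_det n g m (s(m := k)))"
proof -
  let ?B = "\<lambda>m s. Matrix.mat n n (\<lambda>(i, j). if i < m then g $$ (s i, j) else if s i = j then 1 else 0)"
  have B: "?B l t \<in> carrier_mat n n" for l t
    by simp
  have cof: "mixed_det n g m (s(m := k)) = cofactor (?B (Suc m) s) m k" if k: "k < n" for k
  proof -
    have del: "mat_delete (?B m (s(m := k))) m k = mat_delete (?B (Suc m) s) m k"
      by (rule eq_matI) (auto simp: mat_delete_def)
    have "mixed_det n g m (s(m := k)) =
        (\<Sum>j<n. ?B m (s(m := k)) $$ (m, j) * cofactor (?B m (s(m := k))) m j)"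
      unfolding mixed_det_def by (rule laplace_expansion_row[OF B m])
    also have "\<dots> = (\<Sum>j<n. if k = j then cofactor (?B m (s(m := k))) m j else 0)"
      by (rule sum.cong) (use m in auto)
    also have "\<dots> = cofactor (?B (Suc m) s) m k"
      using k del by (simp add: cofactor_def)
    finally show ?thesis .
  qed
  have "mixed_det n g (Suc m) s = (\<Sum>j<n. ?B (Suc m) s $$ (m, j) * cofactor (?B (Suc m) s) m j)"
    unfolding mixed_det_def by (rule laplace_expansion_row[OF B m])
  also have "\<dots> = (\<Sum>k<n. g $$ (s m, k) * mixed_det n g m (s(m := k)))"
    by (rule sum.cong) (use m cof in auto)
  finally show ?thesis .
qed

lemma det_select_rows:
  fixes A :: "'a::comm_ring_1 mat"
  assumes A: "A \<in> carrier_mat n n" and s: "s \<in> {..<n} \<rightarrow> {..<n}"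
  shows "Determinant.det (Matrix.mat n n (\<lambda>(i, j). A $$ (s i, j))) \<in>
    (if inj_on s {..<n} then {Determinant.det A, - Determinant.det A} else {0})"
proof (cases "inj_on s {..<n}")
  case True
  \<comment> \<open>\<open>permutes\<close> requires the identity outside the index range; the
    matrix does not see these values.\<close>
  define s' where "s' i = (if i < n then s i else i)" for i
  have "bij_betw s {..<n} {..<n}"
    using True s by (simp add: bij_betw_def endo_inj_surj image_subset_iff_funcset)
  then have "bij_betw s' {..<n} {..<n}"
    by (rule bij_betw_cong[THEN iffD1, rotated]) (simp add: s'_def)
  then have "s' permutes {0..<n}"
    by (intro bij_imp_permutes) (auto simp: s'_def atLeast0LessThan)
  moreover have "Matrix.mat n n (\<lambda>(i, j). A $$ (s i, j)) = Matrix.mat n n (\<lambda>(i, j). A $$ (s' i, j))"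
    by (rule eq_matI) (auto simp: s'_def)
  ultimately have "Determinant.det (Matrix.mat n n (\<lambda>(i, j). A $$ (s i, j))) = signof s' * Determinant.det A"
    using det_permute_rows[OF A] by simp
  then show ?thesis
    using True by (auto simp: sign_def)
next
  case False
  then obtain i j where ij: "i < n" "j < n" "i \<noteq> j" "s i = s j"
    by (auto simp: inj_on_def)
  have "Determinant.det (Matrix.mat n n (\<lambda>(i, j). A $$ (s i, j))) = 0"
    by (rule det_identical_rows[of _ n i j]) (use ij in \<open>auto intro!: eq_vecI\<close>)
  then show ?thesis
    using False by simp
qed

section \<open>Contractivity of the transfer function and of its determinant\<close>

context commuting_tuple
begin

definition poly_act :: "'d mpolynomial mat \<Rightarrow> (nat \<Rightarrow> 'h) \<Rightarrow> nat \<Rightarrow> 'h"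
  where "poly_act M u i = (\<Sum>j<dim_col M. poly_op (M $$ (i, j)) (u j))"

lemma poly_act_mult:
  assumes "A \<in> carrier_mat n n" "B \<in> carrier_mat n n" "i < n"
  shows "poly_act (A * B) u i = poly_act A (poly_act B u) i"
proof -
  have "poly_act (A * B) u i = (\<Sum>j<n. \<Sum>k<n. poly_op (A $$ (i, k)) (poly_op (B $$ (k, j)) (u j)))"
    using assms by (auto simp: poly_act_def scalar_prod_def poly_op_sum poly_op_mult blinfun.sum_left
        atLeast0LessThan intro!: sum.cong)
  also have "\<dots> = (\<Sum>k<n. \<Sum>j<n. poly_op (A $$ (i, k)) (poly_op (B $$ (k, j)) (u j)))"
    by (rule sum.swap)
  also have "\<dots> = poly_act A (poly_act B u) i"
    using assms by (auto simp: poly_act_def blinfun.sum_right intro!: sum.cong)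
  finally show ?thesis .
qed

lemma poly_act_minus:
  assumes "A \<in> carrier_mat n n" "B \<in> carrier_mat n n" "i < n"
  shows "poly_act (A - B) u i = poly_act A u i - poly_act B u i"
  using assms by (simp add: poly_act_def poly_op_minus blinfun.diff_left sum_subtractf)

lemma poly_act_smult:
  assumes "A \<in> carrier_mat n n" "i < n"
  shows "poly_act (s \<cdot>\<^sub>m A) u i = poly_op s (poly_act A u i)"
  using assms by (simp add: poly_act_def poly_op_mult blinfun.sum_right)

lemma poly_act_one: "i < n \<Longrightarrow> poly_act (1\<^sub>m n) u i = u i"
proof -
  assume i: "i < n"
  have "poly_act (1\<^sub>m n) u i = (\<Sum>j<n. if i = j then u j else 0)"
    unfolding poly_act_def using i by (intro sum.cong) auto
  then show ?thesis
    using i by simp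
qed

lemma poly_act_const:
  assumes "A \<in> carrier_mat n n" "i < n"
  shows "poly_act (map_mat const_poly A) u i = mat_act A u i"
  using assms by (simp add: poly_act_def mat_act_def poly_op_const)

lemma poly_act_diag: "i < n \<Longrightarrow> poly_act (mat_diag n d) u i = poly_op (d i) (u i)"
proof -
  assume i: "i < n"
  have "poly_act (mat_diag n d) u i = (\<Sum>j<n. if i = j then poly_op (d j) (u j) else 0)"
    unfolding poly_act_def using i by (intro sum.cong) (auto simp: mat_diag_def)
  then show ?thesis
    using i by simp
qed

lemma poly_act_cong: "(\<And>j. j < dim_col M \<Longrightarrow> u j = v j) \<Longrightarrow> poly_act M u i = poly_act M v i"
  unfolding poly_act_def by (rule sum.cong) auto

text \<open>
  With \<open>w = V (adj_mat A) E u\<close> and \<open>x = Z w\<close>, the system \<open>w = K x + E u\<close>, \<open>y = D x - K* u\<close> is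
  conservative, and \<open>x\<close> is shorter than \<open>w\<close>.
\<close>

lemma transfer_contraction:
  fixes u :: "nat \<Rightarrow> 'h" and b :: "nat \<Rightarrow> 'd"
  assumes K: "K \<in> carrier_mat n n" and D: "D \<in> carrier_mat n n" and E: "E \<in> carrier_mat n n"
    and adj: "mat_adjoint D = D" "mat_adjoint E = E"
    and DD: "D * D = 1\<^sub>m n - mat_adjoint K * K" and EE: "E * E = 1\<^sub>m n - K * mat_adjoint K"
    and KD: "K * D = E * K"
  defines "Zp \<equiv> mat_diag n (\<lambda>i. var_poly (b i))"
  defines "A \<equiv> 1\<^sub>m n - map_mat const_poly K * Zp"
  assumes V: "poly_op (Determinant.det A) o\<^sub>L V = id_blinfun" "\<And>q. V o\<^sub>L poly_op q = poly_op q o\<^sub>L V"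
  defines "g \<equiv> map_mat const_poly D * Zp * adj_mat A * map_mat const_poly E -
    Determinant.det A \<cdot>\<^sub>m map_mat const_poly (mat_adjoint K)"
  shows "(\<Sum>i<n. norm (\<Sum>j<n. V (poly_op (g $$ (i, j)) (u j))) ^ 2) \<le> (\<Sum>i<n. norm (u i) ^ 2)"
proof -
  let ?Kp = "map_mat const_poly K" and ?Dp = "map_mat const_poly D" and ?Ep = "map_mat const_poly E"
    and ?K'p = "map_mat const_poly (mat_adjoint K)"
  let ?p = "Determinant.det A"
  have Ka: "mat_adjoint K \<in> carrier_mat n n"
    using K by simp
  have carr: "?Kp \<in> carrier_mat n n" "?Dp \<in> carrier_mat n n" "?Ep \<in> carrier_mat n n" "?K'p \<in> carrier_mat n n"
    "Zp \<in> carrier_mat n n"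
    using K D E by (auto simp: Zp_def)
  have A: "A \<in> carrier_mat n n"
    unfolding A_def using carr by (intro minus_carrier_mat) simp
  note B = adj_mat[OF A]
  have g: "g \<in> carrier_mat n n"
    unfolding g_def using carr by (intro minus_carrier_mat) simp
  have V_comm: "V (poly_op q x) = poly_op q (V x)" for q x
    using arg_cong[OF V(2)[of q], of "\<lambda>A. blinfun_apply A x"] by simp
  have V_inv: "poly_op ?p (V x) = x" for x
    using arg_cong[OF V(1), of "\<lambda>A. blinfun_apply A x"] by simp
  have V_act: "V (poly_act M v i) = poly_act M (\<lambda>j. V (v j)) i" for M v i
    by (simp add: poly_act_def blinfun.sum_right V_comm)
  define w where "w = (\<lambda>i. V (poly_act (adj_mat A) (mat_act E u) i))"
  define x where "x = (\<lambda>i. T (b i) (w i))"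
  have x: "poly_act Zp w i = x i" if "i < n" for i
    using that by (simp add: Zp_def poly_act_diag poly_op_var x_def)
  \<comment> \<open>\<open>V\<close> cancels the determinant produced by
    \<open>A * adj_mat A\<close>, so that A w = E u, which is the equation w - K x = E u.\<close>
  have w_eq: "w i = mat_act K x i + mat_act E u i" if i: "i < n" for i
  proof -
    have "poly_act A w i = V (poly_act A (poly_act (adj_mat A) (mat_act E u)) i)"
      unfolding w_def V_act ..
    also have "\<dots> = V (poly_act (A * adj_mat A) (mat_act E u) i)"
      by (simp only: poly_act_mult[OF A B(1) i])
    also have "\<dots> = mat_act E u i"
      using i by (simp add: B(2) poly_act_smult[of _ n] poly_act_one V_comm V_inv)
    finally have "poly_act A w i = mat_act E u i" .
    moreover have "poly_act A w i = w i - poly_act ?Kp (poly_act Zp w) i"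
      unfolding A_def poly_act_minus[OF one_carrier_mat mult_carrier_square[OF carr(1,5)] i]
        poly_act_one[OF i] poly_act_mult[OF carr(1,5) i] ..
    moreover have "poly_act ?Kp (poly_act Zp w) i = mat_act K x i"
      unfolding poly_act_const[OF K i, symmetric] using K by (intro poly_act_cong x) simp
    ultimately show ?thesis
      by (simp add: algebra_simps)
  qed
  have y_eq: "(\<Sum>j<n. V (poly_op (g $$ (i, j)) (u j))) = mat_act D x i - mat_act (mat_adjoint K) u i"
    if i: "i < n" for i
  proof -
    have "(\<Sum>j<n. V (poly_op (g $$ (i, j)) (u j))) = V (poly_act g u i)"
      using g by (simp add: poly_act_def blinfun.sum_right)
    also have "poly_act g u i = poly_act (?Dp * (Zp * (adj_mat A * ?Ep))) u i - poly_op ?p (mat_act (mat_adjoint K) u i)"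
    proof -
      have "?Dp * Zp * adj_mat A * ?Ep = ?Dp * (Zp * (adj_mat A * ?Ep))"
        using carr B(1) by (simp add: assoc_mult_square[of _ n])
      then show ?thesis
        unfolding g_def using carr B(1) i Ka
        by (simp add: poly_act_minus[of _ n] poly_act_smult[of _ n] poly_act_const[of _ n])
    qed
    also have "poly_act (?Dp * (Zp * (adj_mat A * ?Ep))) u i = poly_act ?Dp (poly_act (Zp * (adj_mat A * ?Ep)) u) i"
      by (rule poly_act_mult[OF carr(2) _ i]) (use carr B(1) in simp)
    also have "\<dots> = poly_act ?Dp (poly_act Zp (poly_act (adj_mat A) (mat_act E u))) i"
    proof (rule poly_act_cong)
      fix j assume "j < dim_col ?Dp"
      then have j: "j < n" using D by simp
      have "poly_act (Zp * (adj_mat A * ?Ep)) u j = poly_act Zp (poly_act (adj_mat A * ?Ep) u) j"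
        by (rule poly_act_mult[OF carr(5) _ j]) (use carr B(1) in simp)
      also have "\<dots> = poly_act Zp (poly_act (adj_mat A) (mat_act E u)) j"
      proof (rule poly_act_cong)
        fix l assume "l < dim_col Zp"
        then have l: "l < n"
          by (simp only: carrier_matD[OF carr(5)])
        have "poly_act (adj_mat A * ?Ep) u l = poly_act (adj_mat A) (poly_act ?Ep u) l"
          by (rule poly_act_mult[OF B(1) carr(3) l])
        also have "\<dots> = poly_act (adj_mat A) (mat_act E u) l"
          by (rule poly_act_cong) (use B(1) E in \<open>simp add: poly_act_const[of _ n]\<close>)
        finally show "poly_act (adj_mat A * ?Ep) u l = poly_act (adj_mat A) (mat_act E u) l" .
      qed
      finally show "poly_act (Zp * (adj_mat A * ?Ep)) u j = poly_act Zp (poly_act (adj_mat A) (mat_act E u)) j" .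
    qed
    also have "V (\<dots> - poly_op ?p (mat_act (mat_adjoint K) u i)) =
        poly_act ?Dp (poly_act Zp w) i - mat_act (mat_adjoint K) u i"
      unfolding w_def by (simp add: blinfun.diff_right V_comm V_inv V_act)
    also have "poly_act ?Dp (poly_act Zp w) i = mat_act D x i"
      unfolding poly_act_const[OF D i, symmetric] using D by (intro poly_act_cong x) simp
    finally show ?thesis .
  qed
  have "(\<Sum>i<n. norm (x i) ^ 2) \<le> (\<Sum>i<n. norm (w i) ^ 2)"
  proof (intro sum_mono power_mono)
    fix i
    have "norm (T (b i)) * norm (w i) \<le> 1 * norm (w i)"
      using norm_less_1[of "b i"] by (intro mult_right_mono) auto
    then show "norm (x i) \<le> norm (w i)"
      using norm_blinfun[of "T (b i)" "w i"] unfolding x_def by linarith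
  qed simp
  moreover have "(\<Sum>i<n. norm (w i) ^ 2) = (\<Sum>i<n. norm (mat_act K x i + mat_act E u i) ^ 2)"
    by (simp add: w_eq)
  moreover have "(\<Sum>i<n. norm (\<Sum>j<n. V (poly_op (g $$ (i, j)) (u j))) ^ 2) =
      (\<Sum>i<n. norm (mat_act D x i - mat_act (mat_adjoint K) u i) ^ 2)"
    by (simp add: y_eq)
  ultimately show ?thesis
    using julia_isometry[OF K D E adj DD EE KD, of x u] by linarith
qed

text \<open>
  On the \<open>n\<close>-fold tensor power let the contraction act in the slots \<open>0, ..., n - 1\<close> in turn.
  Since its entries commute, this maps the antisymmetric tensor \<open>mixed_det n g 0\<close> to its multiple
  by the determinant, after \<open>m\<close> slots having reached \<open>mixed_det n g m\<close>.
\<close>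

lemma det_contraction:
  assumes V: "\<And>q. V o\<^sub>L poly_op q = poly_op q o\<^sub>L V"
    and g: "g \<in> carrier_mat n n"
    and contr: "\<And>u. (\<Sum>i<n. norm (\<Sum>j<n. V (poly_op (g $$ (i, j)) (u j))) ^ 2) \<le> (\<Sum>i<n. norm (u i) ^ 2)"
  shows "norm ((blinfun_apply V ^^ n) (poly_op (Determinant.det g) h)) \<le> norm h"
proof -
  let ?S = "Pi\<^sub>E {..<n} (\<lambda>_. {..<n})"
  let ?V = "\<lambda>m. blinfun_apply V ^^ m"
  \<comment> \<open>Each slot applies V g(T), so \<open>m\<close> slots contribute \<open>m\<close>
    factors \<open>V\<close>, pulled out in front since \<open>V\<close> commutes with the
    entries.\<close>
  define x where "x m s = ?V m (poly_op (mixed_det n g m s) h)" for m s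
  have V_comm: "V (poly_op q y) = poly_op q (V y)" for q y
    using arg_cong[OF V[of q], of "\<lambda>A. blinfun_apply A y"] by simp
  have Vm_comm: "?V m (poly_op q y) = poly_op q (?V m y)" for m q y
    by (induction m) (simp_all add: V_comm)
  have Vm_sum: "?V m (\<Sum>i\<in>I. f i) = (\<Sum>i\<in>I. ?V m (f i))" for m f and I :: "nat set"
    by (induction m) (simp_all add: blinfun.sum_right)
  have Vm_minus: "?V m (- y) = - ?V m y" for m y
    by (induction m) (simp_all add: blinfun.minus_right)
  have Vm_zero: "?V m 0 = 0" for m
    by (induction m) simp_all
  have step: "x (Suc m) s = (\<Sum>k<n. V (poly_op (g $$ (s m, k)) (x m (s(m := k)))))" if "m < n" for m s
    unfolding x_def mixed_det_Suc[OF that]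
    by (simp add: poly_op_sum poly_op_mult blinfun.sum_left blinfun.sum_right Vm_sum Vm_comm)
  have decr: "(\<Sum>s\<in>?S. norm (x m s) ^ 2) \<le> (\<Sum>s\<in>?S. norm (x 0 s) ^ 2)" if "m \<le> n" for m
    using that
  proof (induction m)
    case (Suc m)
    then have "(\<Sum>s\<in>?S. norm (x (Suc m) s) ^ 2) \<le> (\<Sum>s\<in>?S. norm (x m s) ^ 2)"
      unfolding step[OF Suc_le_lessD[OF Suc.prems]]
      by (intro slot_contraction[where G = "\<lambda>i k y. V (poly_op (g $$ (i, k)) y)"] contr) simp
    with Suc show ?case by simp
  qed simp
  have poly_op_uminus: "poly_op (- q) = - poly_op q" for q
    using poly_op_minus[of 0 q] by simp
  \<comment> \<open>At both ends a component is, up to sign, one fixed vector for injective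
    \<open>s\<close> and 0 otherwise; the two sums of squares therefore carry the same count of
    injections.\<close>
  have ends: "norm (?V m (poly_op (Determinant.det (Matrix.mat n n (\<lambda>(i, j). A $$ (s i, j)))) h)) ^ 2 =
      (if inj_on s {..<n} then norm (?V m (poly_op (Determinant.det A) h)) ^ 2 else 0)"
    if "A \<in> carrier_mat n n" "s \<in> ?S" for A s m
  proof -
    have "s \<in> {..<n} \<rightarrow> {..<n}"
      using that(2) by auto
    from det_select_rows[OF that(1) this] show ?thesis
      by (auto simp: poly_op_uminus blinfun.minus_left Vm_minus Vm_zero split: if_splits)
  qed
  have x_n: "norm (x n s) ^ 2 = (if inj_on s {..<n} then norm (?V n (poly_op (Determinant.det g) h)) ^ 2 else 0)"
    if s: "s \<in> ?S" for s
  proof -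
    have "mixed_det n g n s = Determinant.det (Matrix.mat n n (\<lambda>(i, j). g $$ (s i, j)))"
      unfolding mixed_det_def by (rule arg_cong[of _ _ Determinant.det], rule eq_matI) auto
    then show ?thesis
      using ends[OF g s, of n] by (simp add: x_def)
  qed
  have x_0: "norm (x 0 s) ^ 2 = (if inj_on s {..<n} then norm h ^ 2 else 0)" if s: "s \<in> ?S" for s
  proof -
    have "s i < n" if "i < n" for i
      using s that by auto
    then have "mixed_det n g 0 s = Determinant.det (Matrix.mat n n (\<lambda>(i, j). 1\<^sub>m n $$ (s i, j)))"
      unfolding mixed_det_def by (intro arg_cong[of _ _ Determinant.det] eq_matI) auto
    then show ?thesis
      using ends[OF one_carrier_mat s, of 0] by (simp add: x_def)
  qed
  let ?I = "{s \<in> ?S. inj_on s {..<n}}"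
  have fin: "finite ?S"
    by (intro finite_PiE) auto
  have count: "(\<Sum>s\<in>?S. if inj_on s {..<n} then c else 0) = real (card ?I) * c" for c :: real
    using fin by (simp add: sum.If_cases Int_def)
  \<comment> \<open>The identity map is injective, so the count is positive and may be
    cancelled.\<close>
  have "restrict id {..<n} \<in> ?I"
    by (auto simp: inj_on_def)
  moreover have "finite ?I"
    using fin by simp
  ultimately have "card ?I > 0"
    unfolding card_gt_0_iff by blast
  moreover have "real (card ?I) * norm (?V n (poly_op (Determinant.det g) h)) ^ 2 \<le> real (card ?I) * norm h ^ 2"
    using decr[of n] by (simp add: x_n x_0 count cong: sum.cong)
  ultimately have "norm (?V n (poly_op (Determinant.det g) h)) ^ 2 \<le> norm h ^ 2"
    by simp
  then show ?thesis
    by (rule power2_le_imp_le) simp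
qed

end

section \<open>The Schur--Agler class\<close>

text \<open>For nonzero x this is x^n times the characteristic polynomial at 1/x. Eigenvalue 0 is
  listed too, with the harmless factor 1, so the number of factors is always
  \<open>n\<close>.\<close>

lemma det_one_minus_smult:
  fixes M :: "complex mat"
  assumes M: "M \<in> carrier_mat n n" and cp: "char_poly M = (\<Prod>a\<leftarrow>as. [:- a, 1:])" and len: "length as = n"
  shows "Determinant.det (1\<^sub>m n - x \<cdot>\<^sub>m M) = (\<Prod>a\<leftarrow>as. 1 - x * a)"
proof (cases "x = 0")
  case True
  have "1\<^sub>m n - 0 \<cdot>\<^sub>m M = 1\<^sub>m n"
    using M by (intro eq_matI) auto
  then show ?thesis
    using True by (simp add: map_replicate_const)
next
  case False
  have "1\<^sub>m n - x \<cdot>\<^sub>m M = x \<cdot>\<^sub>m (- char_matrix M (1 / x))"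
    using M False by (intro eq_matI) (auto simp: char_matrix_def algebra_simps)
  then have "Determinant.det (1\<^sub>m n - x \<cdot>\<^sub>m M) = x ^ n * poly (char_poly M) (1 / x)"
    using M unfolding char_poly_matrix[OF M] by (simp add: char_matrix_def)
  also have "\<dots> = (\<Prod>a\<leftarrow>as. x * (1 / x - a))"
    unfolding cp len[symmetric] by (induction as) (simp_all add: algebra_simps)
  also have "\<dots> = (\<Prod>a\<leftarrow>as. 1 - x * a)"
    using False by (simp add: right_diff_distrib)
  finally show ?thesis .
qed

lemma cvec_norm_mat_diag_le:
  assumes v: "v \<in> carrier_vec n" and d: "\<And>i. i < n \<Longrightarrow> cmod (d i) \<le> 1"
  shows "cvec_norm (mat_diag n d *\<^sub>v v) \<le> cvec_norm v"
proof -
  have "vec_index (mat_diag n d *\<^sub>v v) i = d i * vec_index v i" if "i < n" for i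
    by (rule mat_diag_mult_vec_index[OF v that])
  then have "cvec_norm (mat_diag n d *\<^sub>v v) ^ 2 = (\<Sum>i<n. (cmod (d i) * cmod (vec_index v i)) ^ 2)"
    unfolding cvec_norm_sum by (auto simp: mat_diag_def norm_mult intro!: sum.cong)
  also have "\<dots> \<le> (\<Sum>i<n. (1 * cmod (vec_index v i)) ^ 2)"
    by (intro sum_mono power_mono mult_right_mono d) auto
  also have "\<dots> = cvec_norm v ^ 2"
    using v by (simp add: cvec_norm_sum)
  finally show ?thesis
    by (rule power2_le_imp_le) simp
qed

lemma contraction_eigenvalue_le:
  fixes M :: "complex mat"
  assumes M: "M \<in> carrier_mat n n" and contr: "\<And>v. v \<in> carrier_vec n \<Longrightarrow> cvec_norm (M *\<^sub>v v) \<le> cvec_norm v"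
    and cp: "char_poly M = (\<Prod>a\<leftarrow>as. [:- a, 1:])" and a: "a \<in> set as"
  shows "cmod a \<le> 1"
proof -
  have "poly (char_poly M) a = 0"
    unfolding cp using a by (induction as) auto
  then have "eigenvalue M a"
    using eigenvalue_root_char_poly[OF M] by simp
  then obtain v where v: "v \<in> carrier_vec n" "v \<noteq> 0\<^sub>v n" "M *\<^sub>v v = a \<cdot>\<^sub>v v"
    using M by (auto simp: eigenvalue_def eigenvector_def)
  have "cvec_norm v > 0"
    using v cvec_norm_eq_0_iff[OF v(1)] cvec_norm_nonneg[of v] by (simp add: less_le)
  then show ?thesis
    using contr[OF v(1)] by (simp add: v(3) cvec_norm_smult)
qed

lemma peval_zero: "peval p 0 = Poly_Mapping.lookup p 0"
proof -
  have "monomial 0 k = (if k = 0 then 1 else (0 :: complex))" for k :: "nat ^ 'a"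
    by (auto simp: monomial_def Finite_Cartesian_Product.vec_eq_iff power_0_left)
  then have "peval p 0 = (\<Sum>k\<in>Poly_Mapping.keys p. if k = 0 then Poly_Mapping.lookup p k else 0)"
    unfolding peval_def by (intro sum.cong) auto
  then show ?thesis
    by (simp add: in_keys_iff)
qed

text \<open>The sum S of the reciprocal series satisfies p(z) S = 1, because the Cauchy product
  collapses to its constant term; this gives the nonvanishing on the polydisk as well as the
  expansion of every q/p.\<close>

lemma inverse_coeff_has_sum:
  fixes p :: "'d::finite mpolynomial"
  assumes p0: "Poly_Mapping.lookup p 0 = 1"
    and bound: "\<And>k. cmod (inverse_coeff p k) \<le> real (msize k + 1) ^ N"
    and z: "z \<in> polydisk"
  shows "peval p z \<noteq> 0"
    "((\<lambda>k. conv_coeff q (inverse_coeff p) k * monomial z k) has_sum (peval q z / peval p z)) UNIV"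
proof -
  define r where "r = Max (range (\<lambda>i. cmod (z $ i)))"
  have r: "cmod (z $ i) \<le> r" for i
    by (simp add: r_def)
  have r1: "r < 1"
    unfolding r_def using z by (subst Max_less_iff) (auto simp: polydisk_def)
  have r0: "0 \<le> r"
    using r[of undefined] norm_ge_zero order_trans by blast
  have mon: "cmod (monomial z k) \<le> r ^ msize k" for k
    unfolding monomial_def msize_def power_sum prod_norm[symmetric] norm_power
    by (intro prod_mono conjI power_mono r) auto
  have "(\<lambda>k. norm (inverse_coeff p k * monomial z k)) summable_on UNIV"
  proof (rule summable_on_comparison_test)
    show "(\<lambda>k :: nat ^ 'd. real (msize k + 1) ^ N * r ^ msize k) summable_on UNIV"
      by (rule summable_polynomial_power_msize[OF r0 r1])
    fix k :: "nat ^ 'd"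
    show "norm (inverse_coeff p k * monomial z k) \<le> real (msize k + 1) ^ N * r ^ msize k"
      unfolding norm_mult by (intro mult_mono bound mon) auto
  qed simp
  then have "(\<lambda>k. inverse_coeff p k * monomial z k) summable_on UNIV"
    by (rule abs_summable_summable)
  then obtain S where S: "((\<lambda>k. inverse_coeff p k * monomial z k) has_sum S) UNIV"
    by (auto simp: summable_on_def)
  have conv: "((\<lambda>k. conv_coeff q (inverse_coeff p) k * monomial z k) has_sum peval q z * S) UNIV" for q
  proof -
    have "((\<lambda>k. conv_coeff q (inverse_coeff p) k * monomial z k) has_sum
        (\<Sum>j\<in>Poly_Mapping.keys q. Poly_Mapping.lookup q j * (monomial z j * S))) UNIV"
      by (rule conv_coeff_has_sum)
        (auto simp: distrib_right monomial_add S bounded_linear_mult_right)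
    then show ?thesis
      by (simp add: peval_def sum_distrib_right mult.assoc)
  qed
  have "((\<lambda>k. conv_coeff p (inverse_coeff p) k * monomial z k) has_sum 1) UNIV"
    by (rule has_sum_finite_neutralI[of "{0}"]) (auto simp: conv_coeff_inverse_coeff[OF p0])
  with conv[of p] have pS: "peval p z * S = 1"
    by (rule has_sum_unique)
  then show "peval p z \<noteq> 0"
    by auto
  with pS have "S = 1 / peval p z"
    by (simp add: field_simps)
  then show "((\<lambda>k. conv_coeff q (inverse_coeff p) k * monomial z k) has_sum (peval q z / peval p z)) UNIV"
    using conv[of q] by simp
qed

text \<open>
  The tensor argument needs \<open>det G\<close> with the denominator \<open>p\<close> cleared; the scalar identity for
  \<open>det G\<close> supplies it as the polynomial identity \<open>p * det g = p^n * q\<close>.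
\<close>

lemma (in commuting_tuple) norm_op_eval_quotient_le:
  fixes p q :: "'d mpolynomial" and b :: "nat \<Rightarrow> 'd"
  assumes K: "K \<in> carrier_mat n n"
    and contr: "\<forall>v\<in>carrier_vec n. cvec_norm (K *\<^sub>v v) \<le> cvec_norm v"
    and p: "p = Determinant.det (1\<^sub>m n - map_mat const_poly K * mat_diag n (\<lambda>i. var_poly (b i)))"
    and q: "\<And>z. peval q z = Determinant.det (mat_diag n (\<lambda>i. z $ b i) - mat_adjoint K)"
    and p0: "Poly_Mapping.lookup p 0 = 1"
    and bound: "\<And>k. cmod (inverse_coeff p k) \<le> real (msize k + 1) ^ N"
  shows "norm (op_eval (conv_coeff q (inverse_coeff p)) T) \<le> 1"
proof -
  define D where "D = mat_sqrt (1\<^sub>m n - mat_adjoint K * K)"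
  define E where "E = mat_sqrt (1\<^sub>m n - K * mat_adjoint K)"
  note defect = defect_operators[OF K contr, folded D_def E_def]
  have adj: "mat_adjoint D = D" "mat_adjoint E = E"
    using defect(1,4) by (auto simp: psd_mat_def)
  have Ka: "mat_adjoint K \<in> carrier_mat n n"
    using K by simp
  define V where "V = op_eval (inverse_coeff p) T"
  define Zp where "Zp = mat_diag n (\<lambda>i. var_poly (b i) :: 'd mpolynomial)"
  define A where "A = 1\<^sub>m n - map_mat const_poly K * Zp"
  have pA: "p = Determinant.det A"
    by (simp add: p A_def Zp_def)
  note V = poly_op_inverse[OF p0 bound, folded V_def]
  define g where "g = map_mat const_poly D * Zp * adj_mat A * map_mat const_poly E -
    p \<cdot>\<^sub>m map_mat const_poly (mat_adjoint K)"
  have carr: "map_mat const_poly K \<in> carrier_mat n n" "map_mat const_poly D \<in> carrier_mat n n"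
    "map_mat const_poly E \<in> carrier_mat n n" "map_mat const_poly (mat_adjoint K) \<in> carrier_mat n n"
    "Zp \<in> carrier_mat n n"
    using K defect(2,5) by (auto simp: Zp_def)
  have A: "A \<in> carrier_mat n n"
    unfolding A_def using carr by (intro minus_carrier_mat) simp
  note B = adj_mat[OF A]
  have g: "g \<in> carrier_mat n n"
    unfolding g_def using carr by (intro minus_carrier_mat) simp
  have contr_g: "(\<Sum>i<n. norm (\<Sum>j<n. V (poly_op (g $$ (i, j)) (u j))) ^ 2) \<le> (\<Sum>i<n. norm (u i) ^ 2)" for u
    using transfer_contraction[OF K defect(2,5) adj defect(3,6,7), of b V u] V
    unfolding g_def pA A_def Zp_def by blast
  \<comment> \<open>\<open>p\<close> may vanish on the torus, but the scalar identity used at each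
    point involves no division.\<close>
  have det_g: "p * Determinant.det g = p ^ n * q"
  proof (rule mpoly_eqI_torus)
    fix z :: "complex ^ 'd::{finite,linorder}"
    let ?ev = "map_mat (\<lambda>r. peval r z)"
    let ?Z = "mat_diag n (\<lambda>i. z $ b i)"
    have Z: "?Z \<in> carrier_mat n n" by simp
    have ev_Zp: "?ev Zp = ?Z"
      by (rule eq_matI) (auto simp: Zp_def mat_diag_def)
    have ev_const: "?ev (map_mat const_poly M) = M" for M
      by (rule eq_matI) auto
    have ev_mult: "?ev (M * M') = ?ev M * ?ev M'" if "M \<in> carrier_mat n n" "M' \<in> carrier_mat n n" for M M'
      by (rule peval_hom.mat_hom_mult[OF that])
    have ev_minus: "?ev (M - M') = ?ev M - ?ev M'" if "M \<in> carrier_mat n n" "M' \<in> carrier_mat n n" for M M'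
      using that by (intro eq_matI) (auto simp: peval_hom.hom_minus)
    have ev_one: "?ev (1\<^sub>m n) = 1\<^sub>m n"
      by (rule eq_matI) auto
    have ev_A: "?ev A = 1\<^sub>m n - K * ?Z"
      unfolding A_def using carr by (simp add: ev_minus ev_mult ev_one ev_Zp ev_const)
    \<comment> \<open>The entries of the adjugate are signed minors, and determinants commute with
      the ring homomorphism \<open>peval\<close>.\<close>
    have ev_adj: "?ev (adj_mat A) = adj_mat (?ev A)"
    proof (rule eq_matI)
      fix i j assume "i < dim_row (adj_mat (?ev A))" "j < dim_col (adj_mat (?ev A))"
      then have ij: "i < n" "j < n"
        using A by (auto simp: adj_mat_def)
      have "?ev (mat_delete A j i) = mat_delete (?ev A) j i"
        by (rule eq_matI) (use A ij in \<open>auto simp: mat_delete_def\<close>)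
      then show "?ev (adj_mat A) $$ (i, j) = adj_mat (?ev A) $$ (i, j)"
        using A ij by (simp add: adj_mat_def cofactor_def peval_hom.hom_mult peval_hom.hom_power
            peval_hom.hom_uminus flip: peval_hom.hom_det)
    qed (use A in \<open>auto simp: adj_mat_def\<close>)
    have ev_smult: "?ev (p \<cdot>\<^sub>m M) = peval p z \<cdot>\<^sub>m ?ev M" for M
      by (rule eq_matI) (auto simp: peval_mult)
    have "?ev A \<in> carrier_mat n n"
      using A by simp
    note adj_carrier = adj_mat(1)[OF this]
    have ev_g: "?ev g = D * ?Z * adj_mat (?ev A) * E - peval p z \<cdot>\<^sub>m mat_adjoint K"
      unfolding g_def using carr B(1)
      using defect(2,5) Z adj_carrier
      by (simp add: ev_minus ev_mult ev_smult ev_const ev_Zp ev_adj assoc_mult_square[of _ n])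
    have ev_p: "peval p z = Determinant.det (?ev A)"
      unfolding pA by (rule peval_hom.hom_det [symmetric])
    have "Determinant.det (?ev A) * Determinant.det (?ev g) =
        Determinant.det (?ev A) ^ n * Determinant.det (?Z - mat_adjoint K)"
      unfolding ev_g ev_p ev_A D_def E_def by (rule det_transfer_numerator[OF K Z contr])
    then show "peval (p * Determinant.det g) z = peval (p ^ n * q) z"
      by (simp add: peval_mult peval_hom.hom_power q ev_p)
  qed
  have V_inv: "poly_op p (V x) = x" "V (poly_op p x) = x" for x
    using arg_cong[OF V(1), of "\<lambda>A. blinfun_apply A x"] arg_cong[OF V(2)[of p], of "\<lambda>A. blinfun_apply A x"]
    by simp_all
  have V_comm: "V (poly_op r x) = poly_op r (V x)" for r x
    using arg_cong[OF V(2)[of r], of "\<lambda>A. blinfun_apply A x"] by simp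
  have Vp: "(blinfun_apply V ^^ m) (poly_op (p ^ m * r) x) = poly_op r x" for m r x
    by (induction m arbitrary: r) (simp_all add: funpow_swap1 poly_op_mult V_inv mult.assoc)
  \<comment> \<open>Here det g(T) = V (p det g)(T) = V p(T)^n q(T), and the n further factors
    \<open>V\<close> cancel the n factors p(T).\<close>
  have Vdet: "(blinfun_apply V ^^ n) (poly_op (Determinant.det g) h) = V (poly_op q h)" for h
  proof -
    have "poly_op (Determinant.det g) h = V (poly_op (p * Determinant.det g) h)"
      by (simp add: poly_op_mult V_inv)
    also have "\<dots> = poly_op (p ^ n * q) (V h)"
      by (simp add: det_g V_comm)
    finally show ?thesis
      by (simp add: Vp V_comm)
  qed
  have "op_eval (conv_coeff q (inverse_coeff p)) T = poly_op q o\<^sub>L V"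
    using op_eval_conv_coeff[OF op_eval_has_sum[OF bound], of q] unfolding op_eval_def V_def
    by (rule infsumI)
  moreover have "norm (poly_op q o\<^sub>L V) \<le> 1"
  proof (rule norm_blinfun_bound)
    fix h
    show "norm ((poly_op q o\<^sub>L V) h) \<le> 1 * norm h"
      using det_contraction[OF V(2) g contr_g, of h] by (simp add: Vdet V_comm)
  qed simp
  ultimately show ?thesis by simp
qed

theorem theorem5p2:
  fixes p :: "(nat ^ 'd::{finite,linorder}) \<Rightarrow>\<^sub>0 complex"
    and n :: "nat ^ 'd::{finite,linorder}"
    and K :: "complex mat"
  assumes "K \<in> carrier_mat (msize n) (msize n)"
    and "mat_op_norm K \<le> 1"
    and "\<forall>z. peval p z = Determinant.det (1\<^sub>m (msize n) - K * Zmat n z)"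
  shows "(\<forall>z. peval p z \<noteq> 0 \<longrightarrow>
            reflection n p z / peval p z =
            Determinant.det (- mat_adjoint K +
              mat_sqrt (1\<^sub>m (msize n) - mat_adjoint K * K) * Zmat n z *
              the (mat_inverse (1\<^sub>m (msize n) - K * Zmat n z)) *
              mat_sqrt (1\<^sub>m (msize n) - K * mat_adjoint K)))
         \<and> eventual_agler_denominator TYPE('h::complex_hilbert) n p
         \<and> (multideg p = n \<longrightarrow> agler_denominator TYPE('h) p)"
proof -
  define N where "N = msize n"
  note K = assms(1)[folded N_def]
  have contr: "\<forall>v\<in>carrier_vec N. cvec_norm (K *\<^sub>v v) \<le> cvec_norm v"
    using cvec_norm_mat_le[OF K assms(2)] by blast
  have p: "peval p z = Determinant.det (1\<^sub>m N - K * Zmat n z)" for z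
    using assms(3) by (simp add: N_def)
  obtain b where b: "\<And>z. Zmat n z = mat_diag N (\<lambda>i. z $ b i)"
    using Zmat_eq_mat_diag[of n] unfolding N_def by metis
  have Z: "Zmat n z \<in> carrier_mat N N" for z
    by (simp add: b)
  have refl: "reflection n p z = Determinant.det (Zmat n z - mat_adjoint K)" for z
    by (rule reflection_eq_det[OF assms(1)]) (simp add: assms(3))
  define q where "q = Determinant.det (mat_diag N (\<lambda>i. var_poly (b i)) - map_mat const_poly (mat_adjoint K))"
  have q: "peval q z = Determinant.det (mat_diag N (\<lambda>i. z $ b i) - mat_adjoint K)" for z
    unfolding q_def peval_hom.hom_det[symmetric]
    by (rule arg_cong[of _ _ Determinant.det], rule eq_matI)
      (use K in \<open>auto simp: mat_diag_def peval_hom.hom_minus\<close>)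
  have refl_q: "reflection n p z = peval q z" for z
    unfolding refl q b ..
  have p_det: "p = Determinant.det (1\<^sub>m N - map_mat const_poly K * mat_diag N (\<lambda>i. var_poly (b i)))"
  proof (rule mpoly_eqI_torus)
    fix z :: "complex ^ 'd::{finite,linorder}"
    have "map_mat (\<lambda>r. peval r z) (1\<^sub>m N - map_mat const_poly K * mat_diag N (\<lambda>i. var_poly (b i))) =
        1\<^sub>m N - K * Zmat n z"
      using K by (intro eq_matI) (auto simp: b mat_diag_mult_right[of _ N N] peval_hom.hom_minus peval_mult)
    then show "peval p z =
        peval (Determinant.det (1\<^sub>m N - map_mat const_poly K * mat_diag N (\<lambda>i. var_poly (b i)))) z"
      unfolding p peval_hom.hom_det[symmetric] by simp
  qed
  \<comment> \<open>Z_n vanishes at the origin, so p(0) = 1, the normalisation under which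
    \<open>inverse_coeff\<close> is the reciprocal.\<close>
  have p0: "Poly_Mapping.lookup p 0 = 1"
  proof -
    have "1\<^sub>m N - K * Zmat n 0 = 1\<^sub>m N"
      using K by (intro eq_matI) (auto simp: b mat_diag_mult_right[of _ N N])
    then show ?thesis
      using p[of 0] by (simp add: peval_zero)
  qed
  \<comment> \<open>For \<open>z\<close> on the torus Z_n is unitary, so K Z_n is a contraction and
    its \<open>N\<close> eigenvalues, which are the numbers \<open>a\<close> in the factorisation of
    \<open>p\<close> along the line through \<open>z\<close>, lie in the closed disk.\<close>
  have bound: "cmod (inverse_coeff p k) \<le> real (msize k + 1) ^ N" for k
  proof (rule cmod_inverse_coeff_le[OF _ p0])
    fix z :: "complex ^ 'd::{finite,linorder}" assume z: "\<And>i. cmod (z $ i) = 1"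
    let ?M = "K * Zmat n z"
    have M: "?M \<in> carrier_mat N N"
      using K Z by simp
    obtain as where as: "char_poly ?M = (\<Prod>a\<leftarrow>as. [:- a, 1:])" "length as = N"
      using char_poly_factorized[OF M] by blast
    have "cmod a \<le> 1" if "a \<in> set as" for a
    proof (rule contraction_eigenvalue_le[OF M _ as(1) that])
      fix v :: "complex Matrix.vec" assume v: "v \<in> carrier_vec N"
      have "cvec_norm (K *\<^sub>v (Zmat n z *\<^sub>v v)) \<le> cvec_norm (Zmat n z *\<^sub>v v)"
        using contr mult_mat_vec_carrier[OF Z v] by blast
      also have "\<dots> \<le> cvec_norm v"
        unfolding b by (rule cvec_norm_mat_diag_le[OF v]) (simp add: z)
      finally show "cvec_norm (?M *\<^sub>v v) \<le> cvec_norm v"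
        unfolding assoc_mult_mat_vec[OF K Z v] .
    qed
    moreover have "peval p (\<chi> i. x * z $ i) = (\<Prod>a\<leftarrow>as. 1 - x * a)" for x
    proof -
      have "1\<^sub>m N - K * Zmat n (\<chi> i. x * z $ i) = 1\<^sub>m N - x \<cdot>\<^sub>m ?M"
        using K by (intro eq_matI) (auto simp: b mat_diag_mult_right[of _ N N])
      then show ?thesis
        unfolding p using det_one_minus_smult[OF M as] by simp
    qed
    ultimately show "\<exists>as. length as = N \<and> (\<forall>a\<in>set as. cmod a \<le> 1) \<and>
        (\<forall>x. peval p (\<chi> i. x * z $ i) = (\<Prod>a\<leftarrow>as. 1 - x * a))"
      using as(2) by blast
  qed
  have "eventual_agler_denominator TYPE('h) n p"
    unfolding eventual_agler_denominator_def
  \<comment> \<open>The witness is q/p, with \<open>q\<close> the polynomial form of the reflection: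
    unlike the expression with 1/z it is meaningful also where a coordinate vanishes.\<close>
  proof (intro conjI bexI[of _ "\<lambda>z. peval q z / peval p z"] ballI impI)
    show "semi_stable p"
      unfolding semi_stable_def using inverse_coeff_has_sum(1)[OF p0 bound] by blast
    fix z :: "complex ^ 'd::{finite,linorder}" assume "\<forall>i. z $ i \<noteq> 0"
    then show "peval q z / peval p z = monomial z n * peval (conj_poly p) (\<chi> i. 1 / z $ i) / peval p z"
      using reflection_eq[of z n p] by (simp add: refl_q)
  next
    let ?c = "conv_coeff q (inverse_coeff p)"
    have "(SUP T\<in>strict_contraction_tuples. ennreal (norm (op_eval ?c (T :: 'd \<Rightarrow> ('h \<Rightarrow>\<^sub>L 'h))))) \<le> 1"
    proof (rule SUP_least)
      fix T :: "'d \<Rightarrow> ('h \<Rightarrow>\<^sub>L 'h)" assume "T \<in> strict_contraction_tuples"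
      then interpret commuting_tuple T
        by unfold_locales (auto simp: strict_contraction_tuples_def)
      show "ennreal (norm (op_eval ?c T)) \<le> 1"
        using norm_op_eval_quotient_le[OF K contr p_det q p0 bound]
        by (metis ennreal_1 ennreal_leI)
    qed
    then show "(\<lambda>z. peval q z / peval p z) \<in> schur_agler TYPE('h)"
      unfolding schur_agler_def using inverse_coeff_has_sum(2)[OF p0 bound] by blast
  qed
  moreover have "reflection n p z / peval p z =
      Determinant.det (- mat_adjoint K +
        mat_sqrt (1\<^sub>m N - mat_adjoint K * K) * Zmat n z *
        the (mat_inverse (1\<^sub>m N - K * Zmat n z)) *
        mat_sqrt (1\<^sub>m N - K * mat_adjoint K))" if "peval p z \<noteq> 0" for z
    using det_transfer_function[OF K Z contr, of z] that unfolding refl p by simp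
  ultimately show ?thesis
    unfolding agler_denominator_def N_def by auto
qed

end
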